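(* For every integer $e \geq 3$, $$ f_3\left(n,\, e+\frac{18\log e}{\log\log e},\, e\right) = o(n^2) \quad \text{as } n \to \infty . $$ Equivalently: for every integer $e\ge 3$ and every $\varepsilon\in(0,1)$ there is $n_0$ such that every $3$-uniform hypergraph with $n\ge n_0$ vertices and at least $\varepsilon n^2$ edges contains $e$ edges whose union has at most $e+18\log e/\log\log e$ vertices.
   Context: An $r$-uniform hypergraph ($r$-graph) has a vertex set $V$ of size $n$ and an edge set consisting of $r$-element subsets of $V$. A $(v,e)$-configuration is a hypergraph with exactly $e$ edges and at most $v$ vertices; an $r$-graph contains a $(v,e)$-configuration if it has $e$ edges whose union has at most $v$ vertices. $f_r(n,v,e)$ denotes the largest number of edges in an $n$-vertex $r$-graph containing no $(v,e)$-configuration. All logarithms are natural. *)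

theory Defs
  imports Complex_Main "HOL-Library.Landau_Symbols"
begin

definition uniform_hypergraph :: "nat \<Rightarrow> 'a set \<Rightarrow> 'a set set \<Rightarrow> bool" where
  "uniform_hypergraph r V E \<longleftrightarrow> finite V \<and> (\<forall>A\<in>E. A \<subseteq> V \<and> card A = r)"

text \<open>The vertex bound \<open>v\<close> is real, since it is later instantiated by a non-integer expression.\<close>

definition contains_configuration :: "'a set set \<Rightarrow> real \<Rightarrow> nat \<Rightarrow> bool" where
  "contains_configuration E v e \<longleftrightarrow>
     (\<exists>F \<subseteq> E. finite F \<and> card F = e \<and> real (card (\<Union>F)) \<le> v)"

text \<open>
  Up to isomorphism the vertex set may be taken to be \<open>{..<n}\<close>.  The set below is finite, and
  nonempty for \<open>e > 0\<close> because of the edgeless hypergraph, so \<open>Max\<close> is a genuine maximum;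
  for \<open>e = 0\<close> and \<open>v \<ge> 0\<close> no hypergraph avoids the configuration and the value is meaningless.
\<close>

definition max_edges :: "nat \<Rightarrow> nat \<Rightarrow> real \<Rightarrow> nat \<Rightarrow> nat" where
  "max_edges r n v e =
     Max {card E | E. uniform_hypergraph r {..<n} E \<and> \<not> contains_configuration E v e}"

end

theory Submission
  imports Defs "HOL-Library.FuncSet"
begin

text \<open>
  Call an edge set built from \<open>\<zeta>\<close> vertices if its edges can be ordered so that every edge
  meets the \<open>\<zeta>\<close> given vertices and the earlier edges in at least two vertices. Its initial segments
  with \<open>e\<close> edges span at most \<open>e + \<zeta>\<close> vertices, so it suffices to build at least \<open>e\<close> edges from few
  vertices. If this gets stuck at fewer than \<open>e\<close> edges spanning no more vertices than there are edges,
  vertex-disjoint copies of such configurations are collected instead.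

  In a linear 3-graph the third vertex of an edge is a partial operation on pairs, and a walk
  \<open>a = \<sigma> 0, \<dots>, \<sigma> p = z\<close> with letters \<open>y 1, \<dots>, y p\<close> and edges \<open>{\<sigma> i, y (i + 1), \<sigma> (i + 1)}\<close> is determined
  by any \<open>p\<close> of \<open>a, y 1, \<dots>, y p\<close> (for fixed \<open>z\<close>). By the removal lemma for \<open>p\<close>-uniform simplices, for a positive
  proportion of the pairs of a word and a new starting point \<open>a'\<close>, each single letter of the word can be
  replaced so that the new word leads from \<open>a'\<close> to \<open>z\<close>. Iterating this \<open>k\<close> times with generic
  starting points gives about \<open>p ! / (p - k) !\<close> different words, all built from \<open>p + k + 1\<close> vertices. Walking along all of
  them from one further point, one either sees many edges, or so many coincidences
  that there are at least as many edges as vertices. Taking \<open>p = 2 k\<close> with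
  \<open>k ^ k \<ge> e 2 ^ (3 k + 1)\<close> gives the bound.

  The removal lemma is proved by splitting, level by level, every \<open>B\<close>-measurable colouring of the cube into a
  part determined by lower-order data and a uniform random choice that is independent of it. After that
  the densities in question are those of independent events.
\<close>

section \<open>Averages and conditional expectations on finite sets\<close>

text \<open>Why \<open>log e / log log e\<close>: each of the \<open>k\<close> generic starting
  points costs one free vertex and multiplies the number of words by at least \<open>k\<close>, so a
  cost linear in \<open>k\<close> buys \<open>k ^ k\<close> words. The factor
  \<open>2 ^ (3 * k + 1)\<close> is the price of coincidences: unless edges catch up with vertices,
  the \<open>p + k + 1 = 3 * k + 1\<close> vertices spent before the last walk bound the cyclomatic
  number of the graph of walks, and a layered graph of cyclomatic number \<open>c\<close> carries at
  most \<open>2 ^ c\<close> walks from one vertex to each endpoint.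

  Why removal: a point of the cube of dimension \<open>p + 1\<close>, each of whose coordinates can
  be changed to give a word leading to \<open>z\<close>, is a simplex whose facets come from words.
  The words themselves are only of order \<open>n ^ p\<close> trivial simplices. Removal raises this
  to order \<open>n ^ (p + 1)\<close>, and the extra degree of freedom is what lets the new starting
  point avoid the boundedly many bad choices. Without genericity a replaced letter could be an old
  one, and the words need not differ.\<close>

definition avg :: "'x set \<Rightarrow> ('x \<Rightarrow> real) \<Rightarrow> real" where
  "avg X f = (\<Sum>x\<in>X. f x) / real (card X)"

lemma avg_add: "avg X (\<lambda>x. f x + g x) = avg X f + avg X g"
  by (simp add: avg_def sum.distrib add_divide_distrib)

lemma avg_diff: "avg X (\<lambda>x. f x - g x) = avg X f - avg X g"
  by (simp add: avg_def sum_subtractf diff_divide_distrib)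

lemma avg_cmult: "avg X (\<lambda>x. c * f x) = c * avg X f"
  by (simp add: avg_def sum_distrib_left)

lemma avg_sum: "avg X (\<lambda>x. \<Sum>i\<in>I. f i x) = (\<Sum>i\<in>I. avg X (f i))"
  unfolding avg_def by (subst sum.swap) (simp add: sum_divide_distrib)

lemma avg_cong: "(\<And>x. x \<in> X \<Longrightarrow> f x = g x) \<Longrightarrow> avg X f = avg X g"
  by (simp add: avg_def cong: sum.cong)

lemma avg_mono: "(\<And>x. x \<in> X \<Longrightarrow> f x \<le> g x) \<Longrightarrow> avg X f \<le> avg X g"
  by (simp add: avg_def divide_right_mono sum_mono)

lemma avg_nonneg: "(\<And>x. x \<in> X \<Longrightarrow> 0 \<le> f x) \<Longrightarrow> 0 \<le> avg X f"
  by (simp add: avg_def sum_nonneg)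

lemma avg_const: "finite X \<Longrightarrow> X \<noteq> {} \<Longrightarrow> avg X (\<lambda>x. c) = c"
  by (simp add: avg_def)

lemma avg_abs: "\<bar>avg X f\<bar> \<le> avg X (\<lambda>x. \<bar>f x\<bar>)"
  by (simp add: avg_def divide_right_mono)

lemma avg_abs_le_sqrt:
  assumes "finite X" "X \<noteq> {}"
  shows "avg X (\<lambda>x. \<bar>f x\<bar>) \<le> sqrt (avg X (\<lambda>x. (f x)\<^sup>2))"
proof (rule real_le_rsqrt)
  let ?a = "avg X (\<lambda>x. \<bar>f x\<bar>)"
  have "0 \<le> avg X (\<lambda>x. (\<bar>f x\<bar> - ?a)\<^sup>2)" by (intro avg_nonneg) simp
  also have "\<dots> = avg X (\<lambda>x. (f x)\<^sup>2 - (2 * ?a) * \<bar>f x\<bar> + ?a\<^sup>2)"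
    by (intro avg_cong) (simp add: power2_diff)
  also have "\<dots> = avg X (\<lambda>x. (f x)\<^sup>2) - (2 * ?a) * ?a + ?a\<^sup>2"
    unfolding avg_add avg_diff avg_cmult using assms by (simp add: avg_const)
  finally show "?a\<^sup>2 \<le> avg X (\<lambda>x. (f x)\<^sup>2)" by (simp add: power2_eq_square)
qed

text \<open>Conditional expectation with respect to the partition of \<open>X\<close> into level
  sets of \<open>L\<close>. Partitions are carried by labels, so that refinement becomes an
  implication between equalities of labels.\<close>

definition cexp :: "'x set \<Rightarrow> ('x \<Rightarrow> 'l) \<Rightarrow> ('x \<Rightarrow> real) \<Rightarrow> 'x \<Rightarrow> real" where
  "cexp X L f x = avg {y\<in>X. L y = L x} f"

lemma cexp_cong_label: "L x = L y \<Longrightarrow> cexp X L f x = cexp X L f y"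
  by (simp add: cexp_def)

lemma cexp_bounds:
  assumes "finite X" "x \<in> X" "\<And>y. y \<in> X \<Longrightarrow> 0 \<le> f y \<and> f y \<le> 1"
  shows "0 \<le> cexp X L f x" "cexp X L f x \<le> 1"
proof -
  have ne: "{y\<in>X. L y = L x} \<noteq> {}" "finite {y\<in>X. L y = L x}" using assms by auto
  show "0 \<le> cexp X L f x" unfolding cexp_def using assms by (intro avg_nonneg) auto
  have "cexp X L f x \<le> avg {y\<in>X. L y = L x} (\<lambda>_. 1)"
    unfolding cexp_def using assms by (intro avg_mono) auto
  then show "cexp X L f x \<le> 1" using ne by (simp add: avg_const)
qed

lemma cexp_pos:
  assumes "finite X" "x \<in> X" "\<And>y. y \<in> X \<Longrightarrow> 0 \<le> f y" "0 < f x"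
  shows "0 < cexp X L f x"
proof -
  have "f x \<le> (\<Sum>y | y \<in> X \<and> L y = L x. f y)"
    using assms by (intro member_le_sum) auto
  moreover have "card {y\<in>X. L y = L x} > 0" using assms by (auto simp: card_gt_0_iff)
  ultimately show ?thesis using assms(4) by (simp add: cexp_def avg_def)
qed

text \<open>The defining property of conditional expectation, summed over one class of
  \<open>L\<close> at a time: both \<open>cexp X L f\<close> and \<open>\<phi>\<close> are constant
  there.\<close>

lemma avg_cexp_mult:
  assumes "finite X" and \<phi>: "\<And>x y. x \<in> X \<Longrightarrow> y \<in> X \<Longrightarrow> L x = L y \<Longrightarrow> \<phi> x = \<phi> y"
  shows "avg X (\<lambda>x. cexp X L f x * \<phi> x) = avg X (\<lambda>x. f x * \<phi> x)"
proof -
  have "(\<Sum>x\<in>X. cexp X L f x * \<phi> x) = (\<Sum>l\<in>L ` X. \<Sum>x | x \<in> X \<and> L x = l. cexp X L f x * \<phi> x)"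
    using assms(1) by (rule sum.image_gen)
  also have "\<dots> = (\<Sum>l\<in>L ` X. \<Sum>x | x \<in> X \<and> L x = l. f x * \<phi> x)"
  proof (rule sum.cong)
    fix l assume "l \<in> L ` X"
    then obtain z where z: "z \<in> X" "l = L z" by auto
    let ?A = "{x\<in>X. L x = l}"
    have c: "card ?A > 0" using z assms(1) by (auto simp: card_gt_0_iff)
    have "(\<Sum>x\<in>?A. cexp X L f x * \<phi> x) = (\<Sum>x\<in>?A. avg ?A f * \<phi> z)"
      using z by (intro sum.cong) (auto simp: cexp_def intro: \<phi>)
    also have "\<dots> = (\<Sum>x\<in>?A. f x) * \<phi> z" using c by (simp add: avg_def)
    also have "\<dots> = (\<Sum>x\<in>?A. f x * \<phi> x)"
      unfolding sum_distrib_right using z by (intro sum.cong) (auto intro: \<phi>)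
    finally show "(\<Sum>x\<in>?A. cexp X L f x * \<phi> x) = (\<Sum>x\<in>?A. f x * \<phi> x)" .
  qed simp
  also have "\<dots> = (\<Sum>x\<in>X. f x * \<phi> x)"
    using assms(1) by (rule sum.image_gen[symmetric])
  finally show ?thesis by (simp add: avg_def)
qed

text \<open>Pythagoras: when \<open>L'\<close> refines \<open>L\<close>, the coarse conditional
  expectation is the orthogonal projection of the fine one.\<close>

lemma energy_increment:
  assumes "finite X" and ref: "\<And>x y. x \<in> X \<Longrightarrow> y \<in> X \<Longrightarrow> L' x = L' y \<Longrightarrow> L x = L y"
  shows "avg X (\<lambda>x. (cexp X L' f x - cexp X L f x)\<^sup>2)
    = avg X (\<lambda>x. (cexp X L' f x)\<^sup>2) - avg X (\<lambda>x. (cexp X L f x)\<^sup>2)"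
proof -
  have 1: "avg X (\<lambda>x. cexp X L' f x * cexp X L f x) = avg X (\<lambda>x. f x * cexp X L f x)"
    using assms(1) by (rule avg_cexp_mult) (auto intro: cexp_cong_label ref)
  have 2: "avg X (\<lambda>x. cexp X L f x * cexp X L f x) = avg X (\<lambda>x. f x * cexp X L f x)"
    using assms(1) by (rule avg_cexp_mult) (auto intro: cexp_cong_label)
  have "avg X (\<lambda>x. (cexp X L' f x - cexp X L f x)\<^sup>2) =
    avg X (\<lambda>x. (cexp X L' f x)\<^sup>2 - 2 * (cexp X L' f x * cexp X L f x) + cexp X L f x * cexp X L f x)"
    by (intro avg_cong) (simp add: power2_eq_square algebra_simps)
  also have "\<dots> = avg X (\<lambda>x. (cexp X L' f x)\<^sup>2) - avg X (\<lambda>x. cexp X L f x * cexp X L f x)"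
    unfolding avg_add avg_diff avg_cmult 1 2 by simp
  finally show ?thesis by (simp add: power2_eq_square)
qed

lemma cexp_sum: "(\<Sum>i\<in>I. cexp X L (f i) x) = cexp X L (\<lambda>x. \<Sum>i\<in>I. f i x) x"
  by (simp add: cexp_def avg_sum)

section \<open>Functions on cubes\<close>

definition cube :: "nat \<Rightarrow> 'a set \<Rightarrow> (nat \<Rightarrow> 'a) set" where
  "cube m V = {..<m} \<rightarrow>\<^sub>E V"

definition dep :: "nat \<Rightarrow> 'a set \<Rightarrow> nat set \<Rightarrow> ((nat \<Rightarrow> 'a) \<Rightarrow> 'b) \<Rightarrow> bool" where
  "dep m V B f \<longleftrightarrow> (\<forall>x\<in>cube m V. \<forall>y\<in>cube m V. (\<forall>i\<in>B. x i = y i) \<longrightarrow> f x = f y)"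

definition mix :: "nat set \<Rightarrow> (nat \<Rightarrow> 'a) \<Rightarrow> (nat \<Rightarrow> 'a) \<Rightarrow> nat \<Rightarrow> 'a" where
  "mix B x y = (\<lambda>i. if i \<in> B then x i else y i)"

lemma finite_cube [simp]: "finite V \<Longrightarrow> finite (cube m V)"
  by (simp add: cube_def finite_PiE)

lemma cube_nonempty [simp]: "V \<noteq> {} \<Longrightarrow> cube m V \<noteq> {}"
  by (simp add: cube_def PiE_eq_empty_iff)

lemma card_cube: "card (cube m V) = card V ^ m"
  by (simp add: cube_def card_PiE)

lemma mix_in_cube: "x \<in> cube m V \<Longrightarrow> y \<in> cube m V \<Longrightarrow> mix B x y \<in> cube m V"
  by (auto simp: cube_def mix_def PiE_def extensional_def)

lemma fun_upd_in_cube: "x \<in> cube m V \<Longrightarrow> i < m \<Longrightarrow> v \<in> V \<Longrightarrow> x(i := v) \<in> cube m V"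
  by (auto simp: cube_def PiE_def extensional_def)

lemma cube_eqI:
  "x \<in> cube m V \<Longrightarrow> y \<in> cube m V \<Longrightarrow> (\<And>i. i < m \<Longrightarrow> x i = y i) \<Longrightarrow> x = y"
  unfolding cube_def by (rule PiE_ext) auto

lemma depD:
  assumes "dep m V B f" "x \<in> cube m V" "y \<in> cube m V" "\<And>i. i \<in> B \<Longrightarrow> x i = y i"
  shows "f x = f y"
  using assms unfolding dep_def by blast

lemma depI:
  assumes "\<And>x y. x \<in> cube m V \<Longrightarrow> y \<in> cube m V \<Longrightarrow> (\<And>i. i \<in> B \<Longrightarrow> x i = y i) \<Longrightarrow> f x = f y"
  shows "dep m V B f"
  unfolding dep_def using assms by blast

text \<open>Outside \<open>{..<m}\<close> all points of the cube are \<open>undefined\<close>, so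
  only coordinates below \<open>m\<close> matter. Hence \<open>-{b}\<close> can stand for all
  coordinates but \<open>b\<close>.\<close>

lemma dep_mono: "dep m V B f \<Longrightarrow> B \<inter> {..<m} \<subseteq> C \<Longrightarrow> dep m V C f"
proof (rule depI)
  fix x y assume f: "dep m V B f" and B: "B \<inter> {..<m} \<subseteq> C"
    and xy: "x \<in> cube m V" "y \<in> cube m V" "\<And>i. i \<in> C \<Longrightarrow> x i = y i"
  show "f x = f y"
  proof (rule depD[OF f xy(1,2)])
    fix i assume "i \<in> B"
    then show "x i = y i"
      using B xy by (cases "i < m") (auto simp: cube_def PiE_def extensional_def)
  qed
qed

lemma dep_comp: "dep m V B f \<Longrightarrow> dep m V B (\<lambda>x. F (f x))"
  unfolding dep_def by (intro ballI impI arg_cong[where f = F]) blast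

lemma dep_comp2:
  assumes "dep m V B f" "dep m V B g"
  shows "dep m V B (\<lambda>x. F (f x) (g x))"
  using assms unfolding dep_def by (intro ballI impI arg_cong2[where f = F]) blast+

lemma dep_const [simp]: "dep m V B (\<lambda>x. c)"
  by (simp add: dep_def)

lemma dep_mix:
  assumes "dep m V B f" "y \<in> cube m V"
  shows "dep m V (B \<inter> C) (\<lambda>x. f (mix C x y))"
proof (rule depI)
  fix x x' assume x: "x \<in> cube m V" "x' \<in> cube m V" "\<And>i. i \<in> B \<inter> C \<Longrightarrow> x i = x' i"
  show "f (mix C x y) = f (mix C x' y)"
    using x(3) by (intro depD[OF assms(1)] mix_in_cube x assms(2)) (simp add: mix_def)
qed

lemma dep_prod:
  "(\<And>i. i \<in> I \<Longrightarrow> dep m V B (f i)) \<Longrightarrow> dep m V B (\<lambda>x. \<Prod>i\<in>I. f i x)"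
  unfolding dep_def by (intro ballI impI prod.cong refl) blast

lemma dep_sum:
  "(\<And>i. i \<in> I \<Longrightarrow> dep m V B (f i)) \<Longrightarrow> dep m V B (\<lambda>x. \<Sum>i\<in>I. f i x)"
  unfolding dep_def by (intro ballI impI sum.cong refl) blast

section \<open>Averaging over spliced points; from test functions to test sets\<close>

lemma avg_swap: "avg X (\<lambda>x. avg Y (\<lambda>y. f x y)) = avg Y (\<lambda>y. avg X (\<lambda>x. f x y))"
proof -
  have "(\<Sum>x\<in>X. (\<Sum>y\<in>Y. f x y) / card Y) / card X = (\<Sum>x\<in>X. \<Sum>y\<in>Y. f x y) / card Y / card X"
    by (simp add: sum_divide_distrib)
  also have "\<dots> = (\<Sum>y\<in>Y. \<Sum>x\<in>X. f x y) / card X / card Y"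
    by (subst sum.swap) (simp add: field_simps)
  also have "\<dots> = (\<Sum>y\<in>Y. (\<Sum>x\<in>X. f x y) / card X) / card Y"
    by (simp add: sum_divide_distrib)
  finally show ?thesis by (simp add: avg_def)
qed

text \<open>Splicing two independent uniform points along \<open>B\<close> gives a uniform point:
  exchanging the coordinates outside \<open>B\<close> is an involution on pairs of points.\<close>

lemma avg_mix:
  assumes V: "finite V" "V \<noteq> {}"
  shows "avg (cube m V) (\<lambda>y. avg (cube m V) (\<lambda>x. F (mix B x y))) = avg (cube m V) F"
proof -
  let ?X = "cube m V"
  let ?T = "\<lambda>(x, y). (mix B x y, mix B y x)"
  have "(\<Sum>x\<in>?X. \<Sum>y\<in>?X. F (mix B x y)) = (\<Sum>p\<in>?X \<times> ?X. F (fst (?T p)))"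
    by (simp add: sum.cartesian_product case_prod_beta)
  also have "\<dots> = (\<Sum>p\<in>?X \<times> ?X. F (fst p))"
    by (rule sum.reindex_bij_witness[of _ ?T ?T])
       (auto simp: mix_in_cube, auto simp: mix_def fun_eq_iff)
  also have "\<dots> = (\<Sum>x\<in>?X. \<Sum>y\<in>?X. F x)"
    by (simp add: sum.cartesian_product case_prod_beta del: sum_constant)
  also have "\<dots> = card ?X * (\<Sum>x\<in>?X. F x)" by (simp add: sum_distrib_left)
  finally have "(\<Sum>y\<in>?X. \<Sum>x\<in>?X. F (mix B x y)) = card ?X * (\<Sum>x\<in>?X. F x)"
    by (subst sum.swap)
  moreover have "card ?X > 0" using V by (simp add: card_gt_0_iff)
  ultimately show ?thesis
    unfolding avg_def sum_divide_distrib[symmetric] by simp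
qed

text \<open>A linear functional on the \<open>[0, 1]\<close>-valued functions of the coordinates in
  \<open>C\<close> is extremal at an indicator function. The extremal sets are given by the sign of
  \<open>P\<close>, the conditional expectation of \<open>G\<close> given these coordinates.\<close>

lemma test_set_exists:
  assumes V: "finite V" "V \<noteq> {}" and h: "dep m V C h" "\<And>x. x \<in> cube m V \<Longrightarrow> 0 \<le> h x \<and> h x \<le> (1::real)"
    and "\<delta> < \<bar>avg (cube m V) (\<lambda>x. G x * h x)\<bar>"
  shows "\<exists>D. dep m V C (\<lambda>x. x \<in> D) \<and> \<delta> < \<bar>avg (cube m V) (\<lambda>x. G x * of_bool (x \<in> D))\<bar>"
proof -
  let ?X = "cube m V"
  define P where "P x = avg ?X (\<lambda>y. G (mix C x y))" for x
  have dP: "dep m V C P"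
  proof (rule depI)
    fix x x' :: "nat \<Rightarrow> 'a" assume "\<And>i. i \<in> C \<Longrightarrow> x i = x' i"
    then have "mix C x = mix C x'" by (auto simp: mix_def fun_eq_iff)
    then show "P x = P x'" by (simp add: P_def)
  qed
  have key: "avg ?X (\<lambda>x. G x * k x) = avg ?X (\<lambda>x. P x * k x)" if k: "dep m V C k" for k
  proof -
    have "avg ?X (\<lambda>x. G x * k x) = avg ?X (\<lambda>y. avg ?X (\<lambda>x. G (mix C x y) * k (mix C x y)))"
      by (rule avg_mix[OF V, symmetric])
    also have "\<dots> = avg ?X (\<lambda>y. avg ?X (\<lambda>x. k x * G (mix C x y)))"
    proof (intro avg_cong)
      fix x y assume "x \<in> ?X" "y \<in> ?X"
      then have "k (mix C x y) = k x"
        by (intro depD[OF k]) (auto simp: mix_in_cube, auto simp: mix_def)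
      then show "G (mix C x y) * k (mix C x y) = k x * G (mix C x y)" by simp
    qed
    also have "\<dots> = avg ?X (\<lambda>x. avg ?X (\<lambda>y. k x * G (mix C x y)))" by (rule avg_swap)
    also have "\<dots> = avg ?X (\<lambda>x. P x * k x)" by (simp add: avg_cmult P_def mult.commute)
    finally show ?thesis .
  qed
  define D1 where "D1 = {x. P x > 0}"
  define D2 where "D2 = {x. P x < 0}"
  have d: "dep m V C (\<lambda>x. x \<in> D1)" "dep m V C (\<lambda>x. x \<in> D2)"
    unfolding D1_def D2_def mem_Collect_eq
    using dep_comp[OF dP, of "\<lambda>u. u > 0"] dep_comp[OF dP, of "\<lambda>u. u < 0"] by this
  have "avg ?X (\<lambda>x. P x * h x) \<le> avg ?X (\<lambda>x. P x * of_bool (x \<in> D1))"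
  proof (rule avg_mono)
    fix x assume "x \<in> ?X"
    then have "0 \<le> h x" "h x \<le> 1" using h by auto
    then show "P x * h x \<le> P x * of_bool (x \<in> D1)"
      by (auto simp: D1_def mult_left_le mult_nonpos_nonneg)
  qed
  moreover have "avg ?X (\<lambda>x. P x * of_bool (x \<in> D2)) \<le> avg ?X (\<lambda>x. P x * h x)"
  proof (rule avg_mono)
    fix x assume "x \<in> ?X"
    then have "0 \<le> h x" "h x \<le> 1" using h by auto
    moreover then have "P x * 1 \<le> P x * h x" if "P x < 0"
      using that by (intro mult_left_mono_neg) auto
    ultimately show "P x * of_bool (x \<in> D2) \<le> P x * h x"
      by (cases "P x < 0") (auto simp: D2_def)
  qed
  moreover have "dep m V C (\<lambda>x. of_bool (x \<in> D1) :: real)" "dep m V C (\<lambda>x. of_bool (x \<in> D2) :: real)"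
    using d[THEN dep_comp[where F = of_bool]] by this
  ultimately have "\<delta> < \<bar>avg ?X (\<lambda>x. G x * of_bool (x \<in> D1))\<bar> \<or> \<delta> < \<bar>avg ?X (\<lambda>x. G x * of_bool (x \<in> D2))\<bar>"
    using assms(5) key[OF h(1)] key[of "\<lambda>x. of_bool (x \<in> D1)"] key[of "\<lambda>x. of_bool (x \<in> D2)"]
    by linarith
  then show ?thesis using d by blast
qed

text \<open>One factor at a time; the factors not being treated count as part of
  \<open>g\<close>.\<close>

lemma test_sets_exist:
  assumes V: "finite V" "V \<noteq> {}" and "finite B"
    and "\<And>b. b \<in> B \<Longrightarrow> dep m V (C b) (h b)"
    and "\<And>b x. b \<in> B \<Longrightarrow> x \<in> cube m V \<Longrightarrow> 0 \<le> h b x \<and> h b x \<le> (1::real)"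
    and "\<delta> < \<bar>avg (cube m V) (\<lambda>x. g x * (\<Prod>b\<in>B. h b x))\<bar>"
  shows "\<exists>D. (\<forall>b\<in>B. dep m V (C b) (\<lambda>x. x \<in> D b)) \<and>
     \<delta> < \<bar>avg (cube m V) (\<lambda>x. g x * (\<Prod>b\<in>B. of_bool (x \<in> D b)))\<bar>"
  using assms(3-)
proof (induction B arbitrary: g rule: finite_induct)
  case empty
  then show ?case by simp
next
  case (insert b B)
  have "\<delta> < \<bar>avg (cube m V) (\<lambda>x. (g x * h b x) * (\<Prod>b\<in>B. h b x))\<bar>"
    using insert.prems(3) insert.hyps by (simp add: mult.assoc)
  from insert.IH[OF _ _ this] insert.prems obtain D where
    D: "\<forall>b\<in>B. dep m V (C b) (\<lambda>x. x \<in> D b)"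
      "\<delta> < \<bar>avg (cube m V) (\<lambda>x. g x * h b x * (\<Prod>b\<in>B. of_bool (x \<in> D b)))\<bar>" by auto
  have "\<delta> < \<bar>avg (cube m V) (\<lambda>x. (g x * (\<Prod>b\<in>B. of_bool (x \<in> D b))) * h b x)\<bar>"
    using D(2) by (simp only: ac_simps)
  from test_set_exists[OF V insert.prems(1)[OF insertI1] insert.prems(2)[OF insertI1] this] obtain D' where
    D': "dep m V (C b) (\<lambda>x. x \<in> D')"
     "\<delta> < \<bar>avg (cube m V) (\<lambda>x. g x * (\<Prod>b\<in>B. of_bool (x \<in> D b)) * of_bool (x \<in> D'))\<bar>" by auto
  have eq: "(\<Prod>c\<in>insert b B. of_bool (x \<in> (D(b := D')) c)) =
    (of_bool (x \<in> D') * (\<Prod>c\<in>B. of_bool (x \<in> D c)) :: real)" for x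
  proof -
    have "(\<Prod>c\<in>B. of_bool (x \<in> (D(b := D')) c)) = (\<Prod>c\<in>B. of_bool (x \<in> D c) :: real)"
      using insert.hyps by (intro prod.cong) auto
    then show ?thesis using insert.hyps by simp
  qed
  show ?case
  proof (intro exI conjI)
    show "\<forall>c\<in>insert b B. dep m V (C c) (\<lambda>x. x \<in> (D(b := D')) c)"
      using D(1) D'(1) insert.hyps by auto
    show "\<delta> < \<bar>avg (cube m V) (\<lambda>x. g x * (\<Prod>c\<in>insert b B. of_bool (x \<in> (D(b := D')) c)))\<bar>"
      unfolding eq using D'(2) by (simp only: ac_simps)
  qed
qed

text \<open>Each test misses one coordinate of \<open>B\<close>, but may use the coordinates outside
  \<open>B\<close> freely.\<close>

definition tests :: "nat \<Rightarrow> 'a set \<Rightarrow> nat set \<Rightarrow> (nat \<Rightarrow> (nat \<Rightarrow> 'a) \<Rightarrow> real) \<Rightarrow> bool" where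
  "tests m V B h \<longleftrightarrow> (\<forall>b\<in>B. dep m V (-{b}) (h b) \<and> (\<forall>x\<in>cube m V. 0 \<le> h b x \<and> h b x \<le> 1))"

text \<open>The form of pseudorandomness that counting needs: no correlation with data of lower
  order. For two coordinates this bounds the cut norm.\<close>

definition unif :: "nat \<Rightarrow> 'a set \<Rightarrow> nat set \<Rightarrow> real \<Rightarrow> ((nat \<Rightarrow> 'a) \<Rightarrow> real) \<Rightarrow> bool" where
  "unif m V B \<delta> g \<longleftrightarrow> (\<forall>h. tests m V B h \<longrightarrow> \<bar>avg (cube m V) (\<lambda>x. g x * (\<Prod>b\<in>B. h b x))\<bar> \<le> \<delta>)"

text \<open>Some choice of the coordinates outside \<open>B\<close> keeps the correlation large.
  Fixing them turns tests on \<open>-{b}\<close> into tests on \<open>B - {b}\<close>, which can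
  then be replaced by sets.\<close>

lemma not_unif_imp_sets:
  assumes V: "finite V" "V \<noteq> {}" and "finite B" and g: "dep m V B g" and "\<not> unif m V B \<delta> g"
  shows "\<exists>D. (\<forall>b\<in>B. dep m V (B - {b}) (\<lambda>x. x \<in> D b)) \<and>
     \<delta> < \<bar>avg (cube m V) (\<lambda>x. g x * (\<Prod>b\<in>B. of_bool (x \<in> D b)))\<bar>"
proof -
  let ?X = "cube m V"
  obtain h where h: "tests m V B h" and big: "\<delta> < \<bar>avg ?X (\<lambda>x. g x * (\<Prod>b\<in>B. h b x))\<bar>"
    using assms(5) unfolding unif_def not_all not_imp not_le by blast
  define A where "A y = avg ?X (\<lambda>x. g x * (\<Prod>b\<in>B. h b (mix B x y)))" for y
  have "avg ?X (\<lambda>x. g x * (\<Prod>b\<in>B. h b x)) =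
     avg ?X (\<lambda>y. avg ?X (\<lambda>x. g (mix B x y) * (\<Prod>b\<in>B. h b (mix B x y))))"
    by (rule avg_mix[OF V, symmetric])
  also have "\<dots> = avg ?X A"
    unfolding A_def
  proof (intro avg_cong)
    fix x y assume "x \<in> ?X" "y \<in> ?X"
    then have "g (mix B x y) = g x"
      by (intro depD[OF g]) (auto simp: mix_in_cube, auto simp: mix_def)
    then show "g (mix B x y) * (\<Prod>b\<in>B. h b (mix B x y)) = g x * (\<Prod>b\<in>B. h b (mix B x y))" by simp
  qed
  finally have eq: "avg ?X (\<lambda>x. g x * (\<Prod>b\<in>B. h b x)) = avg ?X A" .
  have "\<exists>y\<in>?X. \<delta> < \<bar>A y\<bar>"
  proof (rule ccontr)
    assume "\<not> ?thesis"
    then have "avg ?X (\<lambda>y. \<bar>A y\<bar>) \<le> avg ?X (\<lambda>_. \<delta>)" by (intro avg_mono) (auto simp: not_less)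
    also have "\<dots> = \<delta>" using V by (intro avg_const) auto
    finally show False using big eq avg_abs[of ?X A] by linarith
  qed
  then obtain y where y: "y \<in> ?X" "\<delta> < \<bar>avg ?X (\<lambda>x. g x * (\<Prod>b\<in>B. h b (mix B x y)))\<bar>"
    by (auto simp: A_def)
  show ?thesis
  proof (rule test_sets_exist[OF V assms(3) _ _ y(2)])
    fix b assume "b \<in> B"
    then have "dep m V (-{b} \<inter> B) (\<lambda>x. h b (mix B x y))"
      using h y(1) by (intro dep_mix) (auto simp: tests_def)
    then show "dep m V (B - {b}) (\<lambda>x. h b (mix B x y))" by (rule dep_mono) auto
  next
    fix b x assume "b \<in> B" "x \<in> ?X"
    then show "0 \<le> h b (mix B x y) \<and> h b (mix B x y) \<le> 1"
      using h y(1) by (simp add: tests_def mix_in_cube)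
  qed
qed

section \<open>Regularity\<close>

text \<open>The label names the atom of the partition generated by the list; appending to the list
  refines the partition.\<close>

definition lab :: "'x set list \<Rightarrow> 'x \<Rightarrow> bool list" where
  "lab Ds x = map (\<lambda>D. x \<in> D) Ds"

definition lows :: "nat \<Rightarrow> 'a set \<Rightarrow> nat set \<Rightarrow> (nat \<Rightarrow> 'a) set list \<Rightarrow> bool" where
  "lows m V B Ds \<longleftrightarrow> (\<forall>D\<in>set Ds. \<exists>b\<in>B. dep m V (B - {b}) (\<lambda>x. x \<in> D))"

definition colf :: "('x \<Rightarrow> nat) \<Rightarrow> nat \<Rightarrow> 'x \<Rightarrow> real" where
  "colf c i x = of_bool (c x = i)"

definition cprob :: "nat \<Rightarrow> 'a set \<Rightarrow> ((nat \<Rightarrow> 'a) \<Rightarrow> nat) \<Rightarrow> (nat \<Rightarrow> 'a) set list \<Rightarrow> nat \<Rightarrow> (nat \<Rightarrow> 'a) \<Rightarrow> real" where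
  "cprob m V c Ds i = cexp (cube m V) (lab Ds) (colf c i)"

definition energy :: "nat \<Rightarrow> 'a set \<Rightarrow> nat \<Rightarrow> ((nat \<Rightarrow> 'a) \<Rightarrow> nat) \<Rightarrow> (nat \<Rightarrow> 'a) set list \<Rightarrow> real" where
  "energy m V r c Ds = (\<Sum>i<r. avg (cube m V) (\<lambda>x. (cprob m V c Ds i x)\<^sup>2))"

text \<open>Testing also against a factor \<open>\<phi>\<close> measurable with respect to the partition itself is free in the
  energy increment. It is needed because the cell weights below multiply the colour indicators
  by functions of the conditional probabilities.\<close>

definition regular :: "nat \<Rightarrow> 'a set \<Rightarrow> nat set \<Rightarrow> nat \<Rightarrow> ((nat \<Rightarrow> 'a) \<Rightarrow> nat) \<Rightarrow> (nat \<Rightarrow> 'a) set list \<Rightarrow> real \<Rightarrow> bool" where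
  "regular m V B r c Ds \<delta> \<longleftrightarrow> (\<forall>i<r. \<forall>\<phi>.
     (\<forall>x\<in>cube m V. \<forall>y\<in>cube m V. lab Ds x = lab Ds y \<longrightarrow> \<phi> x = \<phi> y) \<longrightarrow>
     (\<forall>x\<in>cube m V. 0 \<le> \<phi> x \<and> \<phi> x \<le> 1) \<longrightarrow>
     unif m V B \<delta> (\<lambda>x. (colf c i x - cprob m V c Ds i x) * \<phi> x))"

lemma colf_bounds: "0 \<le> colf c i x" "colf c i x \<le> 1"
  by (auto simp: colf_def)

lemma cprob_bounds:
  assumes "finite V" "x \<in> cube m V"
  shows "0 \<le> cprob m V c Ds i x" "cprob m V c Ds i x \<le> 1"
  unfolding cprob_def using assms by (auto intro!: cexp_bounds simp: colf_bounds)

lemma lab_appendD: "lab (Ds @ Es) x = lab (Ds @ Es) y \<Longrightarrow> lab Ds x = lab Ds y"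
  by (simp add: lab_def)

lemma lab_mem: "lab Ds x = lab Ds y \<Longrightarrow> D \<in> set Ds \<Longrightarrow> x \<in> D \<longleftrightarrow> y \<in> D"
  by (auto simp: lab_def)

lemma lows_append [simp]: "lows m V B (Ds @ Es) \<longleftrightarrow> lows m V B Ds \<and> lows m V B Es"
  by (auto simp: lows_def)

lemma dep_lab:
  assumes "lows m V B Ds"
  shows "dep m V B (lab Ds)"
proof (rule depI)
  fix x y assume xy: "x \<in> cube m V" "y \<in> cube m V" "\<And>i. i \<in> B \<Longrightarrow> x i = y i"
  have "x \<in> D \<longleftrightarrow> y \<in> D" if D: "D \<in> set Ds" for D
  proof -
    obtain b where "dep m V (B - {b}) (\<lambda>x. x \<in> D)" using assms D unfolding lows_def by blast
    from depD[OF this xy(1,2)] xy(3) show ?thesis by blast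
  qed
  then show "lab Ds x = lab Ds y" by (simp add: lab_def)
qed

lemma dep_of_lab:
  assumes "lows m V B Ds" "\<And>x y. x \<in> cube m V \<Longrightarrow> y \<in> cube m V \<Longrightarrow> lab Ds x = lab Ds y \<Longrightarrow> \<phi> x = \<phi> y"
  shows "dep m V B \<phi>"
  using depD[OF dep_lab[OF assms(1)]] assms(2) by (intro depI) blast

lemma cprob_lab: "lab Ds x = lab Ds y \<Longrightarrow> cprob m V c Ds i x = cprob m V c Ds i y"
  unfolding cprob_def by (rule cexp_cong_label)

lemma energy_le:
  assumes "finite V" "V \<noteq> {}"
  shows "energy m V r c Ds \<le> real r"
proof -
  have "avg (cube m V) (\<lambda>x. (cprob m V c Ds i x)\<^sup>2) \<le> avg (cube m V) (\<lambda>_. 1)" for i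
    using cprob_bounds[OF assms(1)] by (intro avg_mono) (simp add: power_le_one)
  then have "avg (cube m V) (\<lambda>x. (cprob m V c Ds i x)\<^sup>2) \<le> 1" for i
    using assms by (simp add: avg_const)
  then have "energy m V r c Ds \<le> (\<Sum>i<r. 1)" unfolding energy_def by (intro sum_mono)
  then show ?thesis by simp
qed

lemma energy_nonneg: "0 \<le> energy m V r c Ds"
  unfolding energy_def by (intro sum_nonneg avg_nonneg) simp

lemma energy_diff:
  assumes "finite V"
  shows "(\<Sum>i<r. avg (cube m V) (\<lambda>x. (cprob m V c (Ds @ Es) i x - cprob m V c Ds i x)\<^sup>2))
     = energy m V r c (Ds @ Es) - energy m V r c Ds"
proof -
  have "avg (cube m V) (\<lambda>x. (cprob m V c (Ds @ Es) i x - cprob m V c Ds i x)\<^sup>2) =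
    avg (cube m V) (\<lambda>x. (cprob m V c (Ds @ Es) i x)\<^sup>2) - avg (cube m V) (\<lambda>x. (cprob m V c Ds i x)\<^sup>2)" for i
    unfolding cprob_def using assms by (intro energy_increment) (auto dest: lab_appendD)
  then show ?thesis by (simp add: energy_def sum_subtractf)
qed

lemma energy_mono: "finite V \<Longrightarrow> energy m V r c Ds \<le> energy m V r c (Ds @ Es)"
  using energy_diff[of V m c Ds Es r]
    sum_nonneg[of "{..<r}" "\<lambda>i. avg (cube m V) (\<lambda>x. (cprob m V c (Ds @ Es) i x - cprob m V c Ds i x)\<^sup>2)"]
  by (simp add: avg_nonneg)

text \<open>The test sets that witness irregularity are added to the partition. Their indicators and
  \<open>\<phi>\<close> are then measurable, so the correlation passes from the colour to the
  difference of the two conditional probabilities, and Cauchy-Schwarz turns it into energy.\<close>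

lemma irregular_step:
  assumes V: "finite V" "V \<noteq> {}" and B: "finite B" and c: "dep m V B c" and lo: "lows m V B Ds"
    and \<delta>: "0 < \<delta>" and irr: "\<not> regular m V B r c Ds \<delta>"
  shows "\<exists>Es. lows m V B Es \<and> length Es \<le> card B \<and> energy m V r c Ds + \<delta>\<^sup>2 \<le> energy m V r c (Ds @ Es)"
proof -
  let ?X = "cube m V"
  obtain i \<phi> where i: "i < r" and \<phi>: "\<forall>x\<in>?X. \<forall>y\<in>?X. lab Ds x = lab Ds y \<longrightarrow> \<phi> x = \<phi> y"
      "\<forall>x\<in>?X. 0 \<le> \<phi> x \<and> \<phi> x \<le> 1"
    and nu: "\<not> unif m V B \<delta> (\<lambda>x. (colf c i x - cprob m V c Ds i x) * \<phi> x)"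
    using irr unfolding regular_def not_all not_imp by blast
  let ?f = "colf c i"
  have d: "dep m V B (\<lambda>x. (?f x - cprob m V c Ds i x) * \<phi> x)"
  proof (intro dep_comp2[where F = "(*)"] dep_comp2[where F = "(-)"])
    show "dep m V B ?f" unfolding colf_def using dep_comp[OF c, of "\<lambda>u. of_bool (u = i)"] .
    show "dep m V B (cprob m V c Ds i)" using lo by (rule dep_of_lab) (rule cprob_lab)
    show "dep m V B \<phi>" using lo by (rule dep_of_lab) (use \<phi>(1) in blast)
  qed
  obtain D where D: "\<forall>b\<in>B. dep m V (B - {b}) (\<lambda>x. x \<in> D b)"
      "\<delta> < \<bar>avg ?X (\<lambda>x. ((?f x - cprob m V c Ds i x) * \<phi> x) * (\<Prod>b\<in>B. of_bool (x \<in> D b)))\<bar>"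
    using not_unif_imp_sets[OF V B d nu] by blast
  define Es where "Es = map D (sorted_list_of_set B)"
  have Es: "set Es = D ` B" "length Es = card B" using B by (auto simp: Es_def)
  have loE: "lows m V B Es" unfolding lows_def Es(1) using D(1) by blast
  let ?q = "cprob m V c Ds i" and ?q' = "cprob m V c (Ds @ Es) i"
  let ?\<psi> = "\<lambda>x. \<phi> x * (\<Prod>b\<in>B. of_bool (x \<in> D b))"
  have \<psi>: "?\<psi> x = ?\<psi> y" if "x \<in> ?X" "y \<in> ?X" "lab (Ds @ Es) x = lab (Ds @ Es) y" for x y
  proof -
    have "\<phi> x = \<phi> y" by (rule \<phi>(1)[rule_format, OF that(1,2) lab_appendD[OF that(3)]])
    moreover have "x \<in> D b \<longleftrightarrow> y \<in> D b" if "b \<in> B" for b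
      using lab_mem[OF \<open>lab (Ds @ Es) x = _\<close>, of "D b"] that Es(1) by auto
    ultimately show ?thesis by simp
  qed
  have \<psi>1: "\<bar>?\<psi> x\<bar> \<le> 1" if "x \<in> ?X" for x
  proof -
    have "0 \<le> (\<Prod>b\<in>B. of_bool (x \<in> D b) :: real)" "(\<Prod>b\<in>B. of_bool (x \<in> D b) :: real) \<le> 1"
      by (auto intro!: prod_nonneg prod_le_1)
    then show ?thesis using \<phi>(2) that by (simp add: abs_mult mult_le_one)
  qed
  have fq: "avg ?X (\<lambda>x. ?q' x * ?\<psi> x) = avg ?X (\<lambda>x. ?f x * ?\<psi> x)"
    unfolding cprob_def using finite_cube[OF V(1)] \<psi> by (rule avg_cexp_mult)
  have "avg ?X (\<lambda>x. ((?f x - ?q x) * \<phi> x) * (\<Prod>b\<in>B. of_bool (x \<in> D b)))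
      = avg ?X (\<lambda>x. ?f x * ?\<psi> x - ?q x * ?\<psi> x)"
    by (intro avg_cong) (simp add: algebra_simps)
  also have "\<dots> = avg ?X (\<lambda>x. ?q' x * ?\<psi> x) - avg ?X (\<lambda>x. ?q x * ?\<psi> x)"
    by (simp only: avg_diff fq)
  also have "\<dots> = avg ?X (\<lambda>x. (?q' x - ?q x) * ?\<psi> x)"
    unfolding avg_diff[symmetric] by (intro avg_cong) (simp add: algebra_simps)
  finally have "\<delta> < \<bar>avg ?X (\<lambda>x. (?q' x - ?q x) * ?\<psi> x)\<bar>" using D(2) by simp
  also have "\<dots> \<le> avg ?X (\<lambda>x. \<bar>(?q' x - ?q x) * ?\<psi> x\<bar>)" by (rule avg_abs)
  also have "\<dots> \<le> avg ?X (\<lambda>x. \<bar>?q' x - ?q x\<bar>)"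
    using \<psi>1 by (intro avg_mono) (simp only: abs_mult[of "_ - _"] mult_left_le abs_ge_zero)
  also have "\<dots> \<le> sqrt (avg ?X (\<lambda>x. (?q' x - ?q x)\<^sup>2))"
    using V by (intro avg_abs_le_sqrt) auto
  finally have "\<delta> \<le> sqrt (avg ?X (\<lambda>x. (?q' x - ?q x)\<^sup>2))" by simp
  then have "\<delta>\<^sup>2 \<le> avg ?X (\<lambda>x. (?q' x - ?q x)\<^sup>2)"
    using \<delta> by (intro sqrt_ge_absD) simp
  also have "\<dots> \<le> (\<Sum>i<r. avg ?X (\<lambda>x. (cprob m V c (Ds @ Es) i x - cprob m V c Ds i x)\<^sup>2))"
    using i by (intro member_le_sum) (auto intro!: avg_nonneg)
  also have "\<dots> = energy m V r c (Ds @ Es) - energy m V r c Ds" by (rule energy_diff[OF V(1)])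
  finally show ?thesis using loE Es(2) by (intro exI[of _ Es]) auto
qed

text \<open>Each failure of regularity raises the energy by \<open>\<delta>\<^sup>2\<close>, and the
  energy never exceeds \<open>r\<close>; this bounds the number of rounds and hence of added
  sets.\<close>

lemma weak_regularity:
  assumes V: "finite V" "V \<noteq> {}" and B: "finite B" and c: "dep m V B c" and lo: "lows m V B Ds"
    and \<delta>: "0 < \<delta>"
  shows "\<exists>Es. lows m V B Es \<and> length Es \<le> (nat \<lceil>real r / \<delta>\<^sup>2\<rceil> + 1) * card B \<and> regular m V B r c (Ds @ Es) \<delta>"
proof -
  have main: "\<exists>Es. lows m V B Es \<and> length Es \<le> k * card B \<and>
      (regular m V B r c (Ds @ Es) \<delta> \<or> real k * \<delta>\<^sup>2 \<le> energy m V r c (Ds @ Es))" for k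
  proof (induction k)
    case 0
    show ?case by (rule exI[of _ "[]"]) (simp add: lows_def energy_nonneg)
  next
    case (Suc k)
    then obtain Es where Es: "lows m V B Es" "length Es \<le> k * card B"
      "regular m V B r c (Ds @ Es) \<delta> \<or> real k * \<delta>\<^sup>2 \<le> energy m V r c (Ds @ Es)" by blast
    show ?case
    proof (cases "regular m V B r c (Ds @ Es) \<delta>")
      case True
      then show ?thesis using Es by (intro exI[of _ Es]) auto
    next
      case False
      from irregular_step[OF V B c _ \<delta> this] lo Es(1) obtain Fs where
        "lows m V B Fs" "length Fs \<le> card B"
        "energy m V r c (Ds @ Es) + \<delta>\<^sup>2 \<le> energy m V r c ((Ds @ Es) @ Fs)" by auto
      with Es False show ?thesis
        by (intro exI[of _ "Es @ Fs"]) (auto simp: algebra_simps)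
    qed
  qed
  define k where "k = nat \<lceil>real r / \<delta>\<^sup>2\<rceil> + 1"
  have "real r / \<delta>\<^sup>2 < real k" unfolding k_def by linarith
  then have "real r < real k * \<delta>\<^sup>2" using \<delta> by (simp add: field_simps)
  then show ?thesis
    using main[of k] energy_le[OF V, of m r c] unfolding k_def[symmetric]
    by (meson less_le_trans not_le)
qed

text \<open>The precision \<open>\<delta> N\<close> may depend on the size \<open>N\<close> of the
  coarse partition, since only the fine one has to be regular. Weak regularity is iterated: as long
  as the refinement gains more than \<open>\<epsilon>\<close> of energy for some \<open>B\<close>,
  the total energy over all \<open>B\<close>, at most \<open>card BB * r\<close>, grows by
  \<open>\<epsilon>\<close>.\<close>

lemma strong_regularity:
  fixes \<delta> :: "nat \<Rightarrow> real"
  assumes \<delta>: "\<And>N. 0 < \<delta> N" and \<epsilon>: "0 < \<epsilon>" and BB: "BB \<subseteq> Pow {..<m}"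
  shows "\<exists>M. \<forall>(V :: 'a set) (col :: nat set \<Rightarrow> (nat \<Rightarrow> 'a) \<Rightarrow> nat). finite V \<longrightarrow> V \<noteq> {} \<longrightarrow> (\<forall>B\<in>BB. dep m V B (col B)) \<longrightarrow>
    (\<exists>N\<le>M. \<exists>Ds Es. \<forall>B\<in>BB. lows m V B (Ds B) \<and> lows m V B (Es B) \<and> length (Ds B) \<le> N \<and>
       regular m V B r (col B) (Ds B @ Es B) (\<delta> N) \<and>
       energy m V r (col B) (Ds B @ Es B) - energy m V r (col B) (Ds B) \<le> \<epsilon>)"
proof -
  \<comment> \<open>\<open>Ms s\<close> bounds the lengths of the coarse lists after
    \<open>s\<close> rounds; each energy increment within a round adds at most
    \<open>card B \<le> m\<close> sets.\<close>
  define Ms where "Ms = rec_nat 0 (\<lambda>_ M. M + (nat \<lceil>real r / (\<delta> M)\<^sup>2\<rceil> + 1) * m)"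
  have Ms: "Ms 0 = 0" "Ms (Suc s) = Ms s + (nat \<lceil>real r / (\<delta> (Ms s))\<^sup>2\<rceil> + 1) * m" for s
    by (simp_all add: Ms_def)
  have mono: "Ms s \<le> Ms t" if "s \<le> t" for s t
    using that by (rule lift_Suc_mono_le[rotated]) (simp add: Ms)
  have fBB: "finite BB" using BB by (rule finite_subset) simp
  define k where "k = nat \<lceil>real (card BB * r) / \<epsilon>\<rceil> + 1"
  have "real (card BB * r) / \<epsilon> < real k" unfolding k_def by linarith
  then have kbig: "real (card BB * r) < real k * \<epsilon>" using \<epsilon> by (simp add: field_simps)
  show ?thesis
  proof (rule exI[of _ "Ms k"], intro allI impI)
    fix V :: "'a set" and col :: "nat set \<Rightarrow> (nat \<Rightarrow> 'a) \<Rightarrow> nat"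
    assume V: "finite V" "V \<noteq> {}" and c: "\<forall>B\<in>BB. dep m V B (col B)"
    define good where "good N Ds Es \<longleftrightarrow> (\<forall>B\<in>BB. lows m V B (Ds B) \<and> lows m V B (Es B) \<and>
       length (Ds B) \<le> N \<and> regular m V B r (col B) (Ds B @ Es B) (\<delta> N) \<and>
       energy m V r (col B) (Ds B @ Es B) - energy m V r (col B) (Ds B) \<le> \<epsilon>)" for N Ds Es
    \<comment> \<open>Either one of the first \<open>l\<close> rounds was good, or the energy has
      grown in all of them.\<close>
    have "(\<exists>s<l. \<exists>Ds Es. good (Ms s) Ds Es) \<or>
       (\<exists>Ds. (\<forall>B\<in>BB. lows m V B (Ds B) \<and> length (Ds B) \<le> Ms l) \<and>
          real l * \<epsilon> \<le> (\<Sum>B\<in>BB. energy m V r (col B) (Ds B)))" for l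
    proof (induction l)
      case 0
      show ?case by (rule disjI2, rule exI[of _ "\<lambda>_. []"]) (simp add: lows_def sum_nonneg energy_nonneg)
    next
      case (Suc l)
      show ?case
      proof (cases "\<exists>s<l. \<exists>Ds Es. good (Ms s) Ds Es")
        case True
        then show ?thesis by (meson less_SucI)
      next
        case False
        with Suc obtain Ds where Ds: "\<forall>B\<in>BB. lows m V B (Ds B) \<and> length (Ds B) \<le> Ms l"
          "real l * \<epsilon> \<le> (\<Sum>B\<in>BB. energy m V r (col B) (Ds B))" by blast
        have "\<forall>B\<in>BB. \<exists>Es. lows m V B Es \<and> length Es \<le> (nat \<lceil>real r / (\<delta> (Ms l))\<^sup>2\<rceil> + 1) * m \<and>
            regular m V B r (col B) (Ds B @ Es) (\<delta> (Ms l))"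
        proof
          fix B assume B: "B \<in> BB"
          then have fB: "finite B" and cB: "card B \<le> m"
            using BB finite_subset card_mono[of "{..<m}" B] by auto
          from weak_regularity[OF V fB _ _ \<delta>, of m "col B" "Ds B" r] c Ds(1) B
          obtain Es where Es: "lows m V B Es" "length Es \<le> (nat \<lceil>real r / (\<delta> (Ms l))\<^sup>2\<rceil> + 1) * card B"
            "regular m V B r (col B) (Ds B @ Es) (\<delta> (Ms l))" by blast
          from Es(2) have "length Es \<le> (nat \<lceil>real r / (\<delta> (Ms l))\<^sup>2\<rceil> + 1) * m"
            using cB by (meson le_trans mult_le_mono2)
          with Es show "\<exists>Es. lows m V B Es \<and> length Es \<le> (nat \<lceil>real r / (\<delta> (Ms l))\<^sup>2\<rceil> + 1) * m \<and>
            regular m V B r (col B) (Ds B @ Es) (\<delta> (Ms l))" by blast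
        qed
        then obtain Es where Es: "\<forall>B\<in>BB. lows m V B (Es B) \<and>
            length (Es B) \<le> (nat \<lceil>real r / (\<delta> (Ms l))\<^sup>2\<rceil> + 1) * m \<and>
            regular m V B r (col B) (Ds B @ Es B) (\<delta> (Ms l))" by metis
        show ?thesis
        proof (cases "good (Ms l) Ds Es")
          case True
          then show ?thesis by blast
        next
          case ng: False
          then obtain B0 where B0: "B0 \<in> BB"
            "\<epsilon> < energy m V r (col B0) (Ds B0 @ Es B0) - energy m V r (col B0) (Ds B0)"
            using Ds(1) Es unfolding good_def by (auto simp: not_le)
          have "\<epsilon> < (\<Sum>B\<in>BB. energy m V r (col B) (Ds B @ Es B) - energy m V r (col B) (Ds B))"
            using B0 fBB by (intro less_le_trans[OF B0(2)] member_le_sum) (auto simp: energy_mono[OF V(1)])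
          then have "real (Suc l) * \<epsilon> \<le> (\<Sum>B\<in>BB. energy m V r (col B) (Ds B @ Es B))"
            using Ds(2) by (simp add: sum_subtractf algebra_simps)
          moreover have "\<forall>B\<in>BB. lows m V B (Ds B @ Es B) \<and> length (Ds B @ Es B) \<le> Ms (Suc l)"
            using Ds(1) Es unfolding Ms(2) length_append lows_append by (meson add_mono)
          ultimately show ?thesis by (intro disjI2 exI[of _ "\<lambda>B. Ds B @ Es B"]) blast
        qed
      qed
    qed
    from this[of k] show "\<exists>N\<le>Ms k. \<exists>Ds Es. \<forall>B\<in>BB. lows m V B (Ds B) \<and> lows m V B (Es B) \<and>
       length (Ds B) \<le> N \<and> regular m V B r (col B) (Ds B @ Es B) (\<delta> N) \<and>
       energy m V r (col B) (Ds B @ Es B) - energy m V r (col B) (Ds B) \<le> \<epsilon>"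
    proof
      assume "\<exists>s<k. \<exists>Ds Es. good (Ms s) Ds Es"
      then show ?thesis unfolding good_def using mono by (meson less_imp_le)
    next
      assume "\<exists>Ds. (\<forall>B\<in>BB. lows m V B (Ds B) \<and> length (Ds B) \<le> Ms k) \<and>
          real k * \<epsilon> \<le> (\<Sum>B\<in>BB. energy m V r (col B) (Ds B))"
      then obtain Ds where "real k * \<epsilon> \<le> (\<Sum>B\<in>BB. energy m V r (col B) (Ds B))" by blast
      also have "\<dots> \<le> (\<Sum>B\<in>BB. real r)" by (intro sum_mono energy_le V)
      finally show ?thesis using kbig by simp
    qed
  qed
qed

section \<open>Independent cells\<close>

text \<open>The nearest point of the cell \<open>[c / \<kappa>, (c + 1) / \<kappa>]\<close>. Its
  distance from the left end is the length of the part of the cell to the left of \<open>x\<close>,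
  so that lengths of intersections become differences.\<close>

definition clamp_cell :: "nat \<Rightarrow> nat \<Rightarrow> real \<Rightarrow> real" where
  "clamp_cell \<kappa> c x = max (real c / real \<kappa>) (min (real (Suc c) / real \<kappa>) x)"

definition cum :: "(nat \<Rightarrow> real) \<Rightarrow> nat \<Rightarrow> real" where
  "cum q i = (\<Sum>k<i. q k)"

text \<open>\<open>overlap \<kappa> q i c\<close> is the length of the intersection of the cell \<open>[c / \<kappa>, (c + 1) / \<kappa>)\<close> with the
  \<open>i\<close>-th of the consecutive intervals of lengths \<open>q 0, q 1, \<dots>\<close>; \<open>guess \<kappa> q c\<close> is the index of the interval
  containing the left end of the cell.\<close>

definition overlap :: "nat \<Rightarrow> (nat \<Rightarrow> real) \<Rightarrow> nat \<Rightarrow> nat \<Rightarrow> real" where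
  "overlap \<kappa> q i c = clamp_cell \<kappa> c (cum q (Suc i)) - clamp_cell \<kappa> c (cum q i)"

definition guess :: "nat \<Rightarrow> (nat \<Rightarrow> real) \<Rightarrow> nat \<Rightarrow> nat" where
  "guess \<kappa> q c = (LEAST i. real c / real \<kappa> < cum q (Suc i))"

lemma clamp_cell_mono: "x \<le> y \<Longrightarrow> clamp_cell \<kappa> c x \<le> clamp_cell \<kappa> c y"
  by (auto simp: clamp_cell_def)

lemma clamp_cell_lipschitz: "x \<le> y \<Longrightarrow> clamp_cell \<kappa> c y - clamp_cell \<kappa> c x \<le> y - x"
  by (auto simp: clamp_cell_def)

lemma cell_le: "real c / real \<kappa> \<le> real (Suc c) / real \<kappa>"
  by (simp add: divide_right_mono)

lemma clamp_cell_bounds: "real c / real \<kappa> \<le> clamp_cell \<kappa> c x" "clamp_cell \<kappa> c x \<le> real (Suc c) / real \<kappa>"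
  using cell_le[of c \<kappa>] by (auto simp: clamp_cell_def)

lemma sum_clamp_cell:
  assumes "0 \<le> x" "x \<le> 1" "0 < \<kappa>"
  shows "(\<Sum>c<\<kappa>. clamp_cell \<kappa> c x - real c / real \<kappa>) = x"
proof -
  have "(\<Sum>c<k. clamp_cell \<kappa> c x - real c / real \<kappa>) = min (real k / real \<kappa>) x" for k
  proof (induction k)
    case (Suc k)
    then show ?case using cell_le[of k \<kappa>] by (auto simp: clamp_cell_def)
  qed (use assms in auto)
  then show ?thesis using assms by simp
qed

lemma sum_abs_clamp_cell:
  assumes "0 \<le> x" "x \<le> 1" "0 \<le> y" "y \<le> 1" "0 < \<kappa>"
  shows "(\<Sum>c<\<kappa>. \<bar>clamp_cell \<kappa> c y - clamp_cell \<kappa> c x\<bar>) = \<bar>y - x\<bar>"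
proof -
  have diff: "(\<Sum>c<\<kappa>. clamp_cell \<kappa> c v - clamp_cell \<kappa> c u) = v - u"
    if "0 \<le> u" "u \<le> 1" "0 \<le> v" "v \<le> 1" for u v
    using sum_clamp_cell[of u \<kappa>] sum_clamp_cell[of v \<kappa>] that assms(5) by (simp add: sum_subtractf)
  show ?thesis
  proof (cases "x \<le> y")
    case True
    then have "\<bar>clamp_cell \<kappa> c y - clamp_cell \<kappa> c x\<bar> = clamp_cell \<kappa> c y - clamp_cell \<kappa> c x" for c
      using clamp_cell_mono[OF True, of \<kappa> c] by simp
    then show ?thesis using diff assms True by simp
  next
    case False
    then have le: "y \<le> x" by simp
    then have "\<bar>clamp_cell \<kappa> c y - clamp_cell \<kappa> c x\<bar> = clamp_cell \<kappa> c x - clamp_cell \<kappa> c y" for c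
      using clamp_cell_mono[OF le, of \<kappa> c] by simp
    then show ?thesis using diff assms le by simp
  qed
qed

lemma sum_of_bool_le_1:
  assumes "finite A" "\<And>x y. x \<in> A \<Longrightarrow> y \<in> A \<Longrightarrow> P x \<Longrightarrow> P y \<Longrightarrow> x = y"
  shows "(\<Sum>x\<in>A. of_bool (P x) :: real) \<le> 1"
proof (cases "\<exists>x\<in>A. P x")
  case True
  then obtain x where x: "x \<in> A" "P x" by blast
  have "(\<Sum>y\<in>A. of_bool (P y) :: real) = (\<Sum>y\<in>A. if y = x then 1 else 0)"
    using assms(2) x by (intro sum.cong refl) (auto simp: of_bool_def)
  also have "\<dots> = 1" using assms(1) x by (simp add: sum.delta)
  finally show ?thesis by simp
next
  case False
  then have "(\<Sum>y\<in>A. of_bool (P y) :: real) = 0" by (intro sum.neutral) auto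
  then show ?thesis by linarith
qed

definition prob_vec :: "nat \<Rightarrow> (nat \<Rightarrow> real) \<Rightarrow> bool" where
  "prob_vec r q \<longleftrightarrow> (\<forall>i. 0 \<le> q i) \<and> (\<Sum>i<r. q i) = 1"

lemma cum_mono: "prob_vec r q \<Longrightarrow> i \<le> j \<Longrightarrow> cum q i \<le> cum q j"
  unfolding cum_def prob_vec_def by (intro sum_mono2) auto

lemma cum_ge_0: "prob_vec r q \<Longrightarrow> 0 \<le> cum q i"
  unfolding cum_def prob_vec_def by (intro sum_nonneg) auto

lemma cum_le_1: "prob_vec r q \<Longrightarrow> i \<le> r \<Longrightarrow> cum q i \<le> 1"
  using cum_mono[of r q i r] by (simp add: cum_def prob_vec_def)

lemma overlap_bounds:
  assumes "prob_vec r q"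
  shows "0 \<le> overlap \<kappa> q i c" "overlap \<kappa> q i c \<le> q i"
  using cum_mono[OF assms, of i "Suc i"] clamp_cell_lipschitz[of "cum q i" "cum q (Suc i)" \<kappa> c]
    clamp_cell_mono[of "cum q i" "cum q (Suc i)" \<kappa> c]
  by (auto simp: overlap_def cum_def)

lemma sum_overlap_colours:
  assumes "prob_vec r q" "c < \<kappa>"
  shows "(\<Sum>i<r. overlap \<kappa> q i c) = 1 / real \<kappa>"
proof -
  have "(\<Sum>i<r. overlap \<kappa> q i c) = clamp_cell \<kappa> c (cum q r) - clamp_cell \<kappa> c (cum q 0)"
    unfolding overlap_def by (rule sum_lessThan_telescope)
  moreover have "cum q r = 1" "cum q 0 = 0" using assms by (auto simp: cum_def prob_vec_def)
  moreover have "clamp_cell \<kappa> c 1 = real (Suc c) / real \<kappa>"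
  proof -
    have "real (Suc c) / real \<kappa> \<le> 1" using assms(2) by simp
    then show ?thesis using cell_le[of c \<kappa>] by (simp add: clamp_cell_def)
  qed
  moreover have "clamp_cell \<kappa> c 0 = real c / real \<kappa>" by (simp add: clamp_cell_def)
  ultimately show ?thesis by (simp add: add_divide_distrib)
qed

lemma sum_overlap_cells:
  assumes "prob_vec r q" "0 < \<kappa>" "i < r"
  shows "(\<Sum>c<\<kappa>. overlap \<kappa> q i c) = q i"
proof -
  have b: "0 \<le> cum q i" "cum q i \<le> 1" "0 \<le> cum q (Suc i)" "cum q (Suc i) \<le> 1"
    using assms by (auto intro: cum_ge_0 cum_le_1)
  have "(\<Sum>c<\<kappa>. overlap \<kappa> q i c) = cum q (Suc i) - cum q i"
    using sum_clamp_cell[OF b(1,2) assms(2)] sum_clamp_cell[OF b(3,4) assms(2)]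
    by (simp add: overlap_def sum_subtractf)
  then show ?thesis by (simp add: cum_def)
qed

lemma guess_props:
  assumes "prob_vec r q" "c < \<kappa>"
  shows "guess \<kappa> q c < r" "cum q (guess \<kappa> q c) \<le> real c / real \<kappa>"
    "real c / real \<kappa> < cum q (Suc (guess \<kappa> q c))"
proof -
  have "r > 0" using assms by (cases r) (auto simp: prob_vec_def)
  have "real c / real \<kappa> < 1" using assms by simp
  also have "1 = cum q (Suc (r - 1))" using \<open>r > 0\<close> assms by (simp add: cum_def prob_vec_def)
  finally have ex: "real c / real \<kappa> < cum q (Suc (r - 1))" .
  show "real c / real \<kappa> < cum q (Suc (guess \<kappa> q c))" unfolding guess_def by (rule LeastI[of "\<lambda>i. real c / real \<kappa> < cum q (Suc i)", OF ex])
  have "guess \<kappa> q c \<le> r - 1" unfolding guess_def by (rule Least_le[of "\<lambda>i. real c / real \<kappa> < cum q (Suc i)", OF ex])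
  then show "guess \<kappa> q c < r" using \<open>r > 0\<close> by linarith
  show "cum q (guess \<kappa> q c) \<le> real c / real \<kappa>"
  proof (cases "guess \<kappa> q c")
    case 0
    then show ?thesis by (simp add: cum_def)
  next
    case (Suc j)
    then have "\<not> real c / real \<kappa> < cum q (Suc j)"
      using not_less_Least[of j "\<lambda>i. real c / real \<kappa> < cum q (Suc i)"] by (simp add: guess_def)
    then show ?thesis using Suc by simp
  qed
qed

text \<open>The guess uses the coarse probabilities \<open>q\<close>, the mass is measured with the
  fine ones \<open>q'\<close>. Mass is misplaced in two ways: a breakpoint has moved between
  \<open>q\<close> and \<open>q'\<close>, or a breakpoint of \<open>q\<close> lies inside the cell.
  The latter happens for at most one cell per breakpoint.\<close>

lemma guess_error:
  assumes q: "prob_vec r q" and q': "prob_vec r q'" and \<kappa>: "0 < \<kappa>"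
  shows "(\<Sum>c<\<kappa>. \<Sum>i<r. of_bool (guess \<kappa> q c \<noteq> i) * overlap \<kappa> q' i c)
     \<le> 2 * (\<Sum>i\<le>r. \<bar>cum q' i - cum q i\<bar>) + real (Suc r) / real \<kappa>"
proof -
  let ?d = "\<lambda>i c. \<bar>clamp_cell \<kappa> c (cum q' i) - clamp_cell \<kappa> c (cum q i)\<bar>"
  let ?b = "\<lambda>i c. of_bool (real c / real \<kappa> < cum q i \<and> cum q i < real (Suc c) / real \<kappa>) / real \<kappa>"
  have step: "(\<Sum>i<r. of_bool (guess \<kappa> q c \<noteq> i) * overlap \<kappa> q' i c) \<le> (\<Sum>i\<le>r. 2 * ?d i c + ?b i c)"
    if c: "c < \<kappa>" for c
  proof -
    define j where "j = guess \<kappa> q c"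
    note j = guess_props[OF q c, folded j_def]
    have "(\<Sum>i<r. of_bool (j \<noteq> i) * overlap \<kappa> q' i c) =
        (\<Sum>i<r. overlap \<kappa> q' i c - (if i = j then overlap \<kappa> q' i c else 0))"
      by (intro sum.cong) auto
    also have "\<dots> = 1 / real \<kappa> - overlap \<kappa> q' j c"
      using j(1) by (simp add: sum_subtractf sum_overlap_colours[OF q' c] sum.delta)
    \<comment> \<open>The part of the cell left of the guessed interval of \<open>q'\<close>, plus
      the part right of it.\<close>
    also have "\<dots> = (clamp_cell \<kappa> c (cum q' j) - real c / real \<kappa>) +
        (real (Suc c) / real \<kappa> - clamp_cell \<kappa> c (cum q' (Suc j)))"
      by (simp add: overlap_def add_divide_distrib)
    also have "\<dots> \<le> ?d j c + (?d (Suc j) c + ?b (Suc j) c)"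
    proof (rule add_mono)
      have "clamp_cell \<kappa> c (cum q j) = real c / real \<kappa>"
        using j(2) cell_le[of c \<kappa>] by (auto simp: clamp_cell_def)
      then show "clamp_cell \<kappa> c (cum q' j) - real c / real \<kappa> \<le> ?d j c" by simp
      have "real (Suc c) / real \<kappa> - clamp_cell \<kappa> c (cum q (Suc j)) \<le> ?b (Suc j) c"
      proof (cases "cum q (Suc j) < real (Suc c) / real \<kappa>")
        case True
        then show ?thesis
          using j(3) clamp_cell_bounds(1)[of c \<kappa> "cum q (Suc j)"] by (simp add: add_divide_distrib)
      next
        case False
        then show ?thesis using cell_le[of c \<kappa>] by (simp add: clamp_cell_def)
      qed
      then show "real (Suc c) / real \<kappa> - clamp_cell \<kappa> c (cum q' (Suc j)) \<le> ?d (Suc j) c + ?b (Suc j) c"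
        by linarith
    qed
    \<comment> \<open>Bounding both moved breakpoints by the full sum costs the factor
      \<open>2\<close>.\<close>
    also have "\<dots> \<le> (\<Sum>i\<le>r. ?d i c) + ((\<Sum>i\<le>r. ?d i c) + (\<Sum>i\<le>r. ?b i c))"
      using j(1) by (intro add_mono member_le_sum) auto
    also have "\<dots> = (\<Sum>i\<le>r. 2 * ?d i c + ?b i c)" by (simp add: sum.distrib sum_distrib_left)
    finally show ?thesis by (simp add: j_def)
  qed
  have "(\<Sum>c<\<kappa>. \<Sum>i<r. of_bool (guess \<kappa> q c \<noteq> i) * overlap \<kappa> q' i c) \<le> (\<Sum>c<\<kappa>. \<Sum>i\<le>r. 2 * ?d i c + ?b i c)"
    by (intro sum_mono step) simp
  also have "\<dots> = (\<Sum>i\<le>r. 2 * (\<Sum>c<\<kappa>. ?d i c) + (\<Sum>c<\<kappa>. ?b i c))"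
    by (subst sum.swap) (simp add: sum.distrib sum_distrib_left)
  also have "\<dots> \<le> (\<Sum>i\<le>r. 2 * \<bar>cum q' i - cum q i\<bar> + 1 / real \<kappa>)"
  proof (intro sum_mono add_mono mult_left_mono)
    fix i assume i: "i \<in> {..r}"
    then show "(\<Sum>c<\<kappa>. ?d i c) \<le> \<bar>cum q' i - cum q i\<bar>"
      using sum_abs_clamp_cell[of "cum q i" "cum q' i" \<kappa>] q q' \<kappa> by (simp add: cum_ge_0 cum_le_1)
    have "(\<Sum>c<\<kappa>. of_bool (real c / real \<kappa> < cum q i \<and> cum q i < real (Suc c) / real \<kappa>) :: real) \<le> 1"
    proof (rule sum_of_bool_le_1)
      fix c d assume "real c / real \<kappa> < cum q i \<and> cum q i < real (Suc c) / real \<kappa>"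
        "real d / real \<kappa> < cum q i \<and> cum q i < real (Suc d) / real \<kappa>"
      then have "real c / real \<kappa> < real (Suc d) / real \<kappa>" "real d / real \<kappa> < real (Suc c) / real \<kappa>" by linarith+
      then have "c < Suc d" "d < Suc c" using \<kappa> by (simp_all add: divide_less_cancel)
      then show "c = d" by linarith
    qed simp
    then show "(\<Sum>c<\<kappa>. ?b i c) \<le> 1 / real \<kappa>"
      by (simp add: sum_divide_distrib[symmetric] divide_right_mono)
  qed auto
  also have "\<dots> = 2 * (\<Sum>i\<le>r. \<bar>cum q' i - cum q i\<bar>) + real (Suc r) / real \<kappa>"
    by (simp add: sum.distrib sum_distrib_left)
  finally show ?thesis .
qed

lemma prob_vec_cprob:
  assumes "finite V" "x \<in> cube m V" "\<And>x. x \<in> cube m V \<Longrightarrow> c x < r"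
  shows "prob_vec r (\<lambda>i. cprob m V c Ds i x)"
proof -
  have "(\<Sum>i<r. cprob m V c Ds i x) = cexp (cube m V) (lab Ds) (\<lambda>x. \<Sum>i<r. colf c i x) x"
    unfolding cprob_def by (rule cexp_sum)
  also have "\<dots> = avg {y \<in> cube m V. lab Ds y = lab Ds x} (\<lambda>_. 1)"
    unfolding cexp_def colf_def using assms(3) by (intro avg_cong) (simp add: of_bool_def sum.delta')
  also have "\<dots> = 1" using assms by (intro avg_const) auto
  finally show ?thesis using cprob_bounds(1)[OF assms(1,2)] by (simp add: prob_vec_def)
qed

text \<open>The probability that a uniform random point of the interval of the colour of \<open>x\<close> falls into cell \<open>c\<close>.
  Averaged over the colour this is \<open>1 / \<kappa>\<close>, so the cell is independent of the partition, while cell and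
  partition together determine the colour up to a small error. Where the conditional probability
  vanishes, so does the indicator in front of the junk quotient.\<close>

definition cell_weight :: "nat \<Rightarrow> 'a set \<Rightarrow> nat \<Rightarrow> ((nat \<Rightarrow> 'a) \<Rightarrow> nat) \<Rightarrow> (nat \<Rightarrow> 'a) set list \<Rightarrow> nat \<Rightarrow> nat \<Rightarrow> (nat \<Rightarrow> 'a) \<Rightarrow> real" where
  "cell_weight m V r col Ds \<kappa> c x =
     (\<Sum>i<r. colf col i x * (overlap \<kappa> (\<lambda>i. cprob m V col Ds i x) i c / cprob m V col Ds i x))"

context
  fixes m :: nat and V :: "'a set" and B :: "nat set" and r \<kappa> :: nat and col :: "(nat \<Rightarrow> 'a) \<Rightarrow> nat"
    and Ds Es :: "(nat \<Rightarrow> 'a) set list" and \<delta> :: real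
  assumes V: "finite V" "V \<noteq> {}" and col: "dep m V B col" "\<And>x. x \<in> cube m V \<Longrightarrow> col x < r"
    and lo: "lows m V B Ds" "lows m V B Es" and reg: "regular m V B r col (Ds @ Es) \<delta>" and \<kappa>: "0 < \<kappa>"
begin

private abbreviation "q x \<equiv> (\<lambda>i. cprob m V col Ds i x)"
private abbreviation "q' x \<equiv> (\<lambda>i. cprob m V col (Ds @ Es) i x)"
private abbreviation "\<theta> i c x \<equiv> overlap \<kappa> (q' x) i c / q' x i"
private abbreviation "wt \<equiv> cell_weight m V r col (Ds @ Es) \<kappa>"

private lemma pv: "x \<in> cube m V \<Longrightarrow> prob_vec r (q x)" "x \<in> cube m V \<Longrightarrow> prob_vec r (q' x)"
  by (intro prob_vec_cprob V(1) col(2); assumption)+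

private lemma \<theta>_bounds: "x \<in> cube m V \<Longrightarrow> 0 \<le> \<theta> i c x \<and> \<theta> i c x \<le> 1"
  using overlap_bounds[OF pv(2), of x \<kappa> i c] cprob_bounds(1)[OF V(1), of x m col "Ds @ Es" i]
  by (cases "q' x i = 0") auto

private lemma \<theta>_lab: "lab (Ds @ Es) x = lab (Ds @ Es) y \<Longrightarrow> \<theta> i c x = \<theta> i c y"
proof -
  assume "lab (Ds @ Es) x = lab (Ds @ Es) y"
  then have "q' x i = q' y i" for i by (rule cprob_lab)
  then show ?thesis by (simp only:)
qed

private lemma q_\<theta>: "x \<in> cube m V \<Longrightarrow> q' x i * \<theta> i c x = overlap \<kappa> (q' x) i c"
  using overlap_bounds[OF pv(2), of x \<kappa> i c] by (cases "q' x i = 0") auto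

private lemma wt_eq: "x \<in> cube m V \<Longrightarrow> wt c x = \<theta> (col x) c x"
proof -
  assume x: "x \<in> cube m V"
  have "wt c x = (\<Sum>i<r. if i = col x then \<theta> i c x else 0)"
    unfolding cell_weight_def by (intro sum.cong) (auto simp: colf_def)
  then show ?thesis using col(2)[OF x] by (simp add: sum.delta)
qed

lemma wt_nonneg: "x \<in> cube m V \<Longrightarrow> 0 \<le> wt c x"
  using wt_eq \<theta>_bounds by simp

lemma wt_sum: "x \<in> cube m V \<Longrightarrow> (\<Sum>c<\<kappa>. wt c x) = 1"
proof -
  assume x: "x \<in> cube m V"
  \<comment> \<open>\<open>x\<close> itself has this colour, so the quotient in the weight is not a
    division by zero.\<close>
  have "0 < q' x (col x)"
    unfolding cprob_def using x V by (intro cexp_pos) (auto simp: colf_def)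
  then show ?thesis
    using sum_overlap_cells[OF pv(2)[OF x] \<kappa> col(2)[OF x]] x
    by (simp add: wt_eq sum_divide_distrib[symmetric])
qed

lemma wt_dep: "dep m V B (wt c)"
  unfolding cell_weight_def
proof (intro dep_sum dep_comp2[where F = "(*)"])
  fix i
  show "dep m V B (colf col i)"
    unfolding colf_def using dep_comp[OF col(1), of "\<lambda>u. of_bool (u = i)"] .
  show "dep m V B (\<theta> i c)"
  proof (rule dep_of_lab)
    show "lows m V B (Ds @ Es)" using lo by simp
  qed (rule \<theta>_lab)
qed

text \<open>\<open>1 / \<kappa>\<close> is the mean over the colours, weighted by the conditional
  probabilities, of the quotients \<open>\<theta> i c x\<close>. So the difference is a sum of terms
  \<open>(colf col i x - q' x i) * \<theta> i c x\<close>, and \<open>\<theta>\<close>, being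
  measurable for the partition, serves as the factor \<open>\<phi>\<close> in
  \<open>regular\<close>.\<close>

lemma wt_unif: "c < \<kappa> \<Longrightarrow> unif m V B (real r * \<delta>) (\<lambda>x. wt c x - 1 / real \<kappa>)"
  unfolding unif_def
proof (intro allI impI)
  fix h assume c: "c < \<kappa>" and h: "tests m V B h"
  let ?P = "\<lambda>x. \<Prod>b\<in>B. h b x"
  have eq: "avg (cube m V) (\<lambda>x. (wt c x - 1 / real \<kappa>) * ?P x) =
     avg (cube m V) (\<lambda>x. \<Sum>i<r. ((colf col i x - q' x i) * \<theta> i c x) * ?P x)"
  proof (rule avg_cong)
    fix x assume x: "x \<in> cube m V"
    have "1 / real \<kappa> = (\<Sum>i<r. q' x i * \<theta> i c x)"
      using sum_overlap_colours[OF pv(2)[OF x] c] by (simp only: q_\<theta>[OF x])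
    then show "(wt c x - 1 / real \<kappa>) * ?P x = (\<Sum>i<r. ((colf col i x - q' x i) * \<theta> i c x) * ?P x)"
      unfolding cell_weight_def
      by (simp only: sum_distrib_right[symmetric] sum_subtractf[symmetric] left_diff_distrib[symmetric])
  qed
  have "\<bar>avg (cube m V) (\<lambda>x. (wt c x - 1 / real \<kappa>) * ?P x)\<bar> \<le> (\<Sum>i<r. \<bar>avg (cube m V) (\<lambda>x. ((colf col i x - q' x i) * \<theta> i c x) * ?P x)\<bar>)"
    unfolding eq avg_sum by (rule sum_abs)
  also have "\<dots> \<le> (\<Sum>i<r. \<delta>)"
  proof (rule sum_mono)
    fix i assume "i \<in> {..<r}"
    then have i: "i < r" by simp
    have "unif m V B \<delta> (\<lambda>x. (colf col i x - q' x i) * \<theta> i c x)"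
      by (rule reg[unfolded regular_def, rule_format, OF i]) (rule \<theta>_lab \<theta>_bounds, assumption)+
    then show "\<bar>avg (cube m V) (\<lambda>x. ((colf col i x - q' x i) * \<theta> i c x) * ?P x)\<bar> \<le> \<delta>"
      using h by (rule unif_def[THEN iffD1, rule_format])
  qed
  finally show "\<bar>avg (cube m V) (\<lambda>x. (wt c x - 1 / real \<kappa>) * ?P x)\<bar> \<le> real r * \<delta>" by simp
qed

text \<open>Guess and quotient depend on the partition only, so the colour may be replaced by its
  conditional probability. This leaves \<open>overlap\<close>, to which \<open>guess_error\<close>
  applies, and the moved breakpoints are controlled by the energy gap through
  Cauchy-Schwarz.\<close>

lemma wt_guess_error:
  assumes en: "energy m V r col (Ds @ Es) - energy m V r col Ds \<le> \<epsilon>"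
  shows "avg (cube m V) (\<lambda>x. \<Sum>c<\<kappa>. wt c x * of_bool (col x \<noteq> guess \<kappa> (q x) c))
     \<le> 2 * real (Suc r) * (real r * sqrt \<epsilon>) + real (Suc r) / real \<kappa>"
proof -
  let ?X = "cube m V"
  let ?G = "\<lambda>i c x. of_bool (guess \<kappa> (q x) c \<noteq> i) :: real"
  have fX: "finite ?X" "?X \<noteq> {}" using V by auto
  have "avg ?X (\<lambda>x. \<Sum>c<\<kappa>. wt c x * of_bool (col x \<noteq> guess \<kappa> (q x) c))
     = avg ?X (\<lambda>x. \<Sum>c<\<kappa>. \<Sum>i<r. colf col i x * (\<theta> i c x * ?G i c x))"
  proof (intro avg_cong sum.cong refl)
    fix x c
    show "wt c x * of_bool (col x \<noteq> guess \<kappa> (q x) c) = (\<Sum>i<r. colf col i x * (\<theta> i c x * ?G i c x))"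
      unfolding cell_weight_def sum_distrib_right
      by (intro sum.cong refl) (auto simp: colf_def)
  qed
  also have "\<dots> = (\<Sum>c<\<kappa>. \<Sum>i<r. avg ?X (\<lambda>x. colf col i x * (\<theta> i c x * ?G i c x)))"
    by (simp only: avg_sum)
  also have "\<dots> = (\<Sum>c<\<kappa>. \<Sum>i<r. avg ?X (\<lambda>x. q' x i * (\<theta> i c x * ?G i c x)))"
  proof (intro sum.cong refl)
    fix c i
    have "\<theta> i c x * ?G i c x = \<theta> i c y * ?G i c y" if "lab (Ds @ Es) x = lab (Ds @ Es) y" for x y
    proof -
      have "q x i = q y i" for i by (rule cprob_lab[OF lab_appendD[OF that]])
      then show ?thesis by (simp only: \<theta>_lab[OF that])
    qed
    then show "avg ?X (\<lambda>x. colf col i x * (\<theta> i c x * ?G i c x)) = avg ?X (\<lambda>x. q' x i * (\<theta> i c x * ?G i c x))"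
      unfolding cprob_def by (intro avg_cexp_mult[symmetric] fX)
  qed
  also have "\<dots> = avg ?X (\<lambda>x. \<Sum>c<\<kappa>. \<Sum>i<r. q' x i * (\<theta> i c x * ?G i c x))"
    by (simp only: avg_sum)
  also have "\<dots> = avg ?X (\<lambda>x. \<Sum>c<\<kappa>. \<Sum>i<r. ?G i c x * overlap \<kappa> (q' x) i c)"
  proof (intro avg_cong sum.cong refl)
    fix x c i assume x: "x \<in> ?X"
    show "q' x i * (\<theta> i c x * ?G i c x) = ?G i c x * overlap \<kappa> (q' x) i c"
      using q_\<theta>[OF x, of i c] by (simp only: mult.commute[of "?G i c x"] mult.assoc[symmetric])
  qed
  also have "\<dots> \<le> avg ?X (\<lambda>x. 2 * real (Suc r) * (\<Sum>i<r. \<bar>q' x i - q x i\<bar>) + real (Suc r) / real \<kappa>)"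
  proof (rule avg_mono)
    fix x assume x: "x \<in> ?X"
    have "\<bar>cum (q' x) i - cum (q x) i\<bar> \<le> (\<Sum>i<r. \<bar>q' x i - q x i\<bar>)" if "i \<le> r" for i
    proof -
      have "\<bar>cum (q' x) i - cum (q x) i\<bar> \<le> (\<Sum>k<i. \<bar>q' x k - q x k\<bar>)"
        unfolding cum_def sum_subtractf[symmetric] by (rule sum_abs)
      also have "\<dots> \<le> (\<Sum>i<r. \<bar>q' x i - q x i\<bar>)" using that by (intro sum_mono2) auto
      finally show ?thesis .
    qed
    then have "(\<Sum>i\<le>r. \<bar>cum (q' x) i - cum (q x) i\<bar>) \<le> (\<Sum>i\<le>r. (\<Sum>i<r. \<bar>q' x i - q x i\<bar>))"
      by (intro sum_mono) auto
    also have "\<dots> = real (Suc r) * (\<Sum>i<r. \<bar>q' x i - q x i\<bar>)" by simp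
    finally show "(\<Sum>c<\<kappa>. \<Sum>i<r. ?G i c x * overlap \<kappa> (q' x) i c)
       \<le> 2 * real (Suc r) * (\<Sum>i<r. \<bar>q' x i - q x i\<bar>) + real (Suc r) / real \<kappa>"
      using guess_error[OF pv(1)[OF x] pv(2)[OF x] \<kappa>] by linarith
  qed
  also have "\<dots> = 2 * real (Suc r) * (\<Sum>i<r. avg ?X (\<lambda>x. \<bar>q' x i - q x i\<bar>)) + real (Suc r) / real \<kappa>"
    by (simp only: avg_add avg_cmult avg_sum avg_const[OF fX])
  also have "\<dots> \<le> 2 * real (Suc r) * (\<Sum>i<r. sqrt \<epsilon>) + real (Suc r) / real \<kappa>"
  proof (intro add_right_mono mult_left_mono sum_mono)
    fix i assume i: "i \<in> {..<r}"
    have "avg ?X (\<lambda>x. \<bar>q' x i - q x i\<bar>) \<le> sqrt (avg ?X (\<lambda>x. (q' x i - q x i)\<^sup>2))"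
      by (rule avg_abs_le_sqrt[OF fX])
    also have "avg ?X (\<lambda>x. (q' x i - q x i)\<^sup>2) \<le> (\<Sum>i<r. avg ?X (\<lambda>x. (q' x i - q x i)\<^sup>2))"
      using i by (intro member_le_sum) (auto intro!: avg_nonneg)
    also have "\<dots> \<le> \<epsilon>" using en by (simp add: energy_diff[OF V(1)])
    finally show "avg ?X (\<lambda>x. \<bar>q' x i - q x i\<bar>) \<le> sqrt \<epsilon>" by simp
  qed auto
  finally show ?thesis by simp
qed

end


section \<open>Joint cells of several coordinate sets\<close>

definition cells :: "(nat \<Rightarrow> nat) \<Rightarrow> nat set set \<Rightarrow> (nat set \<Rightarrow> nat) set" where
  "cells \<kappa> S = PiE S (\<lambda>B. {..<\<kappa> (card B)})"

text \<open>\<open>w B c x\<close> is the probability, given \<open>x\<close>, that the random cell attached to the coordinates \<open>B\<close> is \<open>c\<close>;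
  the cells for different \<open>B\<close> are chosen independently given \<open>x\<close>. The number \<open>\<kappa>\<close> of cells depends only on the
  size of \<open>B\<close>.\<close>

definition valid_weights :: "nat \<Rightarrow> 'a set \<Rightarrow> (nat \<Rightarrow> nat) \<Rightarrow> (nat set \<Rightarrow> nat \<Rightarrow> (nat \<Rightarrow> 'a) \<Rightarrow> real) \<Rightarrow> bool" where
  "valid_weights m V \<kappa> w \<longleftrightarrow> (\<forall>l. 0 < \<kappa> l) \<and> \<kappa> 0 = 1 \<and>
     (\<forall>B\<subseteq>{..<m}. (\<forall>c<\<kappa> (card B). dep m V B (w B c)) \<and>
       (\<forall>x\<in>cube m V. (\<forall>c<\<kappa> (card B). 0 \<le> w B c x) \<and> (\<Sum>c<\<kappa> (card B). w B c x) = 1))"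

definition indep_weights :: "nat \<Rightarrow> 'a set \<Rightarrow> (nat \<Rightarrow> nat) \<Rightarrow> (nat set \<Rightarrow> nat \<Rightarrow> (nat \<Rightarrow> 'a) \<Rightarrow> real) \<Rightarrow> real \<Rightarrow> bool" where
  "indep_weights m V \<kappa> w \<delta> \<longleftrightarrow> (\<forall>B\<subseteq>{..<m}. \<forall>c<\<kappa> (card B). unif m V B \<delta> (\<lambda>x. w B c x - 1 / real (\<kappa> (card B))))"

text \<open>The probability that the colour of a random \<open>x\<close> differs from the guess
  \<open>g\<close> made from the random cells of all subsets of \<open>B\<close>.\<close>

definition guess_err :: "nat \<Rightarrow> 'a set \<Rightarrow> (nat \<Rightarrow> nat) \<Rightarrow> (nat set \<Rightarrow> nat \<Rightarrow> (nat \<Rightarrow> 'a) \<Rightarrow> real) \<Rightarrow>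
    ((nat \<Rightarrow> 'a) \<Rightarrow> nat) \<Rightarrow> ((nat set \<Rightarrow> nat) \<Rightarrow> nat) \<Rightarrow> nat set \<Rightarrow> real" where
  "guess_err m V \<kappa> w c g B =
     avg (cube m V) (\<lambda>x. \<Sum>u\<in>cells \<kappa> (Pow B). (\<Prod>C\<in>Pow B. w C (u C) x) * of_bool (c x \<noteq> g u))"

lemma sum_PiE_insert:
  assumes "s \<notin> S"
  shows "(\<Sum>u\<in>PiE (insert s S) A. f u) = (\<Sum>c\<in>A s. \<Sum>u\<in>PiE S A. f (u(s := c)))"
proof -
  have "(\<Sum>u\<in>PiE (insert s S) A. f u) = sum f ((\<lambda>(y, g). g(s := y)) ` (A s \<times> PiE S A))"
    by (simp add: PiE_insert_eq)
  also have "\<dots> = (\<Sum>p\<in>A s \<times> PiE S A. f ((\<lambda>(y, g). g(s := y)) p))"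
    by (subst sum.reindex[OF inj_combinator[OF assms]]) simp
  also have "\<dots> = (\<Sum>c\<in>A s. \<Sum>u\<in>PiE S A. f (u(s := c)))"
    by (simp add: sum.cartesian_product case_prod_beta)
  finally show ?thesis .
qed

text \<open>The cells of the sets in \<open>S\<close> are drawn independently with total weight
  \<open>1\<close>, so they sum out.\<close>

lemma sum_PiE_marginal:
  fixes w :: "'s \<Rightarrow> 'c \<Rightarrow> real"
  assumes "finite S" "finite T" "S \<inter> T = {}" "\<And>s. s \<in> S \<Longrightarrow> (\<Sum>c\<in>A s. w s c) = 1"
  shows "(\<Sum>u\<in>PiE (S \<union> T) A. (\<Prod>s\<in>S \<union> T. w s (u s)) * F (restrict u T))
    = (\<Sum>u\<in>PiE T A. (\<Prod>s\<in>T. w s (u s)) * F u)"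
  using assms(1,3,4)
proof (induction S rule: finite_induct)
  case empty
  have "restrict u T = u" if "u \<in> PiE T A" for u
    using that by (auto simp: PiE_def extensional_def restrict_def fun_eq_iff)
  then show ?case by simp
next
  case (insert s S)
  have s: "s \<notin> S \<union> T" using insert by auto
  have "(\<Sum>u\<in>PiE (insert s S \<union> T) A. (\<Prod>t\<in>insert s S \<union> T. w t (u t)) * F (restrict u T)) =
    (\<Sum>c\<in>A s. \<Sum>u\<in>PiE (S \<union> T) A. (\<Prod>t\<in>insert s (S \<union> T). w t ((u(s := c)) t)) * F (restrict (u(s := c)) T))"
    unfolding Un_insert_left by (rule sum_PiE_insert[OF s])
  also have "\<dots> = (\<Sum>c\<in>A s. \<Sum>u\<in>PiE (S \<union> T) A. w s c * ((\<Prod>t\<in>S \<union> T. w t (u t)) * F (restrict u T)))"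
  proof (intro sum.cong refl)
    fix c u
    have "(\<Prod>t\<in>S \<union> T. w t ((u(s := c)) t)) = (\<Prod>t\<in>S \<union> T. w t (u t))"
      using s by (intro prod.cong) auto
    moreover have "restrict (u(s := c)) T = restrict u T" using s by (auto simp: restrict_def fun_eq_iff)
    moreover have "finite (S \<union> T)" using insert.hyps(1) assms(2) by simp
    ultimately show "(\<Prod>t\<in>insert s (S \<union> T). w t ((u(s := c)) t)) * F (restrict (u(s := c)) T) =
       w s c * ((\<Prod>t\<in>S \<union> T. w t (u t)) * F (restrict u T))"
      by (subst prod.insert[OF _ s]) (simp_all add: mult.assoc)
  qed
  also have "\<dots> = (\<Sum>c\<in>A s. w s c) * (\<Sum>u\<in>PiE (S \<union> T) A. (\<Prod>t\<in>S \<union> T. w t (u t)) * F (restrict u T))"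
    by (simp only: sum_distrib_left[symmetric] sum_distrib_right[symmetric])
  also have "\<dots> = (\<Sum>u\<in>PiE (S \<union> T) A. (\<Prod>t\<in>S \<union> T. w t (u t)) * F (restrict u T))"
    using insert.prems by simp
  also have "\<dots> = (\<Sum>u\<in>PiE T A. (\<Prod>s\<in>T. w s (u s)) * F u)"
    using insert.prems by (intro insert.IH) auto
  finally show ?case .
qed

lemma sum_cells_marginal:
  assumes v: "valid_weights m V \<kappa> w" and x: "x \<in> cube m V" and S: "finite S" "S \<subseteq> Pow {..<m}" and T: "T \<subseteq> S"
  shows "(\<Sum>u\<in>cells \<kappa> S. (\<Prod>C\<in>S. w C (u C) x) * F (restrict u T))
    = (\<Sum>u\<in>cells \<kappa> T. (\<Prod>C\<in>T. w C (u C) x) * F u)"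
proof -
  have ST: "(S - T) \<union> T = S" using T by auto
  have "(\<Sum>u\<in>PiE ((S - T) \<union> T) (\<lambda>B. {..<\<kappa> (card B)}). (\<Prod>C\<in>(S - T) \<union> T. w C (u C) x) * F (restrict u T))
    = (\<Sum>u\<in>PiE T (\<lambda>B. {..<\<kappa> (card B)}). (\<Prod>C\<in>T. w C (u C) x) * F u)"
  proof (rule sum_PiE_marginal[where w = "\<lambda>C c. w C c x"])
    fix C assume "C \<in> S - T"
    then have "C \<subseteq> {..<m}" using S by auto
    then show "(\<Sum>c<\<kappa> (card C). w C c x) = 1" using v x unfolding valid_weights_def by blast
  qed (use S T finite_subset in auto)
  then show ?thesis unfolding cells_def ST .
qed

lemma sum_cells_singleton:
  "(\<Sum>u\<in>cells \<kappa> {B}. (\<Prod>C\<in>{B}. w C (u C) x) * F (u B)) = (\<Sum>c<\<kappa> (card B). w B c x * F c)"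
  unfolding cells_def using sum_PiE_insert[of B "{}" "\<lambda>u. (\<Prod>C\<in>{B}. w C (u C) x) * F (u B)" "\<lambda>B. {..<\<kappa> (card B)}"] by simp

lemma cell_prod_nonneg:
  assumes "valid_weights m V \<kappa> w" "x \<in> cube m V" "S \<subseteq> Pow {..<m}" "u \<in> cells \<kappa> S"
  shows "0 \<le> (\<Prod>C\<in>S. w C (u C) x)"
proof (rule prod_nonneg)
  fix C assume "C \<in> S"
  then have "C \<subseteq> {..<m}" "u C < \<kappa> (card C)" using assms(3,4) by (auto simp: cells_def PiE_def Pi_def)
  then show "0 \<le> w C (u C) x" using assms(1,2) unfolding valid_weights_def by blast
qed

section \<open>The structure lemma\<close>

text \<open>The error \<open>\<delta> K\<close> may be tiny compared with the number of cells: the fine partition making the top level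
  regular is chosen after the coarse one, and only the coarse one enters the lower levels.\<close>

lemma structure_lemma:
  fixes r :: nat and \<epsilon> :: real and \<delta> :: "nat \<Rightarrow> real"
  assumes "0 < \<epsilon>" "\<And>N. 0 < \<delta> N" "\<And>K L. K \<le> L \<Longrightarrow> \<delta> L \<le> \<delta> K"
  shows "\<exists>Kmax. \<forall>(V :: 'a set) (col :: nat set \<Rightarrow> (nat \<Rightarrow> 'a) \<Rightarrow> nat). finite V \<longrightarrow> V \<noteq> {} \<longrightarrow>
    (\<forall>B\<subseteq>{..<m}. card B \<le> j \<longrightarrow> dep m V B (col B) \<and> (\<forall>x\<in>cube m V. col B x < r)) \<longrightarrow>
    (\<exists>K\<le>Kmax. \<exists>\<kappa> w g. valid_weights m V \<kappa> w \<and> (\<forall>l. \<kappa> l \<le> K) \<and> indep_weights m V \<kappa> w (\<delta> K) \<and>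
       (\<forall>B\<subseteq>{..<m}. card B \<le> j \<longrightarrow> guess_err m V \<kappa> w (col B) (g B) B \<le> \<epsilon>))"
  using assms
proof (induction j arbitrary: r \<epsilon> \<delta>)
  case 0
  show ?case
  proof (rule exI[of _ 1], intro allI impI)
    fix V :: "'a set" and col :: "nat set \<Rightarrow> (nat \<Rightarrow> 'a) \<Rightarrow> nat"
    assume V: "finite V" "V \<noteq> {}"
      and c: "\<forall>B\<subseteq>{..<m}. card B \<le> 0 \<longrightarrow> dep m V B (col B) \<and> (\<forall>x\<in>cube m V. col B x < r)"
    \<comment> \<open>Only \<open>B = {}\<close> is coloured at this level, and its colour is
      constant: one cell everywhere suffices.\<close>
    let ?w = "\<lambda>B c x. 1 :: real" and ?\<kappa> = "\<lambda>l. 1 :: nat"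
    obtain x0 where x0: "x0 \<in> cube m V" using cube_nonempty[OF V(2)] by blast
    have "valid_weights m V ?\<kappa> ?w" by (simp add: valid_weights_def)
    moreover have "indep_weights m V ?\<kappa> ?w (\<delta> 1)"
      using "0.prems"(2)[of 1] by (simp add: indep_weights_def unif_def avg_def less_imp_le)
    moreover have "guess_err m V ?\<kappa> ?w (col B) (\<lambda>u. col B x0) B \<le> \<epsilon>" if B: "B \<subseteq> {..<m}" "card B \<le> 0" for B
    proof -
      have "B = {}" using B finite_subset[OF B(1)] by simp
      then have "dep m V {} (col B)" using c B by blast
      then have "col B x = col B x0" if "x \<in> cube m V" for x
        using that x0 by (intro depD[of m V "{}" "col B"]) auto
      then have "guess_err m V ?\<kappa> ?w (col B) (\<lambda>u. col B x0) B = avg (cube m V) (\<lambda>x. 0)"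
        unfolding guess_err_def by (intro avg_cong) simp
      also have "\<dots> \<le> \<epsilon>" using "0.prems"(1) by (simp add: avg_def)
      finally show ?thesis .
    qed
    ultimately show "\<exists>K\<le>1. \<exists>\<kappa> w g. valid_weights m V \<kappa> w \<and> (\<forall>l. \<kappa> l \<le> K) \<and> indep_weights m V \<kappa> w (\<delta> K) \<and>
       (\<forall>B\<subseteq>{..<m}. card B \<le> 0 \<longrightarrow> guess_err m V \<kappa> w (col B) (g B) B \<le> \<epsilon>)"
      by (intro exI[of _ 1] conjI exI[of _ ?\<kappa>] exI[of _ ?w] exI[of _ "\<lambda>B u. col B x0"]) auto
  qed
next
  case (Suc j)
  note \<epsilon> = Suc.prems(1) and \<delta> = Suc.prems(2) and anti = Suc.prems(3)
  \<comment> \<open>The error budget is \<open>\<epsilon> / 3\<close> each for cells cut by a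
    breakpoint (\<open>\<kappa>t\<close>), for the energy gap (\<open>\<epsilon>0\<close>) and for
    wrong guesses on the at most \<open>m\<close> facets (\<open>\<epsilon>'\<close>).\<close>
  define \<kappa>t where "\<kappa>t = nat \<lceil>3 * real (Suc r) / \<epsilon>\<rceil> + 1"
  have \<kappa>t: "0 < \<kappa>t" "3 * real (Suc r) / \<epsilon> \<le> real \<kappa>t" unfolding \<kappa>t_def by linarith+
  define \<epsilon>0 where "\<epsilon>0 = (\<epsilon> / (6 * real (Suc r) * real (Suc r)))\<^sup>2"
  define \<epsilon>' where "\<epsilon>' = \<epsilon> / (3 * real (Suc m))"
  have \<epsilon>0: "0 < \<epsilon>0" unfolding \<epsilon>0_def using \<epsilon> by (intro zero_less_power divide_pos_pos) auto
  have \<epsilon>': "0 < \<epsilon>'" "\<epsilon>' \<le> \<epsilon>" "real m * \<epsilon>' \<le> \<epsilon> / 3"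
    unfolding \<epsilon>'_def using \<epsilon> by (auto simp: field_simps)
  \<comment> \<open>The lower levels must be uniform for the final bound on the number of cells,
    which includes the \<open>\<kappa>t\<close> cells of the top level.\<close>
  define \<delta>' where "\<delta>' K = \<delta> (max K \<kappa>t)" for K
  \<comment> \<open>The new colours of the lower sets: the old colour together with the coarse sets
    containing the point, where \<open>(B, k)\<close> names the \<open>k\<close>-th set of
    \<open>Ds B\<close>.\<close>
  define Ls where "Ls N = {..<r} \<times> Pow (Pow {..<m} \<times> {..<N})" for N :: nat
  have fLs: "finite (Ls N)" for N by (simp add: Ls_def)
  define P where "P r' Kmax \<longleftrightarrow> (\<forall>(V :: 'a set) (col :: nat set \<Rightarrow> (nat \<Rightarrow> 'a) \<Rightarrow> nat). finite V \<longrightarrow> V \<noteq> {} \<longrightarrow>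
    (\<forall>B\<subseteq>{..<m}. card B \<le> j \<longrightarrow> dep m V B (col B) \<and> (\<forall>x\<in>cube m V. col B x < r')) \<longrightarrow>
    (\<exists>K\<le>Kmax. \<exists>\<kappa> w g. valid_weights m V \<kappa> w \<and> (\<forall>l. \<kappa> l \<le> K) \<and> indep_weights m V \<kappa> w (\<delta>' K) \<and>
       (\<forall>B\<subseteq>{..<m}. card B \<le> j \<longrightarrow> guess_err m V \<kappa> w (col B) (g B) B \<le> \<epsilon>')))" for r' Kmax
  have "\<exists>Kmax. P r' Kmax" for r'
    unfolding P_def by (rule Suc.IH) (auto simp: \<delta>'_def \<delta> \<epsilon>' intro!: anti)
  then obtain KM where KM: "\<And>r'. P r' (KM r')" by metis
  \<comment> \<open>A bound for the number of cells that depends on \<open>N\<close> only. It is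
    available before the top level is regularised, which is why \<open>\<delta>t N\<close> can be
    small relative to it.\<close>
  define Kb where "Kb N = max (KM (card (Ls N))) \<kappa>t" for N
  define \<delta>t where "\<delta>t N = \<delta> (Kb N) / real (Suc r)" for N
  have \<delta>t: "0 < \<delta>t N" "real r * \<delta>t N \<le> \<delta> (Kb N)" for N
  proof -
    show "0 < \<delta>t N" unfolding \<delta>t_def using \<delta> by simp
    have "real r * \<delta> (Kb N) \<le> real (Suc r) * \<delta> (Kb N)"
      using less_imp_le[OF \<delta>[of "Kb N"]] by (intro mult_right_mono) auto
    then show "real r * \<delta>t N \<le> \<delta> (Kb N)" by (simp add: \<delta>t_def field_simps)
  qed
  define BB where "BB = {B. B \<subseteq> {..<m} \<and> card B = Suc j}"
  have BB: "BB \<subseteq> Pow {..<m}" by (auto simp: BB_def)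
  obtain M where M: "\<And>(V :: 'a set) (col :: nat set \<Rightarrow> (nat \<Rightarrow> 'a) \<Rightarrow> nat). finite V \<Longrightarrow> V \<noteq> {} \<Longrightarrow>
      (\<forall>B\<in>BB. dep m V B (col B)) \<Longrightarrow>
    (\<exists>N\<le>M. \<exists>Ds Es. \<forall>B\<in>BB. lows m V B (Ds B) \<and> lows m V B (Es B) \<and> length (Ds B) \<le> N \<and>
       regular m V B r (col B) (Ds B @ Es B) (\<delta>t N) \<and>
       energy m V r (col B) (Ds B @ Es B) - energy m V r (col B) (Ds B) \<le> \<epsilon>0)"
    using strong_regularity[of \<delta>t \<epsilon>0 BB m r, where 'a = 'a, OF \<delta>t(1) \<epsilon>0 BB] by blast
  show ?case
  \<comment> \<open>Which \<open>N \<le> M\<close> occurs depends on \<open>V\<close> and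
    \<open>col\<close>, so the bound has to dominate \<open>Kb N\<close> for all of them.\<close>
  proof (rule exI[of _ "\<Sum>N\<le>M. Kb N"], intro allI impI)
    fix V :: "'a set" and col :: "nat set \<Rightarrow> (nat \<Rightarrow> 'a) \<Rightarrow> nat"
    assume V: "finite V" "V \<noteq> {}"
      and c: "\<forall>B\<subseteq>{..<m}. card B \<le> Suc j \<longrightarrow> dep m V B (col B) \<and> (\<forall>x\<in>cube m V. col B x < r)"
    have cdep: "dep m V B (col B)" if "B \<subseteq> {..<m}" "card B \<le> Suc j" for B using c that by blast
    have cr: "col B x < r" if "B \<subseteq> {..<m}" "card B \<le> Suc j" "x \<in> cube m V" for B x using c that by blast
    have "\<forall>B\<in>BB. dep m V B (col B)" using cdep by (simp add: BB_def)
    from M[OF V this] obtain N Ds Es where N: "N \<le> M" and DE: "\<forall>B\<in>BB. lows m V B (Ds B) \<and> lows m V B (Es B) \<and>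
       length (Ds B) \<le> N \<and> regular m V B r (col B) (Ds B @ Es B) (\<delta>t N) \<and>
       energy m V r (col B) (Ds B @ Es B) - energy m V r (col B) (Ds B) \<le> \<epsilon>0" by blast
    obtain enc where enc: "bij_betw enc (Ls N) {..<card (Ls N)}"
      using ex_bij_betw_finite_nat[OF fLs[of N]] by (auto simp: atLeast0LessThan)
    define dec where "dec = inv_into (Ls N) enc"
    have dec: "dec (enc p) = p" if "p \<in> Ls N" for p
      unfolding dec_def using enc that by (simp add: bij_betw_def)
    \<comment> \<open>Only sets determined by \<open>B'\<close> are recorded, so that
      \<open>St B'\<close> is itself a function of these coordinates. The fine sets
      \<open>Es\<close> are left out: they serve regularity, not guessing.\<close>
    define St where "St B' x = {(B, k). B \<in> BB \<and> k < length (Ds B) \<and>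
        dep m V B' (\<lambda>x. x \<in> Ds B ! k) \<and> x \<in> Ds B ! k}" for B' x
    have St_dep: "dep m V B' (St B')" for B'
    proof (rule depI)
      fix x y assume xy: "x \<in> cube m V" "y \<in> cube m V" "\<And>i. i \<in> B' \<Longrightarrow> x i = y i"
      have "(p \<in> St B' x) = (p \<in> St B' y)" for p
        unfolding St_def using depD[OF _ xy] by (cases p) blast
      then show "St B' x = St B' y" by blast
    qed
    define col' where "col' B' x = enc (col B' x, St B' x)" for B' x
    have pair: "(col B' x, St B' x) \<in> Ls N" if "B' \<subseteq> {..<m}" "card B' \<le> j" "x \<in> cube m V" for B' x
      using cr[of B' x] that DE BB unfolding Ls_def St_def by (auto intro: less_le_trans)
    have "P (card (Ls N)) (KM (card (Ls N)))" by (rule KM)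
    note IH = this[unfolded P_def, rule_format, OF V, of col']
    have "\<exists>K\<le>KM (card (Ls N)). \<exists>\<kappa> w g. valid_weights m V \<kappa> w \<and> (\<forall>l. \<kappa> l \<le> K) \<and> indep_weights m V \<kappa> w (\<delta>' K) \<and>
       (\<forall>B\<subseteq>{..<m}. card B \<le> j \<longrightarrow> guess_err m V \<kappa> w (col' B) (g B) B \<le> \<epsilon>')"
    proof (rule IH, intro conjI ballI)
      fix B assume B: "B \<subseteq> {..<m}" "card B \<le> j"
      show "dep m V B (col' B)" unfolding col'_def using B
        by (intro dep_comp2[where F = "\<lambda>a b. enc (a, b)"] cdep St_dep) auto
      fix x assume "x \<in> cube m V"
      with pair B have "(col B x, St B x) \<in> Ls N" by blast
      then show "col' B x < card (Ls N)" unfolding col'_def using enc by (auto simp: bij_betw_def)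
    qed
    then obtain K \<kappa>' w' g' where K: "K \<le> KM (card (Ls N))" and v': "valid_weights m V \<kappa>' w'"
      and \<kappa>K: "\<And>l. \<kappa>' l \<le> K" and ind': "indep_weights m V \<kappa>' w' (\<delta>' K)"
      and err': "\<And>B. B \<subseteq> {..<m} \<Longrightarrow> card B \<le> j \<Longrightarrow> guess_err m V \<kappa>' w' (col' B) (g' B) B \<le> \<epsilon>'" by blast
    define \<kappa> where "\<kappa> l = (if l = Suc j then \<kappa>t else \<kappa>' l)" for l
    define w where "w B = (if card B = Suc j then cell_weight m V r (col B) (Ds B @ Es B) \<kappa>t else w' B)" for B
    \<comment> \<open>The guess depends on \<open>x\<close> only through the label, so any
      representative of the label will do; a label that does not occur gets an arbitrary
      value.\<close>
    define Gd where "Gd B L c = guess \<kappa>t (\<lambda>i. cprob m V (col B) (Ds B) i (SOME x. lab (Ds B) x = L)) c" for B L c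
    have Gd: "Gd B (lab (Ds B) x) c = guess \<kappa>t (\<lambda>i. cprob m V (col B) (Ds B) i x) c" for B x c
    proof -
      have "lab (Ds B) (SOME y. lab (Ds B) y = lab (Ds B) x) = lab (Ds B) x"
        by (rule someI[of "\<lambda>y. lab (Ds B) y = lab (Ds B) x", OF refl])
      then have "cprob m V (col B) (Ds B) i (SOME y. lab (Ds B) y = lab (Ds B) x) = cprob m V (col B) (Ds B) i x" for i
        by (rule cprob_lab)
      then show ?thesis unfolding Gd_def by (simp only:)
    qed
    \<comment> \<open>The coarse label of \<open>x\<close>, as read off from the guesses on the
      facets \<open>B - {b}\<close>.\<close>
    define LL where "LL B u = map (\<lambda>k. \<exists>b\<in>B. (B, k) \<in> snd (dec (g' (B - {b}) (restrict u (Pow (B - {b}))))))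
       [0..<length (Ds B)]" for B and u :: "nat set \<Rightarrow> nat"
    define g where "g B u = (if card B = Suc j then Gd B (LL B u) (u B) else fst (dec (g' B u)))" for B u
    let ?K = "max K \<kappa>t"
    have KKb: "?K \<le> Kb N" using K by (simp add: Kb_def)
    have tops: "lows m V B (Ds B)" "lows m V B (Es B)" "length (Ds B) \<le> N"
       "regular m V B r (col B) (Ds B @ Es B) (\<delta>t N)"
       "energy m V r (col B) (Ds B @ Es B) - energy m V r (col B) (Ds B) \<le> \<epsilon>0"
       "dep m V B (col B)" "\<And>x. x \<in> cube m V \<Longrightarrow> col B x < r"
      if "B \<subseteq> {..<m}" "card B = Suc j" for B
      using DE that c by (auto simp: BB_def)
    have v: "valid_weights m V \<kappa> w"
      unfolding valid_weights_def
    proof (intro conjI allI impI)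
      show "0 < \<kappa> l" for l using v' \<kappa>t(1) by (simp add: \<kappa>_def valid_weights_def)
      show "\<kappa> 0 = 1" using v' by (simp add: \<kappa>_def valid_weights_def)
      fix B assume B: "B \<subseteq> {..<m}"
      show "dep m V B (w B c)" if "c < \<kappa> (card B)" for c
      proof (cases "card B = Suc j")
        case True
        note t = tops[OF B True]
        show ?thesis unfolding w_def using True wt_dep[OF V t(6,7,1,2,4) \<kappa>t(1)] by simp
      next
        case False
        then show ?thesis using v' B that unfolding valid_weights_def w_def \<kappa>_def by auto
      qed
      show "\<forall>x\<in>cube m V. (\<forall>c<\<kappa> (card B). 0 \<le> w B c x) \<and> (\<Sum>c<\<kappa> (card B). w B c x) = 1"
      proof (cases "card B = Suc j")
        case True
        note t = tops[OF B True]
        show ?thesis unfolding w_def \<kappa>_def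
          using True wt_nonneg[OF V t(6,7,1,2,4) \<kappa>t(1)] wt_sum[OF V t(6,7,1,2,4) \<kappa>t(1)] by simp
      next
        case False
        then show ?thesis using v' B unfolding valid_weights_def w_def \<kappa>_def by simp
      qed
    qed
    have ind: "indep_weights m V \<kappa> w (\<delta> ?K)"
      unfolding indep_weights_def
    proof (intro allI impI)
      fix B c assume B: "B \<subseteq> {..<m}" "c < \<kappa> (card B)"
      show "unif m V B (\<delta> ?K) (\<lambda>x. w B c x - 1 / real (\<kappa> (card B)))"
      proof (cases "card B = Suc j")
        case True
        note t = tops[OF B(1) True]
        have "c < \<kappa>t" using True B(2) by (simp add: \<kappa>_def)
        have "unif m V B (real r * \<delta>t N) (\<lambda>x. w B c x - 1 / real (\<kappa> (card B)))"
          unfolding w_def \<kappa>_def using True wt_unif[OF V t(6,7,1,2,4) \<kappa>t(1) \<open>c < \<kappa>t\<close>] by simp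
        moreover have "real r * \<delta>t N \<le> \<delta> ?K" using \<delta>t(2)[of N] anti[OF KKb] by linarith
        ultimately show ?thesis unfolding unif_def by (meson order_trans)
      next
        case False
        then show ?thesis using ind' B unfolding indep_weights_def w_def \<kappa>_def \<delta>'_def by simp
      qed
    qed
    have same: "cells \<kappa> (Pow B) = cells \<kappa>' (Pow B)" "\<And>u x. (\<Prod>C\<in>Pow B. w C (u C) x) = (\<Prod>C\<in>Pow B. w' C (u C) x)"
      if "B \<subseteq> {..<m}" "card B \<le> j" for B
    proof -
      have C: "card C \<noteq> Suc j" if "C \<in> Pow B" for C
        using that card_mono[of B C] \<open>card B \<le> j\<close> finite_subset[OF \<open>B \<subseteq> {..<m}\<close>] by auto
      show "cells \<kappa> (Pow B) = cells \<kappa>' (Pow B)"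
        unfolding cells_def using C by (intro PiE_cong) (simp add: \<kappa>_def)
      show "(\<Prod>C\<in>Pow B. w C (u C) x) = (\<Prod>C\<in>Pow B. w' C (u C) x)" for u x
        using C by (intro prod.cong refl) (simp add: w_def)
    qed
    have err: "guess_err m V \<kappa> w (col B) (g B) B \<le> \<epsilon>" if B: "B \<subseteq> {..<m}" "card B \<le> Suc j" for B
    proof (cases "card B = Suc j")
      case False
      then have Bj: "card B \<le> j" using B(2) by simp
      have "guess_err m V \<kappa> w (col B) (g B) B \<le> guess_err m V \<kappa>' w' (col' B) (g' B) B"
        unfolding guess_err_def same[OF B(1) Bj]
      proof (intro avg_mono sum_mono mult_left_mono)
        fix x u assume x: "x \<in> cube m V" and u: "u \<in> cells \<kappa>' (Pow B)"
        show "0 \<le> (\<Prod>C\<in>Pow B. w' C (u C) x)" using B(1) by (intro cell_prod_nonneg[OF v' x _ u]) auto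
        show "of_bool (col B x \<noteq> g B u) \<le> (of_bool (col' B x \<noteq> g' B u) :: real)"
          using False dec[OF pair[OF B(1) Bj x]] by (auto simp: g_def col'_def)
      qed
      then show ?thesis using err'[OF B(1) Bj] \<epsilon>'(2) by linarith
    next
      case True
      note t = tops[OF B(1) True]
      have fB: "finite B" using B(1) finite_subset by blast
      have Bb: "B - {b} \<subseteq> {..<m}" "card (B - {b}) \<le> j" if "b \<in> B" for b
        using B(1) True that fB by auto
      let ?top = "\<lambda>x. \<Sum>c<\<kappa>t. w B c x * of_bool (col B x \<noteq> guess \<kappa>t (\<lambda>i. cprob m V (col B) (Ds B) i x) c)"
      let ?low = "\<lambda>b x. \<Sum>u\<in>cells \<kappa> (Pow (B - {b})). (\<Prod>C\<in>Pow (B - {b}). w C (u C) x) * of_bool (col' (B - {b}) x \<noteq> g' (B - {b}) u)"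
      \<comment> \<open>Union bound: if all facets are guessed correctly, the label is right and
        only the top cell can mislead. The cells that a term does not involve sum out.\<close>
      have "guess_err m V \<kappa> w (col B) (g B) B \<le> avg (cube m V) (\<lambda>x. ?top x + (\<Sum>b\<in>B. ?low b x))"
        unfolding guess_err_def
      proof (rule avg_mono)
        fix x assume x: "x \<in> cube m V"
        let ?W = "\<lambda>u. \<Prod>C\<in>Pow B. w C (u C) x"
        let ?F = "\<lambda>u. of_bool (col B x \<noteq> guess \<kappa>t (\<lambda>i. cprob m V (col B) (Ds B) i x) (u B)) :: real"
        let ?H = "\<lambda>b u. of_bool (col' (B - {b}) x \<noteq> g' (B - {b}) u) :: real"
        have "(\<Sum>u\<in>cells \<kappa> (Pow B). ?W u * of_bool (col B x \<noteq> g B u)) \<le>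
            (\<Sum>u\<in>cells \<kappa> (Pow B). ?W u * (?F (restrict u {B}) + (\<Sum>b\<in>B. ?H b (restrict u (Pow (B - {b}))))))"
        proof (intro sum_mono mult_left_mono)
          fix u assume u: "u \<in> cells \<kappa> (Pow B)"
          show "0 \<le> ?W u" using B(1) by (intro cell_prod_nonneg[OF v x _ u]) auto
          show "of_bool (col B x \<noteq> g B u) \<le> ?F (restrict u {B}) + (\<Sum>b\<in>B. ?H b (restrict u (Pow (B - {b}))))"
          proof (cases "\<forall>b\<in>B. col' (B - {b}) x = g' (B - {b}) (restrict u (Pow (B - {b})))")
            case all: True
            have "LL B u = lab (Ds B) x"
            proof -
              have "(\<exists>b\<in>B. (B, k) \<in> snd (dec (g' (B - {b}) (restrict u (Pow (B - {b})))))) \<longleftrightarrow> x \<in> Ds B ! k"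
                if k: "k < length (Ds B)" for k
              proof -
                have "snd (dec (g' (B - {b}) (restrict u (Pow (B - {b}))))) = St (B - {b}) x" if "b \<in> B" for b
                proof -
                  have "g' (B - {b}) (restrict u (Pow (B - {b}))) = enc (col (B - {b}) x, St (B - {b}) x)"
                    using all that by (simp add: col'_def)
                  then show ?thesis using dec[OF pair[OF Bb[OF that] x]] by simp
                qed
                then have "(\<exists>b\<in>B. (B, k) \<in> snd (dec (g' (B - {b}) (restrict u (Pow (B - {b})))))) \<longleftrightarrow>
                    (\<exists>b\<in>B. (B, k) \<in> St (B - {b}) x)" by simp
                also have "\<dots> \<longleftrightarrow> x \<in> Ds B ! k"
                proof
                  assume "x \<in> Ds B ! k"
                  moreover obtain b where "b \<in> B" "dep m V (B - {b}) (\<lambda>x. x \<in> Ds B ! k)"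
                    using t(1) nth_mem[OF k] unfolding lows_def by blast
                  moreover have "B \<in> BB" using B(1) True by (simp add: BB_def)
                  ultimately have "(B, k) \<in> St (B - {b}) x" unfolding St_def using k by simp
                  with \<open>b \<in> B\<close> show "\<exists>b\<in>B. (B, k) \<in> St (B - {b}) x" ..
                qed (auto simp: St_def)
                finally show ?thesis .
              qed
              then show ?thesis unfolding LL_def lab_def by (intro nth_equalityI) auto
            qed
            then have "g B u = guess \<kappa>t (\<lambda>i. cprob m V (col B) (Ds B) i x) (u B)"
              unfolding g_def using True Gd by simp
            moreover have "0 \<le> (\<Sum>b\<in>B. ?H b (restrict u (Pow (B - {b}))))" by (intro sum_nonneg) simp
            ultimately show ?thesis by simp
          next
            case False
            then obtain b where b: "b \<in> B" "col' (B - {b}) x \<noteq> g' (B - {b}) (restrict u (Pow (B - {b})))" by blast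
            have "?H b (restrict u (Pow (B - {b}))) \<le> (\<Sum>b\<in>B. ?H b (restrict u (Pow (B - {b}))))"
              using b(1) fB by (intro member_le_sum) auto
            then have "1 \<le> (\<Sum>b\<in>B. ?H b (restrict u (Pow (B - {b}))))" using b(2) by simp
            moreover have "of_bool (col B x \<noteq> g B u) \<le> (1::real)" "0 \<le> ?F (restrict u {B})" by simp_all
            ultimately show ?thesis by linarith
          qed
        qed
        also have "\<dots> = (\<Sum>u\<in>cells \<kappa> (Pow B). ?W u * ?F (restrict u {B})) +
            (\<Sum>b\<in>B. \<Sum>u\<in>cells \<kappa> (Pow B). ?W u * ?H b (restrict u (Pow (B - {b}))))"
          by (subst sum.swap) (simp only: distrib_left sum.distrib sum_distrib_left)
        also have "\<dots> = ?top x + (\<Sum>b\<in>B. ?low b x)"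
        proof -
          have "(\<Sum>u\<in>cells \<kappa> (Pow B). ?W u * ?F (restrict u {B})) = (\<Sum>u\<in>cells \<kappa> {B}. (\<Prod>C\<in>{B}. w C (u C) x) * ?F u)"
            by (rule sum_cells_marginal[OF v x]) (use B(1) fB in auto)
          also have "\<dots> = (\<Sum>c<\<kappa> (card B). w B c x * of_bool (col B x \<noteq> guess \<kappa>t (\<lambda>i. cprob m V (col B) (Ds B) i x) c))"
            by (rule sum_cells_singleton)
          finally have T: "(\<Sum>u\<in>cells \<kappa> (Pow B). ?W u * ?F (restrict u {B})) = ?top x"
            using True by (simp add: \<kappa>_def)
          have L: "(\<Sum>u\<in>cells \<kappa> (Pow B). ?W u * ?H b (restrict u (Pow (B - {b})))) = ?low b x" if "b \<in> B" for b
            by (rule sum_cells_marginal[OF v x]) (use B(1) fB in auto)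
          show ?thesis by (rule arg_cong2[where f = "(+)", OF T sum.cong[OF refl L]])
        qed
        finally show "(\<Sum>u\<in>cells \<kappa> (Pow B). ?W u * of_bool (col B x \<noteq> g B u)) \<le> ?top x + (\<Sum>b\<in>B. ?low b x)" .
      qed
      also have "\<dots> = avg (cube m V) ?top + (\<Sum>b\<in>B. avg (cube m V) (?low b))"
        by (simp only: avg_add avg_sum)
      also have "\<dots> \<le> (2 * real (Suc r) * (real r * sqrt \<epsilon>0) + real (Suc r) / real \<kappa>t) + (\<Sum>b\<in>B. \<epsilon>')"
      proof (intro add_mono[of "avg _ _"] sum_mono)
        show "avg (cube m V) ?top \<le> 2 * real (Suc r) * (real r * sqrt \<epsilon>0) + real (Suc r) / real \<kappa>t"
          unfolding w_def using True wt_guess_error[OF V t(6,7,1,2,4) \<kappa>t(1) t(5)] by simp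
        fix b assume b: "b \<in> B"
        have "avg (cube m V) (?low b) = guess_err m V \<kappa>' w' (col' (B - {b})) (g' (B - {b})) (B - {b})"
          unfolding guess_err_def same[OF Bb[OF b]] ..
        then show "avg (cube m V) (?low b) \<le> \<epsilon>'" using err'[OF Bb[OF b]] by simp
      qed
      also have "\<dots> \<le> \<epsilon>"
      proof -
        have sq: "sqrt \<epsilon>0 = \<epsilon> / (6 * real (Suc r) * real (Suc r))" unfolding \<epsilon>0_def using \<epsilon> by simp
        have S: "2 * S * (real r * (\<epsilon> / (6 * S * S))) = \<epsilon> / 3 * (real r / S)" if "S > 0" for S :: real
          using that by (simp add: field_simps)
        have "2 * real (Suc r) * (real r * sqrt \<epsilon>0) = \<epsilon> / 3 * (real r / real (Suc r))"
          unfolding sq by (rule S) simp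
        also have "\<dots> \<le> \<epsilon> / 3 * 1" using \<epsilon> by (intro mult_left_mono) auto
        finally have 1: "2 * real (Suc r) * (real r * sqrt \<epsilon>0) \<le> \<epsilon> / 3" by simp
        have 2: "real (Suc r) / real \<kappa>t \<le> \<epsilon> / 3" using \<kappa>t \<epsilon> by (simp add: field_simps)
        have "real (card B) * \<epsilon>' \<le> real m * \<epsilon>'"
          using \<epsilon>'(1) card_mono[OF _ B(1)] by (intro mult_right_mono) auto
        then show ?thesis using 1 2 \<epsilon>'(3) unfolding sum_constant by linarith
      qed
      finally show ?thesis .
    qed
    have "?K \<le> (\<Sum>N\<le>M. Kb N)"
      using KKb member_le_sum[of N "{..M}" Kb] N by simp
    moreover have "\<forall>l. \<kappa> l \<le> ?K" using \<kappa>K by (auto simp: \<kappa>_def le_max_iff_disj)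
    ultimately show "\<exists>K\<le>\<Sum>N\<le>M. Kb N. \<exists>\<kappa> w g. valid_weights m V \<kappa> w \<and> (\<forall>l. \<kappa> l \<le> K) \<and> indep_weights m V \<kappa> w (\<delta> K) \<and>
       (\<forall>B\<subseteq>{..<m}. card B \<le> Suc j \<longrightarrow> guess_err m V \<kappa> w (col B) (g B) B \<le> \<epsilon>)"
      using v ind err by blast
  qed
qed


section \<open>Peeling off the weights one at a time\<close>

lemma weight_bounds:
  assumes v: "valid_weights m V \<kappa> w" and B: "B \<subseteq> {..<m}" and c: "c < \<kappa> (card B)" and x: "x \<in> cube m V"
  shows "0 \<le> w B c x" "w B c x \<le> 1"
proof -
  have n: "\<forall>c<\<kappa> (card B). 0 \<le> w B c x" and s: "(\<Sum>c<\<kappa> (card B). w B c x) = 1"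
    using v B x unfolding valid_weights_def by blast+
  show "0 \<le> w B c x" using n c by blast
  have "w B c x \<le> (\<Sum>c<\<kappa> (card B). w B c x)" using n c by (intro member_le_sum) auto
  then show "w B c x \<le> 1" using s by simp
qed

text \<open>The factors are sorted by a coordinate of \<open>B\<close> on which they do not depend.\<close>

lemma unif_prod:
  assumes g: "unif m V B \<delta> g" and "finite I"
    and d: "\<And>s. s \<in> I \<Longrightarrow> \<exists>b\<in>B. dep m V (-{b}) (G s)"
    and b01: "\<And>s x. s \<in> I \<Longrightarrow> x \<in> cube m V \<Longrightarrow> 0 \<le> G s x \<and> G s x \<le> (1::real)" and fB: "finite B"
  shows "\<bar>avg (cube m V) (\<lambda>x. g x * (\<Prod>s\<in>I. G s x))\<bar> \<le> \<delta>"
proof -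
  obtain \<beta> where \<beta>: "\<And>s. s \<in> I \<Longrightarrow> \<beta> s \<in> B \<and> dep m V (-{\<beta> s}) (G s)" using d by metis
  define h where "h b x = (\<Prod>s\<in>{s\<in>I. \<beta> s = b}. G s x)" for b x
  have "tests m V B h"
    unfolding tests_def
  proof (intro ballI conjI)
    fix b assume "b \<in> B"
    show "dep m V (-{b}) (h b)" unfolding h_def using \<beta> by (intro dep_prod) auto
    fix x assume "x \<in> cube m V"
    then show "0 \<le> h b x" "h b x \<le> 1" unfolding h_def using b01 by (auto intro!: prod_nonneg prod_le_1)
  qed
  moreover have "(\<Prod>b\<in>B. h b x) = (\<Prod>s\<in>I. G s x)" for x
    unfolding h_def using assms(2) fB \<beta> by (intro prod.group) auto
  ultimately show ?thesis using g unfolding unif_def by auto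
qed

text \<open>The weight of a set \<open>B\<close> in \<open>A\<close> of maximal size is replaced by
  \<open>1 / \<kappa> (card B)\<close> first. Neither \<open>B0\<close> nor any other set in play
  contains \<open>B\<close>, so every other factor misses a coordinate of \<open>B\<close>, and
  uniformity applies at cost \<open>\<delta>\<close>.\<close>

lemma peel_weights:
  assumes V: "finite V" "V \<noteq> {}" and v: "valid_weights m V \<kappa> w" and ind: "indep_weights m V \<kappa> w \<delta>"
    and F: "dep m V B0 F" "\<And>x. x \<in> cube m V \<Longrightarrow> 0 \<le> F x \<and> F x \<le> 1"
    and A: "A \<subseteq> Pow {..<m}" and A0: "A0 \<subseteq> Pow {..<m}" "\<And>B. B \<in> A0 \<Longrightarrow> B \<subseteq> B0" "\<And>B. B \<in> A \<Longrightarrow> \<not> B \<subseteq> B0"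
    and u: "\<And>B. B \<in> A \<union> A0 \<Longrightarrow> u B < \<kappa> (card B)"
  shows "\<bar>avg (cube m V) (\<lambda>x. F x * (\<Prod>B\<in>A0. w B (u B) x) * (\<Prod>B\<in>A. w B (u B) x))
     - avg (cube m V) (\<lambda>x. F x * (\<Prod>B\<in>A0. w B (u B) x)) * (\<Prod>B\<in>A. 1 / real (\<kappa> (card B)))\<bar> \<le> real (card A) * \<delta>"
  using A A0(3) u
proof (induction "card A" arbitrary: A)
  case 0
  then have "A = {}" using finite_subset[OF "0.prems"(1)] by simp
  then show ?case by simp
next
  case (Suc n)
  let ?X = "cube m V"
  have fA: "finite A" using Suc.prems(1) finite_subset by blast
  have fA0: "finite A0" using A0(1) finite_subset by blast
  have "A \<noteq> {}" using Suc.hyps(2) by auto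
  then have "Max (card ` A) \<in> card ` A" using fA by (intro Max_in) auto
  then obtain B where B: "B \<in> A" and MB: "Max (card ` A) = card B" by blast
  have mx: "card C \<le> card B" if "C \<in> A" for C
    unfolding MB[symmetric] using fA that by (intro Max_ge) auto
  define A' where "A' = A - {B}"
  have A': "A = insert B A'" "B \<notin> A'" "finite A'" "card A' = n"
    using B fA Suc.hyps(2) by (auto simp: A'_def)
  have Bm: "B \<subseteq> {..<m}" "finite B" using B Suc.prems(1) finite_subset[of B "{..<m}"] by auto
  let ?k = "1 / real (\<kappa> (card B))"
  let ?G = "\<lambda>x. F x * (\<Prod>C\<in>A0. w C (u C) x)"
  let ?R = "\<lambda>x. \<Prod>C\<in>A'. w C (u C) x"
  let ?p = "\<Prod>C\<in>A'. 1 / real (\<kappa> (card C))"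
  have k01: "0 \<le> ?k" "?k \<le> 1"
  proof -
    have "0 < \<kappa> (card B)" using v unfolding valid_weights_def by blast
    then show "0 \<le> ?k" "?k \<le> 1" by auto
  qed
  have miss: "\<exists>b\<in>B. dep m V (-{b}) f" if df: "dep m V C f" and nB: "\<not> B \<subseteq> C" for C and f :: "(nat \<Rightarrow> 'a) \<Rightarrow> real"
  proof -
    obtain b where b: "b \<in> B" "b \<notin> C" using nB by blast
    then have "dep m V (-{b}) f" by (intro dep_mono[OF df]) auto
    with b show ?thesis by blast
  qed
  have disj: "A0 \<inter> A' = {}" using A0(2) Suc.prems(2) A'(1) by blast
  define I where "I = insert None (Some ` (A0 \<union> A'))"
  define H where "H s x = (case s of None \<Rightarrow> F x | Some C \<Rightarrow> w C (u C) x)" for s x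
  have H: "(\<Prod>s\<in>I. H s x) = ?G x * ?R x" for x
  proof -
    have "(\<Prod>s\<in>I. H s x) = F x * (\<Prod>s\<in>Some ` (A0 \<union> A'). H s x)"
      unfolding I_def using fA0 A'(3) by (subst prod.insert) (auto simp: H_def)
    also have "(\<Prod>s\<in>Some ` (A0 \<union> A'). H s x) = (\<Prod>C\<in>A0 \<union> A'. w C (u C) x)"
      by (subst prod.reindex) (auto simp: H_def)
    also have "\<dots> = (\<Prod>C\<in>A0. w C (u C) x) * ?R x"
      using fA0 A'(3) disj by (rule prod.union_disjoint)
    finally show ?thesis by (simp add: mult.assoc)
  qed
  have wdep: "dep m V C (w C (u C))" if "C \<in> A0 \<union> A" for C
  proof -
    have "C \<subseteq> {..<m}" "u C < \<kappa> (card C)" using that Suc.prems(1,3) A0(1) by auto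
    then show ?thesis using v unfolding valid_weights_def by blast
  qed
  have "\<bar>avg ?X (\<lambda>x. (w B (u B) x - ?k) * (\<Prod>s\<in>I. H s x))\<bar> \<le> \<delta>"
  proof (rule unif_prod)
    show "unif m V B \<delta> (\<lambda>x. w B (u B) x - ?k)"
      using ind Bm(1) Suc.prems(3) B unfolding indep_weights_def by blast
    show "finite I" using fA0 A'(3) by (simp add: I_def)
    fix s assume s: "s \<in> I"
    show "\<exists>b\<in>B. dep m V (-{b}) (H s)"
    proof (cases s)
      case None
      have "\<exists>b\<in>B. dep m V (-{b}) F" by (rule miss[OF F(1)]) (use Suc.prems(2) B in blast)
      then show ?thesis using None by (simp add: H_def[abs_def])
    next
      case (Some C)
      then have C: "C \<in> A0 \<union> A'" using s by (auto simp: I_def)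
      have "\<not> B \<subseteq> C"
      proof
        assume BC: "B \<subseteq> C"
        show False
        proof (cases "C \<in> A0")
          case True
          then show ?thesis using BC A0(2) Suc.prems(2) B by blast
        next
          case False
          then have CA: "C \<in> A" "C \<noteq> B" using C A' by auto
          have "finite C" using CA(1) Suc.prems(1) finite_subset[of C "{..<m}"] by auto
          then have "B = C" using BC mx[OF CA(1)] by (simp add: card_seteq)
          then show False using CA by simp
        qed
      qed
      moreover have "dep m V C (w C (u C))" using C A' by (intro wdep) auto
      ultimately have "\<exists>b\<in>B. dep m V (-{b}) (w C (u C))" by (intro miss)
      then show ?thesis using Some by (simp add: H_def[abs_def])
    qed
    fix x assume x: "x \<in> ?X"
    show "0 \<le> H s x \<and> H s x \<le> 1"
    proof (cases s)
      case None
      then show ?thesis using F(2)[OF x] by (simp add: H_def)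
    next
      case (Some C)
      then have C: "C \<in> A0 \<union> A" using s A' by (auto simp: I_def)
      then have "C \<subseteq> {..<m}" "u C < \<kappa> (card C)" using Suc.prems(1,3) A0(1) by auto
      then show ?thesis using weight_bounds[OF v _ _ x] Some by (simp add: H_def)
    qed
  qed (rule Bm(2))
  then have 1: "\<bar>avg ?X (\<lambda>x. (w B (u B) x - ?k) * (?G x * ?R x))\<bar> \<le> \<delta>" by (simp only: H)
  have eq: "avg ?X (\<lambda>x. (w B (u B) x - ?k) * (?G x * ?R x)) =
      avg ?X (\<lambda>x. ?G x * (\<Prod>C\<in>A. w C (u C) x)) - ?k * avg ?X (\<lambda>x. ?G x * ?R x)"
    unfolding avg_cmult[symmetric] avg_diff[symmetric] A'(1) prod.insert[OF A'(3,2)]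
    by (intro avg_cong) (simp add: algebra_simps)
  have IH: "\<bar>avg ?X (\<lambda>x. ?G x * ?R x) - avg ?X ?G * ?p\<bar> \<le> real (card A') * \<delta>"
  proof (rule Suc.hyps(1))
    show "n = card A'" using A' by simp
    show "A' \<subseteq> Pow {..<m}" using Suc.prems(1) A' by auto
    show "\<not> C \<subseteq> B0" if "C \<in> A'" for C using Suc.prems(2) A' that by blast
    show "u C < \<kappa> (card C)" if "C \<in> A' \<union> A0" for C using Suc.prems(3) A' that by blast
  qed
  have "?k * \<bar>avg ?X (\<lambda>x. ?G x * ?R x) - avg ?X ?G * ?p\<bar> \<le> real n * \<delta>"
    using mult_mono[OF k01(2) IH] k01 A'(4) by simp
  then have 2: "\<bar>?k * avg ?X (\<lambda>x. ?G x * ?R x) - ?k * (avg ?X ?G * ?p)\<bar> \<le> real n * \<delta>"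
    using k01(1) by (simp only: right_diff_distrib[symmetric] abs_mult abs_of_nonneg)
  have "avg ?X ?G * (\<Prod>C\<in>A. 1 / real (\<kappa> (card C))) = ?k * (avg ?X ?G * ?p)"
    unfolding A'(1) prod.insert[OF A'(3,2)] by simp
  moreover have "real (card A) * \<delta> = \<delta> + real n * \<delta>" using Suc.hyps(2) by (simp flip: Suc.hyps(2) add: algebra_simps)
  ultimately show ?case using 1 2 unfolding eq by linarith
qed

section \<open>Simplex removal\<close>

lemma avg_weights_approx:
  assumes V: "finite V" "V \<noteq> {}" and v: "valid_weights m V \<kappa> w" and ind: "indep_weights m V \<kappa> w \<delta>"
    and D: "D \<subseteq> {..<m}" and u: "\<And>B. B \<subseteq> D \<Longrightarrow> u B < \<kappa> (card B)" and \<delta>: "0 \<le> \<delta>"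
  shows "\<bar>avg (cube m V) (\<lambda>x. \<Prod>B\<in>Pow D. w B (u B) x) - (\<Prod>B\<in>Pow D. 1 / real (\<kappa> (card B)))\<bar> \<le> 2 ^ m * \<delta>"
proof -
  let ?X = "cube m V" and ?A = "Pow D - {{}}"
  have fD: "finite D" using D finite_subset by blast
  have P: "Pow D = insert {} ?A" by auto
  have fA: "finite ?A" using fD by simp
  have k0: "\<kappa> 0 = 1" using v by (simp add: valid_weights_def)
  \<comment> \<open>The empty set cannot be peeled, as it lies in every \<open>B0\<close>; but it
    has a single cell, of weight \<open>1\<close>.\<close>
  have w0: "w {} (u {}) x = 1" if "x \<in> ?X" for x
  proof -
    have "(\<Sum>c<\<kappa> (card ({}::nat set)). w {} c x) = 1" using v that unfolding valid_weights_def by blast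
    moreover have "u {} = 0" using u[of "{}"] k0 by simp
    ultimately show ?thesis using k0 by simp
  qed
  have a: "\<bar>avg ?X (\<lambda>x. 1 * (\<Prod>B\<in>{}. w B (u B) x) * (\<Prod>B\<in>?A. w B (u B) x)) -
      avg ?X (\<lambda>x. 1 * (\<Prod>B\<in>{}. w B (u B) x)) * (\<Prod>B\<in>?A. 1 / real (\<kappa> (card B)))\<bar> \<le> real (card ?A) * \<delta>"
    by (rule peel_weights[OF V v ind, where ?B0.0 = "{}"]) (use D u in auto)
  have b: "avg ?X (\<lambda>x. 1 * (\<Prod>B\<in>{}. w B (u B) x) * (\<Prod>B\<in>?A. w B (u B) x)) =
     avg ?X (\<lambda>x. \<Prod>B\<in>Pow D. w B (u B) x)"
    using w0 by (intro avg_cong) (subst P, subst prod.insert[OF fA], auto)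
  have c: "(\<Prod>B\<in>Pow D. 1 / real (\<kappa> (card B))) = (\<Prod>B\<in>?A. 1 / real (\<kappa> (card B)))"
    by (subst P, subst prod.insert[OF fA]) (auto simp: k0)
  have d: "avg ?X (\<lambda>x. 1 * (\<Prod>B\<in>{}. w B (u B) x)) = 1" using V by (simp add: avg_const)
  have "real (card ?A) * \<delta> \<le> 2 ^ m * \<delta>"
  proof (intro mult_right_mono \<delta>)
    have "card ?A \<le> card (Pow {..<m})" using D by (intro card_mono) auto
    then have "card ?A \<le> 2 ^ m" by (simp add: card_Pow)
    then show "real (card ?A) \<le> 2 ^ m" by (metis of_nat_le_iff of_nat_numeral of_nat_power)
  qed
  then show ?thesis using a[unfolded b d c[symmetric]] by simp
qed

text \<open>The points of \<open>S\<close> are simplices no two of which share a facet; their facets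
  opposite coordinate \<open>i\<close> are encoded by \<open>A i\<close>. Choices of cells in which
  some \<open>A i\<close> fails to be nearly full are discarded. This loses less than all of
  \<open>S\<close>, so in some choice of cells all \<open>A i\<close> are nearly full, and there
  simplices are counted by independence.\<close>

lemma simplex_removal:
  fixes \<epsilon> :: real
  assumes m: "0 < m" and \<epsilon>: "0 < \<epsilon>"
  shows "\<exists>c>0. \<forall>(V :: 'a set) S. finite V \<longrightarrow> V \<noteq> {} \<longrightarrow> S \<subseteq> cube m V \<longrightarrow>
    (\<forall>x\<in>S. \<forall>y\<in>S. \<forall>i<m. (\<forall>k. k \<noteq> i \<longrightarrow> x k = y k) \<longrightarrow> x = y) \<longrightarrow>
    \<epsilon> * real (card V) ^ (m - 1) \<le> real (card S) \<longrightarrow>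
    c * real (card V) ^ m \<le> real (card {x \<in> cube m V. \<forall>i<m. \<exists>v\<in>V. x(i := v) \<in> S})"
proof -
  \<comment> \<open>The \<open>m\<close> facets lose the proportion \<open>\<eta>\<close> each, so
    half of the cell survives. \<open>Q\<close> counts the subsets of \<open>{..<m}\<close>, that is
    the factors of the density \<open>\<pi>\<close>, and \<open>M\<close> keeps all approximation
    errors together below \<open>\<pi> / 4\<close>.\<close>
  define \<eta> :: real where "\<eta> = 1 / (2 * real m)"
  have \<eta>: "0 < \<eta>" "\<eta> \<le> 1" using m by (auto simp: \<eta>_def field_simps)
  define Q :: nat where "Q = 2 ^ m"
  have Q: "real Q \<ge> 1" by (simp add: Q_def)
  define M where "M = 4 * (1 + 2 * real m) * real Q"
  have M: "0 < M" using Q by (simp add: M_def)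
  define \<delta> where "\<delta> K = 1 / real (max K 1) ^ Q / M" for K :: nat
  have \<delta>0: "0 < \<delta> K" for K unfolding \<delta>_def using M by (intro divide_pos_pos) auto
  have anti: "\<delta> L \<le> \<delta> K" if "K \<le> L" for K L
    unfolding \<delta>_def using that M by (intro divide_right_mono frac_le power_mono) auto
  \<comment> \<open>Makes discarded cells account for at most
    \<open>\<epsilon> / 2 * n ^ (m - 1)\<close> points of \<open>S\<close>, where
    \<open>n = card V\<close>.\<close>
  define \<epsilon>1 where "\<epsilon>1 = \<epsilon> / (2 * real m * (1 + 1 / \<eta>))"
  have \<epsilon>1: "0 < \<epsilon>1" unfolding \<epsilon>1_def using \<epsilon> m \<eta> by (intro divide_pos_pos mult_pos_pos) (auto intro: add_pos_pos)
  obtain Kmax where KM: "\<And>(V :: 'a set) (col :: nat set \<Rightarrow> (nat \<Rightarrow> 'a) \<Rightarrow> nat). finite V \<Longrightarrow> V \<noteq> {} \<Longrightarrow>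
    (\<forall>B\<subseteq>{..<m}. card B \<le> m - 1 \<longrightarrow> dep m V B (col B) \<and> (\<forall>x\<in>cube m V. col B x < 2)) \<Longrightarrow>
    (\<exists>K\<le>Kmax. \<exists>\<kappa> w g. valid_weights m V \<kappa> w \<and> (\<forall>l. \<kappa> l \<le> K) \<and> indep_weights m V \<kappa> w (\<delta> K) \<and>
       (\<forall>B\<subseteq>{..<m}. card B \<le> m - 1 \<longrightarrow> guess_err m V \<kappa> w (col B) (g B) B \<le> \<epsilon>1))"
    using structure_lemma[of \<epsilon>1 \<delta>, where m = m and j = "m - 1" and r = 2 and 'a = 'a, OF \<epsilon>1 \<delta>0 anti] by blast
  define c where "c = 1 / real (max Kmax 1) ^ Q / 4"
  have c: "0 < c" by (simp add: c_def less_max_iff_disj)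
  show ?thesis
  proof (intro exI[of _ c] conjI allI impI c)
    fix V :: "'a set" and S
    assume V: "finite V" "V \<noteq> {}" and S: "S \<subseteq> cube m V"
      and latin: "\<forall>x\<in>S. \<forall>y\<in>S. \<forall>i<m. (\<forall>k. k \<noteq> i \<longrightarrow> x k = y k) \<longrightarrow> x = y"
      and big: "\<epsilon> * real (card V) ^ (m - 1) \<le> real (card S)"
    let ?X = "cube m V"
    have fX: "finite ?X" "?X \<noteq> {}" using V by auto
    have fS: "finite S" using S fX finite_subset by blast
    have n: "card V > 0" using V by (simp add: card_gt_0_iff)
    define Bi where "Bi i = {..<m} - {i}" for i
    have Bi: "Bi i \<subseteq> {..<m}" "finite (Bi i)" for i by (auto simp: Bi_def)
    have Bi_card: "card (Bi i) \<le> m - 1" if "i < m" for i using that by (simp add: Bi_def)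
    have Bi_inj: "i = j" if "Bi i = Bi j" "i < m" "j < m" for i j using that by (auto simp: Bi_def)
    define A where "A i = {x \<in> ?X. \<exists>v\<in>V. x(i := v) \<in> S}" for i
    have A_dep: "dep m V (Bi i) (\<lambda>x. x \<in> A i)" for i
    proof (rule depI)
      fix x y assume xy: "x \<in> ?X" "y \<in> ?X" "\<And>k. k \<in> Bi i \<Longrightarrow> x k = y k"
      have "x(i := v) = y(i := v)" for v
      proof
        fix k
        show "(x(i := v)) k = (y(i := v)) k"
          using xy by (cases "k < m") (auto simp: Bi_def cube_def PiE_def extensional_def)
      qed
      then show "(x \<in> A i) = (y \<in> A i)" using xy by (simp add: A_def)
    qed
    define col where "col B x = (if \<exists>i<m. B = Bi i \<and> x \<in> A i then 1 else 0 :: nat)" for B x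
    have col_Bi: "col (Bi i) x = of_bool (x \<in> A i)" if "i < m" for i x
      using that Bi_inj by (auto simp: col_def)
    have "\<forall>B\<subseteq>{..<m}. card B \<le> m - 1 \<longrightarrow> dep m V B (col B) \<and> (\<forall>x\<in>?X. col B x < 2)"
    proof (intro allI impI conjI ballI)
      fix B
      show "dep m V B (col B)"
      proof (cases "\<exists>i<m. B = Bi i")
        case True
        then obtain i where i: "i < m" "B = Bi i" by blast
        have "col B = (\<lambda>x. of_bool (x \<in> A i))" using col_Bi[OF i(1)] i(2) by auto
        then show ?thesis using dep_comp[OF A_dep[of i], where F = of_bool] i(2) by simp
      next
        case False
        then have "col B = (\<lambda>x. 0)" by (intro ext) (auto simp: col_def)
        then show ?thesis by simp
      qed
      show "col B x < 2" for x by (simp add: col_def)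
    qed
    from KM[OF V this] obtain K \<kappa> w g where K: "K \<le> Kmax" and v: "valid_weights m V \<kappa> w" and \<kappa>K: "\<And>l. \<kappa> l \<le> K"
      and ind: "indep_weights m V \<kappa> w (\<delta> K)"
      and err0: "\<forall>B\<subseteq>{..<m}. card B \<le> m - 1 \<longrightarrow> guess_err m V \<kappa> w (col B) (g B) B \<le> \<epsilon>1" by blast
    have \<kappa>0: "0 < \<kappa> l" for l using v unfolding valid_weights_def by blast
    let ?W = "\<lambda>i u x. \<Prod>C\<in>Pow (Bi i). w C (u C) x"
    define \<mu> where "\<mu> i u = avg ?X (?W i u)" for i u
    define \<alpha> where "\<alpha> i u = avg ?X (\<lambda>x. (1 - of_bool (x \<in> A i)) * ?W i u x)" for i u
    define good where "good i u \<longleftrightarrow> \<alpha> i u \<le> \<eta> * \<mu> i u" for i u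
    have W0: "0 \<le> ?W i u x" if "x \<in> ?X" "u \<in> cells \<kappa> (Pow (Bi i))" for i u x
      using Bi by (intro cell_prod_nonneg[OF v that(1) _ that(2)]) auto
    \<comment> \<open>The probability, given \<open>x\<close>, that the cells of the subsets of
      \<open>Bi i\<close> are to be discarded.\<close>
    define \<psi> where "\<psi> i x = (\<Sum>u\<in>cells \<kappa> (Pow (Bi i)). ?W i u x * of_bool (\<not> good i u))" for i x
    \<comment> \<open>In a bad cell, either the guess claims the facet to be present, and then the
      proportion of errors exceeds \<open>\<eta>\<close>; or it does not, and every point of
      \<open>A i\<close> is an error.\<close>
    have bad: "avg ?X (\<lambda>x. of_bool (x \<in> A i) * \<psi> i x) \<le> (1 + 1 / \<eta>) * \<epsilon>1" if i: "i < m" for i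
    proof -
      let ?C = "cells \<kappa> (Pow (Bi i))"
      let ?e = "\<lambda>u. avg ?X (\<lambda>x. ?W i u x * of_bool (of_bool (x \<in> A i) \<noteq> g (Bi i) u))"
      have err: "(\<Sum>u\<in>?C. ?e u) \<le> \<epsilon>1"
        using err0[rule_format, OF Bi(1) Bi_card[OF i]] unfolding guess_err_def avg_sum col_Bi[OF i] .
      have e0: "0 \<le> ?e u" if "u \<in> ?C" for u
        using W0 that by (intro avg_nonneg) simp
      have "avg ?X (\<lambda>x. of_bool (x \<in> A i) * \<psi> i x) = (\<Sum>u\<in>?C. avg ?X (\<lambda>x. of_bool (x \<in> A i) * (?W i u x * of_bool (\<not> good i u))))"
        unfolding \<psi>_def sum_distrib_left avg_sum ..
      also have "\<dots> \<le> (\<Sum>u\<in>?C. (1 + 1 / \<eta>) * ?e u)"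
      proof (rule sum_mono)
        fix u assume u: "u \<in> ?C"
        show "avg ?X (\<lambda>x. of_bool (x \<in> A i) * (?W i u x * of_bool (\<not> good i u))) \<le> (1 + 1 / \<eta>) * ?e u"
        proof (cases "good i u")
          case True
          then have "avg ?X (\<lambda>x. of_bool (x \<in> A i) * (?W i u x * of_bool (\<not> good i u))) = 0"
            by (simp add: avg_def)
          also have "0 \<le> (1 + 1 / \<eta>) * ?e u" using e0[OF u] \<eta> by (intro mult_nonneg_nonneg) auto
          finally show ?thesis .
        next
          case bad: False
          have le\<mu>: "avg ?X (\<lambda>x. of_bool (x \<in> A i) * (?W i u x * of_bool (\<not> good i u))) \<le> \<mu> i u"
            unfolding \<mu>_def using W0 u by (intro avg_mono) auto
          show ?thesis
          proof (cases "g (Bi i) u = 1")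
            case True
            have "\<alpha> i u = ?e u" unfolding \<alpha>_def using True by (intro avg_cong) auto
            then have "\<eta> * \<mu> i u \<le> ?e u" using bad by (simp add: good_def)
            then have "\<mu> i u \<le> (1 / \<eta>) * ?e u" using \<eta> by (simp add: field_simps)
            also have "\<dots> \<le> (1 + 1 / \<eta>) * ?e u" using e0[OF u] by (intro mult_right_mono) auto
            finally show ?thesis using le\<mu> by linarith
          next
            case False
            have "avg ?X (\<lambda>x. of_bool (x \<in> A i) * (?W i u x * of_bool (\<not> good i u))) \<le> ?e u"
              using W0 u False by (intro avg_mono) auto
            also have "1 * ?e u \<le> (1 + 1 / \<eta>) * ?e u" using e0[OF u] \<eta> by (intro mult_right_mono) auto
            finally show ?thesis by simp
          qed
        qed
      qed
      also have "\<dots> = (1 + 1 / \<eta>) * (\<Sum>u\<in>?C. ?e u)" by (rule sum_distrib_left[symmetric])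
      also have "\<dots> \<le> (1 + 1 / \<eta>) * \<epsilon>1" using err \<eta> by (intro mult_left_mono) auto
      finally show ?thesis .
    qed
    have \<psi>_dep: "dep m V (Bi i) (\<psi> i)" if i: "i < m" for i
      unfolding \<psi>_def
    proof (intro dep_sum dep_comp2[where F = "(*)"] dep_prod dep_const)
      fix u C assume u: "u \<in> cells \<kappa> (Pow (Bi i))" and C: "C \<in> Pow (Bi i)"
      then have "u C < \<kappa> (card C)" "C \<subseteq> {..<m}" using Bi(1) by (auto simp: cells_def PiE_def Pi_def)
      then have "dep m V C (w C (u C))" using v unfolding valid_weights_def by blast
      then show "dep m V (Bi i) (w C (u C))" by (rule dep_mono) (use C in auto)
    qed
    have Ssum: "(\<Sum>x\<in>S. \<psi> i x) \<le> real (card V) ^ (m - 1) * ((1 + 1 / \<eta>) * \<epsilon>1)" if i: "i < m" for i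
    proof -
      \<comment> \<open>Distinct points of \<open>S\<close> have distinct facets opposite
        \<open>i\<close>, and \<open>\<psi> i\<close> ignores coordinate \<open>i\<close>; so the
        sum over \<open>S\<close> is the sum over \<open>A i\<close> divided by
        \<open>card V\<close>.\<close>
      have bij: "bij_betw (\<lambda>(x, v). x(i := v)) (S \<times> V) (A i)"
        unfolding bij_betw_def
      proof
        show "inj_on (\<lambda>(x, v). x(i := v)) (S \<times> V)"
        proof (rule inj_onI, clarify)
          fix x v y v' assume xy: "x \<in> S" "y \<in> S" and eq: "x(i := v) = y(i := v')"
          have "x k = y k" if "k \<noteq> i" for k using fun_cong[OF eq, of k] that by simp
          then have "x = y" using latin xy i by blast
          moreover have "v = v'" using fun_cong[OF eq, of i] by simp
          ultimately show "x = y \<and> v = v'" by simp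
        qed
        show "(\<lambda>(x, v). x(i := v)) ` (S \<times> V) = A i"
        proof (intro equalityI subsetI)
          fix y assume "y \<in> (\<lambda>(x, v). x(i := v)) ` (S \<times> V)"
          then obtain x v where xv: "x \<in> S" "v \<in> V" "y = x(i := v)" by auto
          have "y(i := x i) = x" using xv by simp
          moreover have "x i \<in> V" "y \<in> ?X" using xv S i by (auto simp: cube_def PiE_def Pi_def extensional_def)
          ultimately show "y \<in> A i" unfolding A_def using xv(1) by (intro CollectI conjI bexI[of _ "x i"]) auto
        next
          fix y assume "y \<in> A i"
          then obtain v where v: "y \<in> ?X" "v \<in> V" "y(i := v) \<in> S" by (auto simp: A_def)
          have "y i \<in> V" using v(1) i by (auto simp: cube_def)
          moreover have "y = (y(i := v))(i := y i)" by simp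
          ultimately show "y \<in> (\<lambda>(x, v). x(i := v)) ` (S \<times> V)" using v(3) by (intro image_eqI[of _ _ "(y(i := v), y i)"]) auto
        qed
      qed
      have "real (card V) * (\<Sum>x\<in>S. \<psi> i x) = (\<Sum>x\<in>S. \<Sum>v\<in>V. \<psi> i (x(i := v)))"
      proof -
        have "\<psi> i (x(i := v)) = \<psi> i x" if "x \<in> S" "v \<in> V" for x v
          using that S i by (intro depD[OF \<psi>_dep[OF i]] fun_upd_in_cube) (auto simp: Bi_def)
        then have "(\<Sum>x\<in>S. \<Sum>v\<in>V. \<psi> i (x(i := v))) = (\<Sum>x\<in>S. \<Sum>v\<in>V. \<psi> i x)" by simp
        then show ?thesis by (simp add: sum_distrib_left)
      qed
      also have "\<dots> = (\<Sum>p\<in>S \<times> V. \<psi> i ((\<lambda>(x, v). x(i := v)) p))"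
        by (simp add: sum.cartesian_product case_prod_beta)
      also have "\<dots> = (\<Sum>y\<in>A i. \<psi> i y)" by (rule sum.reindex_bij_betw[OF bij])
      also have "\<dots> = (\<Sum>y\<in>?X. of_bool (y \<in> A i) * \<psi> i y)"
        using fX by (intro sum.mono_neutral_cong_left) (auto simp: A_def)
      also have "\<dots> = real (card V) ^ m * avg ?X (\<lambda>x. of_bool (x \<in> A i) * \<psi> i x)"
        using n by (simp add: avg_def card_cube)
      also have "\<dots> \<le> real (card V) ^ m * ((1 + 1 / \<eta>) * \<epsilon>1)"
        by (intro mult_left_mono bad i) simp
      also have "\<dots> = real (card V) * (real (card V) ^ (m - 1) * ((1 + 1 / \<eta>) * \<epsilon>1))"
        using m by (cases m) auto
      finally show ?thesis using n by simp
    qed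
    \<comment> \<open>If every choice of cells had a bad facet, the probabilities
      \<open>\<psi> i x\<close> would add up to at least \<open>1\<close> at each point of
      \<open>S\<close>, more than the previous estimate allows.\<close>
    have "\<exists>u\<in>cells \<kappa> (Pow {..<m}). \<forall>i<m. good i (restrict u (Pow (Bi i)))"
    proof (rule ccontr)
      assume no: "\<not> ?thesis"
      have "1 \<le> (\<Sum>i<m. \<psi> i x)" if x: "x \<in> S" for x
      proof -
        have xX: "x \<in> ?X" using x S by blast
        let ?U = "cells \<kappa> (Pow {..<m})" and ?F = "\<lambda>u. \<Prod>C\<in>Pow {..<m}. w C (u C) x"
        have "1 = (\<Sum>u\<in>?U. ?F u * 1)"
          using sum_cells_marginal[OF v xX, of "Pow {..<m}" "{}" "\<lambda>_. 1"] by (simp add: cells_def)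
        also have "\<dots> \<le> (\<Sum>u\<in>?U. ?F u * (\<Sum>i<m. of_bool (\<not> good i (restrict u (Pow (Bi i))))))"
        proof (intro sum_mono mult_left_mono)
          fix u assume u: "u \<in> ?U"
          show "0 \<le> ?F u" by (rule cell_prod_nonneg[OF v xX _ u]) simp
          obtain i where i: "i < m" "\<not> good i (restrict u (Pow (Bi i)))" using no u by blast
          have "of_bool (\<not> good i (restrict u (Pow (Bi i)))) \<le> (\<Sum>i<m. of_bool (\<not> good i (restrict u (Pow (Bi i)))) :: real)"
            using i(1) by (intro member_le_sum) auto
          then show "1 \<le> (\<Sum>i<m. of_bool (\<not> good i (restrict u (Pow (Bi i)))) :: real)" using i(2) by simp
        qed
        also have "\<dots> = (\<Sum>i<m. \<Sum>u\<in>?U. ?F u * of_bool (\<not> good i (restrict u (Pow (Bi i)))))"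
          unfolding sum_distrib_left by (rule sum.swap)
        also have "\<dots> = (\<Sum>i<m. \<psi> i x)"
          unfolding \<psi>_def
          by (intro sum.cong refl sum_cells_marginal[OF v xX, where F = "\<lambda>u. of_bool (\<not> good _ u)"]) (use Bi(1) in auto)
        finally show ?thesis .
      qed
      then have "real (card S) \<le> (\<Sum>x\<in>S. \<Sum>i<m. \<psi> i x)" using sum_mono[of S "\<lambda>_. 1::real"] by simp
      also have "\<dots> = (\<Sum>i<m. \<Sum>x\<in>S. \<psi> i x)" by (rule sum.swap)
      also have "\<dots> \<le> (\<Sum>i<m. real (card V) ^ (m - 1) * ((1 + 1 / \<eta>) * \<epsilon>1))"
        by (intro sum_mono Ssum) simp
      also have "\<dots> = real (card V) ^ (m - 1) * (real m * ((1 + 1 / \<eta>) * \<epsilon>1))" by simp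
      also have "real m * ((1 + 1 / \<eta>) * \<epsilon>1) = \<epsilon> / 2"
      proof -
        have z: "real m * (z * (\<epsilon> / (2 * real m * z))) = \<epsilon> / 2" if "z > 0" for z
          using that m by (simp add: field_simps)
        show ?thesis unfolding \<epsilon>1_def using \<eta> by (intro z) (simp add: add_pos_pos)
      qed
      finally have "real (card S) \<le> real (card V) ^ (m - 1) * (\<epsilon> / 2)" .
      moreover have "0 < \<epsilon> * real (card V) ^ (m - 1)" using \<epsilon> n by simp
      ultimately show False using big by (simp add: field_simps)
    qed
    then obtain u where u: "u \<in> cells \<kappa> (Pow {..<m})" and gd: "\<And>i. i < m \<Longrightarrow> good i (restrict u (Pow (Bi i)))" by blast
    have uk: "u B < \<kappa> (card B)" if "B \<subseteq> {..<m}" for B using u that by (auto simp: cells_def PiE_def Pi_def)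
    let ?k = "\<lambda>B. 1 / real (\<kappa> (card B))"
    define \<pi> where "\<pi> = (\<Prod>B\<in>Pow {..<m}. ?k B)"
    define d where "d = real Q * \<delta> K"
    have d0: "0 \<le> d" unfolding d_def using less_imp_le[OF \<delta>0[of K]] by simp
    have dq: "2 ^ m * \<delta> K = d" by (simp add: d_def Q_def)
    let ?Wt = "\<lambda>x. \<Prod>B\<in>Pow {..<m}. w B (u B) x"
    have low: "avg ?X ?Wt \<ge> \<pi> - d"
      using avg_weights_approx[OF V v ind order_refl uk less_imp_le[OF \<delta>0]] unfolding dq \<pi>_def by linarith
    \<comment> \<open>The weights of sets not inside \<open>Bi i\<close> are peeled off, and
      goodness bounds what remains by the mass of the cell; each of these two approximations costs
      \<open>d\<close>.\<close>
    have up: "avg ?X (\<lambda>x. (1 - of_bool (x \<in> A i)) * ?Wt x) \<le> \<eta> * \<pi> + 2 * d" if i: "i < m" for i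
    proof -
      let ?A0 = "Pow (Bi i)" and ?R = "Pow {..<m} - Pow (Bi i)"
      let ?F = "\<lambda>x. 1 - of_bool (x \<in> A i) :: real"
      have split: "(\<Prod>B\<in>Pow {..<m}. f B) = (\<Prod>B\<in>?A0. f B) * (\<Prod>B\<in>?R. f B)" for f :: "nat set \<Rightarrow> real"
        by (subst prod.subset_diff[of ?A0]) (use Bi(1) in auto)
      have rst: "(\<Prod>B\<in>?A0. w B (restrict u ?A0 B) x) = (\<Prod>B\<in>?A0. w B (u B) x)" for x
        by (intro prod.cong) auto
      define p where "p = (\<Prod>B\<in>?A0. ?k B)"
      define r where "r = (\<Prod>B\<in>?R. ?k B)"
      have k01: "0 \<le> ?k B" "?k B \<le> 1" for B using \<kappa>0[of "card B"] by auto
      have r01: "0 \<le> r" "r \<le> 1" unfolding r_def using k01 by (auto intro!: prod_nonneg prod_le_1)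
      have pr: "p * r = \<pi>" unfolding \<pi>_def p_def r_def by (rule split[symmetric])
      have p1: "\<bar>avg ?X (\<lambda>x. ?F x * (\<Prod>B\<in>?A0. w B (u B) x) * (\<Prod>B\<in>?R. w B (u B) x)) -
          avg ?X (\<lambda>x. ?F x * (\<Prod>B\<in>?A0. w B (u B) x)) * r\<bar> \<le> real (card ?R) * \<delta> K"
        unfolding r_def
      proof (rule peel_weights[OF V v ind, where ?B0.0 = "Bi i"])
        show "dep m V (Bi i) ?F" using dep_comp[OF A_dep[of i], where F = "\<lambda>b. 1 - of_bool b :: real"] .
        show "?A0 \<subseteq> Pow {..<m}" using Bi(1) by auto
        show "u B < \<kappa> (card B)" if "B \<in> ?R \<union> ?A0" for B using that Bi(1) by (intro uk) auto
      qed auto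
      have p2: "avg ?X (\<lambda>x. ?F x * (\<Prod>B\<in>?A0. w B (u B) x) * (\<Prod>B\<in>?R. w B (u B) x)) = avg ?X (\<lambda>x. ?F x * ?Wt x)"
        by (intro avg_cong) (simp only: split mult.assoc)
      have p3: "avg ?X (\<lambda>x. ?F x * (\<Prod>B\<in>?A0. w B (u B) x)) = \<alpha> i (restrict u ?A0)"
        unfolding \<alpha>_def rst ..
      have p4: "real (card ?R) * \<delta> K \<le> d"
      proof -
        have "card ?R \<le> card (Pow {..<m})" by (intro card_mono) auto
        then have "card ?R \<le> Q" by (simp add: card_Pow Q_def)
        then show ?thesis unfolding d_def using less_imp_le[OF \<delta>0[of K]] by (intro mult_right_mono) auto
      qed
      have 1: "avg ?X (\<lambda>x. ?F x * ?Wt x) \<le> \<alpha> i (restrict u ?A0) * r + d"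
        using p1[unfolded p2 p3] p4 by linarith
      have "\<mu> i (restrict u ?A0) = avg ?X (\<lambda>x. \<Prod>B\<in>?A0. w B (u B) x)"
        unfolding \<mu>_def rst ..
      also have "\<dots> \<le> p + d"
        using avg_weights_approx[OF V v ind Bi(1)[of i] uk less_imp_le[OF \<delta>0]] Bi(1)[of i] unfolding dq p_def by fastforce
      finally have "\<eta> * \<mu> i (restrict u ?A0) \<le> \<eta> * (p + d)" using \<eta> by (intro mult_left_mono) auto
      then have "\<alpha> i (restrict u ?A0) \<le> \<eta> * (p + d)" using gd[OF i] unfolding good_def by linarith
      then have "\<alpha> i (restrict u ?A0) * r \<le> \<eta> * (p + d) * r" using r01 by (intro mult_right_mono) auto
      also have "\<dots> = \<eta> * \<pi> + \<eta> * r * d" by (simp add: pr[symmetric] algebra_simps)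
      also have "\<eta> * r * d \<le> 1 * d" using \<eta> r01 d0 by (intro mult_right_mono mult_le_one) auto
      finally show ?thesis using 1 by linarith
    qed
    let ?T = "{x \<in> ?X. \<forall>i<m. \<exists>v\<in>V. x(i := v) \<in> S}"
    have T: "x \<in> ?T \<longleftrightarrow> (\<forall>i<m. x \<in> A i)" if "x \<in> ?X" for x using that by (auto simp: A_def)
    have Wt01: "0 \<le> ?Wt x" "?Wt x \<le> 1" if "x \<in> ?X" for x
      using weight_bounds[OF v _ _ that] uk by (auto intro!: prod_nonneg prod_le_1)
    have "avg ?X ?Wt - (\<Sum>i<m. avg ?X (\<lambda>x. (1 - of_bool (x \<in> A i)) * ?Wt x)) =
        avg ?X (\<lambda>x. ?Wt x - (\<Sum>i<m. (1 - of_bool (x \<in> A i)) * ?Wt x))"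
      by (simp only: avg_diff avg_sum)
    also have "\<dots> \<le> avg ?X (\<lambda>x. of_bool (x \<in> ?T))"
    proof (rule avg_mono)
      fix x assume x: "x \<in> ?X"
      show "?Wt x - (\<Sum>i<m. (1 - of_bool (x \<in> A i)) * ?Wt x) \<le> of_bool (x \<in> ?T)"
      proof (cases "x \<in> ?T")
        case True
        have "(\<Sum>i<m. (1 - of_bool (x \<in> A i)) * ?Wt x) = 0" using True T[OF x] by (intro sum.neutral) auto
        then show ?thesis using Wt01[OF x] True by simp
      next
        case False
        then obtain i where i: "i < m" "x \<notin> A i" using T[OF x] by blast
        have "(1 - of_bool (x \<in> A i)) * ?Wt x \<le> (\<Sum>i<m. (1 - of_bool (x \<in> A i)) * ?Wt x)"
          using i(1) Wt01[OF x] by (intro member_le_sum) auto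
        then show ?thesis using False i(2) by simp
      qed
    qed
    also have "\<dots> = real (card ?T) / real (card V) ^ m"
    proof -
      have "(\<Sum>x\<in>?X. of_bool (x \<in> ?T) :: real) = (\<Sum>x\<in>?T. 1)"
        using fX(1) by (intro sum.mono_neutral_cong_right) auto
      then show ?thesis by (simp add: avg_def card_cube)
    qed
    finally have "avg ?X ?Wt - (\<Sum>i<m. avg ?X (\<lambda>x. (1 - of_bool (x \<in> A i)) * ?Wt x)) \<le> real (card ?T) / real (card V) ^ m" .
    moreover have "(\<Sum>i<m. avg ?X (\<lambda>x. (1 - of_bool (x \<in> A i)) * ?Wt x)) \<le> (\<Sum>i<m. \<eta> * \<pi> + 2 * d)"
      by (intro sum_mono up) simp
    moreover have "(\<Sum>i<m. \<eta> * \<pi> + 2 * d) = \<pi> / 2 + 2 * real m * d"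
      using m by (simp add: \<eta>_def field_simps)
    moreover have \<pi>K: "1 / real (max K 1) ^ Q \<le> \<pi>"
    proof -
      have "1 / real (max K 1) ^ Q = (\<Prod>B\<in>Pow {..<m}. 1 / real (max K 1))"
        by (simp add: Q_def card_Pow power_one_over)
      also have "\<dots> \<le> \<pi>" unfolding \<pi>_def
      proof (rule prod_mono)
        fix B
        have "\<kappa> (card B) \<le> max K 1" using \<kappa>K[of "card B"] by simp
        then have "real (\<kappa> (card B)) \<le> real (max K 1)" by (simp only: of_nat_le_iff)
        then show "0 \<le> 1 / real (max K 1) \<and> 1 / real (max K 1) \<le> ?k B" using \<kappa>0[of "card B"] by (auto intro!: frac_le)
      qed
      finally show ?thesis .
    qed
    moreover have "d + 2 * real m * d \<le> \<pi> / 4"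
    proof -
      have "d + 2 * real m * d = (1 + 2 * real m) * d" by (simp add: algebra_simps)
      also have "\<dots> = 1 / real (max K 1) ^ Q / 4"
        unfolding d_def \<delta>_def M_def using Q by (simp add: divide_simps)
      finally show ?thesis using \<pi>K by simp
    qed
    moreover have "c \<le> 1 / real (max K 1) ^ Q / 4"
      unfolding c_def using K by (intro divide_right_mono frac_le power_mono) auto
    moreover have "c \<le> t" if "a - s \<le> t" "s \<le> s'" "s' = \<pi> / 2 + b" "y \<le> \<pi>" "d + b \<le> \<pi> / 4"
        "c \<le> y / 4" "\<pi> - d \<le> a" for a s s' t b y using that by linarith
    ultimately have "c \<le> real (card ?T) / real (card V) ^ m" using low by blast
    then show "c * real (card V) ^ m \<le> real (card ?T)" using n by (simp add: field_simps)
  qed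
qed

section \<open>Linear 3-graphs\<close>

definition linear3 :: "'a set set \<Rightarrow> bool" where
  "linear3 H \<longleftrightarrow> (\<forall>f\<in>H. card f = 3) \<and> (\<forall>f\<in>H. \<forall>f'\<in>H. f \<noteq> f' \<longrightarrow> card (f \<inter> f') \<le> 1)"

lemma linear3_subset: "linear3 H \<Longrightarrow> H' \<subseteq> H \<Longrightarrow> linear3 H'"
  unfolding linear3_def by blast

lemma linear3_distinct:
  assumes "linear3 H" "{u, v, w} \<in> H"
  shows "u \<noteq> v" "u \<noteq> w" "v \<noteq> w"
proof -
  have "card {u, v, w} = 3" using assms by (auto simp: linear3_def)
  then show "u \<noteq> v" "u \<noteq> w" "v \<noteq> w" by (auto simp: card_insert_if split: if_splits)
qed

lemma linear3_third:
  assumes H: "linear3 H" and f: "{u, v, w} \<in> H" and f': "{u, v, w'} \<in> H"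
  shows "w = w'"
proof -
  have d: "u \<noteq> v" "u \<noteq> w" "v \<noteq> w" "u \<noteq> w'" "v \<noteq> w'"
    using linear3_distinct[OF H f] linear3_distinct[OF H f'] by auto
  have "{u, v, w} = {u, v, w'}"
  proof (rule ccontr)
    assume ne: "{u, v, w} \<noteq> {u, v, w'}"
    have "card ({u, v, w} \<inter> {u, v, w'}) \<le> 1" by (rule H[unfolded linear3_def, THEN conjunct2, rule_format, OF f f' ne])
    moreover have "card {u, v} \<le> card ({u, v, w} \<inter> {u, v, w'})" by (rule card_mono) auto
    moreover have "card {u, v} = 2" using d by simp
    ultimately show False by linarith
  qed
  then have "w \<in> {u, v, w'}" by blast
  then show ?thesis using d by simp
qed

text \<open>\<open>\<zeta>\<close> counts the vertices given for free. They may be added between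
  edges, which lets several stages of a construction be concatenated.\<close>

inductive built :: "'a set set \<Rightarrow> nat \<Rightarrow> 'a set \<Rightarrow> 'a set set \<Rightarrow> bool" for H where
  built_empty: "built H 0 {} {}"
| built_vertex: "built H \<zeta> U G \<Longrightarrow> built H (Suc \<zeta>) (insert v U) G"
| built_edge: "built H \<zeta> U G \<Longrightarrow> f \<in> H \<Longrightarrow> 2 \<le> card (f \<inter> U) \<Longrightarrow> built H \<zeta> (U \<union> f) (insert f G)"

text \<open>A new edge meets \<open>U\<close> in two of its three vertices, so it brings at most one
  new vertex; an edge already in \<open>G\<close> brings none.\<close>

lemma built_props:
  assumes "built H \<zeta> U G" "\<forall>f\<in>H. card f = 3"
  shows "finite U \<and> finite G \<and> G \<subseteq> H \<and> \<Union>G \<subseteq> U \<and> card U \<le> \<zeta> + card G"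
  using assms
proof (induction rule: built.induct)
  case (built_vertex \<zeta> U G v)
  then have "card (insert v U) \<le> Suc (card U)" by (simp add: card_insert_if)
  then show ?case using built_vertex by auto
next
  case (built_edge \<zeta> U G f)
  have f3: "card f = 3" using built_edge by blast
  have ff: "finite f" using f3 by (intro card_ge_0_finite) simp
  show ?case
  proof (cases "f \<in> G")
    case True
    then have "U \<union> f = U" using built_edge by blast
    then show ?thesis using built_edge True by (simp add: insert_absorb)
  next
    case False
    have "card (U \<union> f) = card U + card (f - U)"
      using built_edge ff by (metis Un_Diff_cancel card_Un_disjoint Diff_disjoint finite_Diff)
    moreover have "card f = card (f \<inter> U) + card (f - U)"
      using ff by (rule card_Int_Diff)
    moreover have "card (insert f G) = Suc (card G)" using built_edge False by simp
    ultimately have "card (U \<union> f) \<le> \<zeta> + card (insert f G)" using built_edge f3 by linarith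
    then show ?thesis using built_edge ff by auto
  qed
qed simp_all

text \<open>The edges come one at a time, so every intermediate number of edges occurs.\<close>

lemma built_prefix:
  assumes "built H \<zeta> U G" "\<forall>f\<in>H. card f = 3" "k \<le> card G"
  shows "\<exists>\<zeta>'\<le>\<zeta>. \<exists>U'\<subseteq>U. \<exists>G'\<subseteq>G. built H \<zeta>' U' G' \<and> card G' = k"
  using assms
proof (induction rule: built.induct)
  case built_empty
  then show ?case using built.built_empty by auto
next
  case (built_vertex \<zeta> U G v)
  then obtain \<zeta>' U' G' where *: "\<zeta>' \<le> \<zeta>" "U' \<subseteq> U" "G' \<subseteq> G" "built H \<zeta>' U' G'" "card G' = k" by blast
  then have "\<zeta>' \<le> Suc \<zeta>" "U' \<subseteq> insert v U" by auto
  with *(3-5) show ?case by blast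
next
  case (built_edge \<zeta> U G f)
  show ?case
  proof (cases "k \<le> card G")
    case True
    then obtain \<zeta>' U' G' where *: "\<zeta>' \<le> \<zeta>" "U' \<subseteq> U" "G' \<subseteq> G" "built H \<zeta>' U' G'" "card G' = k"
      using built_edge by blast
    then have "U' \<subseteq> U \<union> f" "G' \<subseteq> insert f G" by auto
    with *(1,4,5) show ?thesis by blast
  next
    case False
    have "finite G" using built_props[OF built_edge.hyps(1) built_edge.prems(1)] by blast
    then have "k = card (insert f G)" using False built_edge.prems(2) by (simp add: card_insert_if split: if_splits)
    moreover have "built H \<zeta> (U \<union> f) (insert f G)" using built_edge.hyps by (rule built.built_edge)
    ultimately show ?thesis by blast
  qed
qed

lemma built_edges:
  assumes "finite F" "built H \<zeta> U G" "F \<subseteq> H" "\<forall>f\<in>F. 2 \<le> card (f \<inter> U)" "\<forall>f\<in>H. card f = 3"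
  shows "built H \<zeta> (U \<union> \<Union>F) (G \<union> F)"
  using assms
proof (induction F rule: finite_induct)
  case (insert f F)
  have b: "built H \<zeta> (U \<union> \<Union>F) (G \<union> F)" using insert by simp
  have "finite f" using insert.prems by (intro card_ge_0_finite) auto
  then have "card (f \<inter> U) \<le> card (f \<inter> (U \<union> \<Union>F))" by (intro card_mono) auto
  moreover have "2 \<le> card (f \<inter> U)" using insert.prems by simp
  ultimately have "2 \<le> card (f \<inter> (U \<union> \<Union>F))" by linarith
  moreover have "f \<in> H" using insert.prems by simp
  ultimately have "built H \<zeta> (U \<union> \<Union>F \<union> f) (insert f (G \<union> F))" using b by (intro built_edge)
  moreover have "U \<union> \<Union>F \<union> f = U \<union> \<Union>(insert f F)" by blast
  ultimately show ?case by simp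
qed simp

section \<open>Walks with letters in a fixed set, and generic starting points\<close>

fun reach :: "'a set set \<Rightarrow> 'a set \<Rightarrow> 'a \<Rightarrow> nat \<Rightarrow> 'a set" where
  "reach H U a 0 = {a}"
| "reach H U a (Suc i) = {b. \<exists>s\<in>reach H U a i. \<exists>l\<in>U. {s, l, b} \<in> H}"

lemma reach_step: "s \<in> reach H U a i \<Longrightarrow> l \<in> U \<Longrightarrow> {s, l, b} \<in> H \<Longrightarrow> b \<in> reach H U a (Suc i)"
  by auto

lemma reach_front: "{a, l, s} \<in> H \<Longrightarrow> l \<in> U \<Longrightarrow> b \<in> reach H U s i \<Longrightarrow> b \<in> reach H U a (Suc i)"
proof (induction i arbitrary: b)
  case (Suc i)
  then obtain s' l' where "s' \<in> reach H U s i" "l' \<in> U" "{s', l', b} \<in> H" by auto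
  then show ?case using Suc reach_step by metis
qed auto

text \<open>A walk can be read backwards with the same letters. Hence the points from which
  \<open>U\<close> can be hit are among those reachable from \<open>U\<close>.\<close>

lemma reach_sym: "b \<in> reach H U a i \<Longrightarrow> a \<in> reach H U b i"
proof (induction i arbitrary: b)
  case (Suc i)
  then obtain s l where s: "s \<in> reach H U a i" "l \<in> U" "{s, l, b} \<in> H" by auto
  have "{b, l, s} \<in> H" using s(3) by (simp add: insert_commute)
  then show ?case using reach_front[of b l s H U a i] s Suc.IH by blast
qed simp

lemma finite_card_reach:
  assumes "linear3 H" "finite U"
  shows "finite (reach H U a i) \<and> card (reach H U a i) \<le> card U ^ i"
proof (induction i)
  case (Suc i)
  define R where "R = reach H U a i \<times> U"
  define nb where "nb p = (THE b. {fst p, snd p, b} \<in> H)" for p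
  have "finite R" "card R \<le> card U ^ Suc i"
    using Suc assms(2) by (auto simp: R_def card_cartesian_product)
  moreover have "reach H U a (Suc i) \<subseteq> nb ` R"
  proof
    fix b assume "b \<in> reach H U a (Suc i)"
    then obtain s l where s: "s \<in> reach H U a i" "l \<in> U" "{s, l, b} \<in> H" by auto
    have "nb (s, l) = b"
      unfolding nb_def fst_conv snd_conv using s(3)
      by (rule the_equality) (rule linear3_third[OF assms(1) _ s(3)])
    then show "b \<in> nb ` R" using s by (intro image_eqI[of _ _ "(s, l)"]) (auto simp: R_def)
  qed
  ultimately show ?case
    by (meson card_image_le card_mono finite_imageI finite_subset le_trans)
qed simp

text \<open>Keeps everything visited from \<open>a\<close> with letters in \<open>U\<close> apart
  from the old vertices; \<open>i = 0\<close> gives \<open>a \<notin> U\<close>.\<close>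

definition generic :: "'a set set \<Rightarrow> nat \<Rightarrow> 'a set \<Rightarrow> 'a \<Rightarrow> bool" where
  "generic H p U a \<longleftrightarrow> (\<forall>i\<le>p. reach H U a i \<inter> U = {})"

definition expand :: "'a set set \<Rightarrow> nat \<Rightarrow> 'a set \<Rightarrow> 'a \<Rightarrow> 'a set" where
  "expand H p U a = U \<union> (\<Union>i\<le>p. reach H U a i)"

fun expands :: "'a set set \<Rightarrow> nat \<Rightarrow> 'a set \<Rightarrow> 'a list \<Rightarrow> 'a set" where
  "expands H p U [] = U"
| "expands H p U (a # as) = expands H p (expand H p U a) as"

fun generics :: "'a set set \<Rightarrow> nat \<Rightarrow> 'a set \<Rightarrow> 'a list \<Rightarrow> bool" where
  "generics H p U [] = True"
| "generics H p U (a # as) \<longleftrightarrow> generic H p U a \<and> generics H p (expand H p U a) as"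

lemma generics_append: "generics H p U (as @ bs) \<longleftrightarrow> generics H p U as \<and> generics H p (expands H p U as) bs"
  by (induction as arbitrary: U) auto

lemma finite_card_union_reach:
  assumes H: "linear3 H" and U: "finite U" "card U \<le> N"
  shows "finite (\<Union>i\<le>p. reach H U a i) \<and> card (\<Union>i\<le>p. reach H U a i) \<le> Suc p * Suc N ^ p"
proof
  show "finite (\<Union>i\<le>p. reach H U a i)" using finite_card_reach[OF H U(1)] by blast
  have "card (\<Union>i\<le>p. reach H U a i) \<le> (\<Sum>i\<le>p. card (reach H U a i))" by (rule card_UN_le) simp
  also have "\<dots> \<le> (\<Sum>i\<le>p. Suc N ^ p)"
  proof (rule sum_mono)
    fix i assume "i \<in> {..p}"
    have "card (reach H U a i) \<le> card U ^ i" using finite_card_reach[OF H U(1)] by blast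
    also have "\<dots> \<le> Suc N ^ i" using U(2) by (intro power_mono) auto
    also have "\<dots> \<le> Suc N ^ p" using \<open>i \<in> {..p}\<close> by (intro power_increasing) auto
    finally show "card (reach H U a i) \<le> Suc N ^ p" .
  qed
  finally show "card (\<Union>i\<le>p. reach H U a i) \<le> Suc p * Suc N ^ p" by simp
qed

lemma finite_card_expand:
  assumes "linear3 H" "finite U" "card U \<le> N"
  shows "finite (expand H p U a) \<and> card (expand H p U a) \<le> N + Suc p * Suc N ^ p"
proof -
  note f = finite_card_union_reach[OF assms, where p = p and a = a]
  have "card (expand H p U a) \<le> card U + card (\<Union>i\<le>p. reach H U a i)"
    unfolding expand_def by (rule card_Un_le)
  then show ?thesis using f assms by (auto simp: expand_def)
qed

lemma card_nongeneric:
  assumes "linear3 H" "finite U" "card U \<le> N"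
  shows "finite {a. \<not> generic H p U a} \<and> card {a. \<not> generic H p U a} \<le> N * (Suc p * Suc N ^ p)"
proof -
  let ?B = "\<Union>b\<in>U. \<Union>i\<le>p. reach H U b i"
  have sub: "{a. \<not> generic H p U a} \<subseteq> ?B"
  proof
    fix a assume "a \<in> {a. \<not> generic H p U a}"
    then obtain i b where "i \<le> p" "b \<in> reach H U a i" "b \<in> U" unfolding generic_def by blast
    then show "a \<in> ?B" using reach_sym by fast
  qed
  have fB: "finite ?B" using finite_card_union_reach[OF assms] assms(2) by blast
  have "card ?B \<le> (\<Sum>b\<in>U. card (\<Union>i\<le>p. reach H U b i))" using assms(2) by (rule card_UN_le)
  also have "\<dots> \<le> (\<Sum>b\<in>U. Suc p * Suc N ^ p)"
    using finite_card_union_reach[OF assms] by (intro sum_mono) blast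
  also have "\<dots> = card U * (Suc p * Suc N ^ p)" by simp
  also have "\<dots> \<le> N * (Suc p * Suc N ^ p)" using assms(3) by (intro mult_right_mono) auto
  finally have "card ?B \<le> N * (Suc p * Suc N ^ p)" .
  then show ?thesis using sub fB by (meson card_mono finite_subset le_trans)
qed

lemma card_lists_Suc:
  "{as. set as \<subseteq> V \<and> length as = Suc t \<and> P as} = (\<lambda>(a, as). a # as) ` (SIGMA a:V. {as. set as \<subseteq> V \<and> length as = t \<and> P (a # as)})"
  (is "?L = ?R")
proof (intro equalityI subsetI)
  fix xs assume xs: "xs \<in> ?L"
  then obtain a as where "xs = a # as" by (cases xs) auto
  then show "xs \<in> ?R" using xs by (intro image_eqI[of _ _ "(a, as)"]) auto
qed auto

text \<open>The number of non-generic points is bounded independently of \<open>V\<close>, and so is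
  the growth of \<open>U\<close> under \<open>expand\<close>. A bad list has a bad entry, which
  costs one factor \<open>card V\<close>.\<close>

lemma card_not_generics:
  "\<exists>C. \<forall>(H :: 'a set set) U V. linear3 H \<longrightarrow> finite V \<longrightarrow> finite U \<longrightarrow> card U \<le> N \<longrightarrow>
     card {as. set as \<subseteq> V \<and> length as = t \<and> \<not> generics H p U as} \<le> C * card V ^ (t - 1)"
proof (induction t arbitrary: N)
  case 0
  show ?case by (rule exI[of _ 0]) (auto simp: card_eq_0_iff)
next
  case (Suc t)
  obtain C where C: "\<And>(H :: 'a set set) U V. linear3 H \<Longrightarrow> finite V \<Longrightarrow> finite U \<Longrightarrow> card U \<le> N + Suc p * Suc N ^ p \<Longrightarrow>
     card {as. set as \<subseteq> V \<and> length as = t \<and> \<not> generics H p U as} \<le> C * card V ^ (t - 1)"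
    using Suc[of "N + Suc p * Suc N ^ p"] by blast
  define D where "D = N * (Suc p * Suc N ^ p)"
  show ?case
  proof (intro exI[of _ "D + C"] allI impI)
    fix H :: "'a set set" and U V :: "'a set"
    assume H: "linear3 H" and V: "finite V" and U: "finite U" "card U \<le> N"
    let ?L = "{as. set as \<subseteq> V \<and> length as = t}"
    let ?F = "\<lambda>a. {as. set as \<subseteq> V \<and> length as = t \<and> \<not> generics H p U (a # as)}"
    have fL: "finite ?L" "card ?L = card V ^ t"
      using V by (auto simp: finite_lists_length_eq card_lists_length_eq)
    have fF: "finite (?F a)" for a by (rule finite_subset[OF _ fL(1)]) auto
    have fS: "finite (SIGMA a:V. ?F a)" using V fF by (intro finite_SigmaI) auto
    let ?B = "{a. \<not> generic H p U a}"
    have B: "finite ?B" "card ?B \<le> D" using card_nongeneric[OF H U, where p = p] by (auto simp: D_def)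
    have one: "card (?F a) \<le> (if a \<in> ?B then card V ^ t else C * card V ^ (t - 1))" for a
    proof (cases "a \<in> ?B")
      case True
      have "card (?F a) \<le> card ?L" using fL(1) by (intro card_mono) auto
      then show ?thesis using True fL(2) by simp
    next
      case False
      then have "?F a = {as. set as \<subseteq> V \<and> length as = t \<and> \<not> generics H p (expand H p U a) as}" by auto
      also have "card \<dots> \<le> C * card V ^ (t - 1)" using finite_card_expand[OF H U, where p = p and a = a] by (intro C H V) auto
      finally show ?thesis using False by simp
    qed
    have "card {as. set as \<subseteq> V \<and> length as = Suc t \<and> \<not> generics H p U as} \<le> card (SIGMA a:V. ?F a)"
      unfolding card_lists_Suc by (rule card_image_le[OF fS])
    also have "\<dots> = (\<Sum>a\<in>V. card (?F a))" using V fF by (intro card_SigmaI) auto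
    \<comment> \<open>For \<open>t = 0\<close> the truncated exponent \<open>t - 1\<close> would
      make the second term too large; as the empty list is never bad, it is switched off.\<close>
    also have "\<dots> \<le> (\<Sum>a\<in>V. (if a \<in> ?B then card V ^ t else 0) + C * card V ^ (t - 1) * of_bool (t > 0))"
    proof (rule sum_mono)
      fix a assume "a \<in> V"
      have "t = 0 \<Longrightarrow> a \<notin> ?B \<Longrightarrow> card (?F a) = 0" by (auto simp: card_eq_0_iff)
      then show "card (?F a) \<le> (if a \<in> ?B then card V ^ t else 0) + C * card V ^ (t - 1) * of_bool (t > 0)"
        using one[of a] by (cases "t = 0") auto
    qed
    also have "\<dots> = card (V \<inter> ?B) * card V ^ t + card V * (C * card V ^ (t - 1) * of_bool (t > 0))"
    proof -
      have "(\<Sum>a\<in>V. if a \<in> ?B then card V ^ t else 0) = card (V \<inter> ?B) * card V ^ t"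
        using V by (subst sum.inter_restrict[symmetric]) simp_all
      then show ?thesis by (simp only: sum.distrib sum_constant of_nat_id)
    qed
    also have "\<dots> \<le> D * card V ^ t + C * card V ^ t"
    proof (intro add_mono mult_right_mono)
      have "card (V \<inter> ?B) \<le> card ?B" using B(1) by (intro card_mono) auto
      then show "card (V \<inter> ?B) \<le> D" using B(2) by linarith
      show "card V * (C * card V ^ (t - 1) * of_bool (t > 0)) \<le> C * card V ^ t" by (cases t) auto
    qed simp
    finally show "card {as. set as \<subseteq> V \<and> length as = Suc t \<and> \<not> generics H p U as} \<le> (D + C) * card V ^ (Suc t - 1)"
      by (simp add: distrib_right)
  qed
qed

text \<open>Only \<open>a\<close> has to be paid for: every further vertex lies on an edge with a
  previously reached vertex and a letter in \<open>U\<close>.\<close>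

lemma built_expand:
  assumes H: "linear3 H" and b: "built H \<zeta> U G"
  shows "\<exists>G'. built H (Suc \<zeta>) (expand H p U a) G'"
proof -
  have H3: "\<forall>f\<in>H. card f = 3" using H by (simp add: linear3_def)
  have fU: "finite U" using built_props[OF b H3] by blast
  have "\<exists>G'. built H (Suc \<zeta>) (U \<union> (\<Union>i\<le>k. reach H U a i)) G'" for k
  proof (induction k)
    case 0
    have "built H (Suc \<zeta>) (insert a U) G" using b by (rule built_vertex)
    then show ?case by auto
  next
    case (Suc k)
    then obtain G' where G': "built H (Suc \<zeta>) (U \<union> (\<Union>i\<le>k. reach H U a i)) G'" (is "built H _ ?U _") by blast
    define F where "F = {{s, l, b} | s l b. s \<in> reach H U a k \<and> l \<in> U \<and> {s, l, b} \<in> H}"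
    have fin: "finite (reach H U a i)" for i using finite_card_reach[OF H fU] by blast
    have "F \<subseteq> (\<lambda>(s, l, b). {s, l, b}) ` (reach H U a k \<times> U \<times> reach H U a (Suc k))"
      unfolding F_def by (auto intro!: rev_image_eqI)
    then have fF: "finite F" using fin fU by (meson finite_SigmaI finite_imageI finite_subset)
    have "built H (Suc \<zeta>) (?U \<union> \<Union>F) (G' \<union> F)"
    proof (rule built_edges[OF fF G' _ _ H3])
      show "F \<subseteq> H" by (auto simp: F_def)
      show "\<forall>f\<in>F. 2 \<le> card (f \<inter> ?U)"
      proof
        fix f assume "f \<in> F"
        then obtain s l b where f: "f = {s, l, b}" "s \<in> reach H U a k" "l \<in> U" "{s, l, b} \<in> H" by (auto simp: F_def)
        have "s \<noteq> l" using linear3_distinct[OF H f(4)] by blast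
        then have "2 = card {s, l}" by simp
        also have "\<dots> \<le> card (f \<inter> ?U)" using f by (intro card_mono) auto
        finally show "2 \<le> card (f \<inter> ?U)" .
      qed
    qed
    moreover have "?U \<union> \<Union>F = U \<union> (\<Union>i\<le>Suc k. reach H U a i)"
    proof (intro equalityI subsetI)
      fix v assume "v \<in> ?U \<union> \<Union>F"
      then show "v \<in> U \<union> (\<Union>i\<le>Suc k. reach H U a i)"
      proof
        assume "v \<in> \<Union>F"
        then obtain s l b where f: "v \<in> {s, l, b}" "s \<in> reach H U a k" "l \<in> U" "{s, l, b} \<in> H" by (auto simp: F_def)
        then have "b \<in> reach H U a (Suc k)" by auto
        moreover have "s \<in> (\<Union>i\<le>Suc k. reach H U a i)" using f(2) by (intro UN_I[of k]) auto
        ultimately show ?thesis using f(1,3) by blast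
      qed (auto simp: atMost_Suc)
    next
      fix v assume "v \<in> U \<union> (\<Union>i\<le>Suc k. reach H U a i)"
      then consider "v \<in> ?U" | "v \<in> reach H U a (Suc k)" by (auto simp: atMost_Suc)
      then show "v \<in> ?U \<union> \<Union>F"
      proof cases
        case 2
        then obtain s l where "s \<in> reach H U a k" "l \<in> U" "{s, l, v} \<in> H" by auto
        then have "{s, l, v} \<in> F" by (auto simp: F_def)
        then show ?thesis by blast
      qed blast
    qed
    ultimately show ?case by metis
  qed
  then show ?thesis by (simp add: expand_def)
qed

lemma built_expands:
  assumes "linear3 H" "built H \<zeta> U G"
  shows "\<exists>G'. built H (\<zeta> + length as) (expands H p U as) G'"
  using assms(2)
proof (induction as arbitrary: \<zeta> U G)
  case (Cons a as)
  obtain G' where "built H (Suc \<zeta>) (expand H p U a) G'" using built_expand[OF assms(1) Cons.prems] by blast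
  from Cons.IH[OF this] show ?case by simp
qed auto

section \<open>Walks and towers\<close>

text \<open>The colouring \<open>\<chi>\<close> separates the layers of a walk, so that the edges used at different steps
  of different walks never coincide.\<close>

definition spine :: "'a set set \<Rightarrow> ('a \<Rightarrow> nat) \<Rightarrow> nat \<Rightarrow> 'a \<Rightarrow> (nat \<Rightarrow> 'a) \<Rightarrow> (nat \<Rightarrow> 'a) \<Rightarrow> bool" where
  "spine H \<chi> p z y \<sigma> \<longleftrightarrow> \<sigma> 0 = y 0 \<and> \<sigma> p = z \<and> (\<forall>i<p. {\<sigma> i, y (Suc i), \<sigma> (Suc i)} \<in> H) \<and> (\<forall>i\<le>p. \<chi> (\<sigma> i) = i)"

definition path :: "'a set set \<Rightarrow> ('a \<Rightarrow> nat) \<Rightarrow> nat \<Rightarrow> 'a \<Rightarrow> (nat \<Rightarrow> 'a) \<Rightarrow> bool" where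
  "path H \<chi> p z y \<longleftrightarrow> (\<exists>\<sigma>. spine H \<chi> p z y \<sigma>)"

text \<open>Each list entry is a new starting point \<open>a\<close>; whichever letter is replaced,
  the result is a tower for the remaining entries, so that replacements can be iterated. Coordinate
  \<open>0\<close> of a word is its starting point.\<close>

fun tower :: "'a set set \<Rightarrow> ('a \<Rightarrow> nat) \<Rightarrow> nat \<Rightarrow> 'a \<Rightarrow> 'a list \<Rightarrow> (nat \<Rightarrow> 'a) \<Rightarrow> bool" where
  "tower H \<chi> p z [] y \<longleftrightarrow> path H \<chi> p z y"
| "tower H \<chi> p z (a # as) y \<longleftrightarrow> tower H \<chi> p z as y \<and> (\<forall>j\<in>{1..p}. \<exists>l. tower H \<chi> p z as (y(0 := a, j := l)))"

lemma tower_path: "tower H \<chi> p z as y \<Longrightarrow> path H \<chi> p z y"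
  by (induction as) auto

lemma seq_forward:
  assumes H: "linear3 H" and s: "\<And>i. i < k \<Longrightarrow> {\<sigma> i, l i, \<sigma> (Suc i)} \<in> H"
    "\<And>i. i < k \<Longrightarrow> {\<sigma>' i, l i, \<sigma>' (Suc i)} \<in> H" and "\<sigma> 0 = \<sigma>' 0"
  shows "i \<le> k \<Longrightarrow> \<sigma> i = \<sigma>' i"
proof (induction i)
  case (Suc i)
  then have "\<sigma> i = \<sigma>' i" "i < k" by auto
  then show ?case using linear3_third[OF H, of "\<sigma> i" "l i"] s[of i] by metis
qed (rule assms(4))

lemma seq_backward:
  assumes H: "linear3 H" and s: "\<And>i. j \<le> i \<Longrightarrow> i < k \<Longrightarrow> {\<sigma> i, l i, \<sigma> (Suc i)} \<in> H"
    "\<And>i. j \<le> i \<Longrightarrow> i < k \<Longrightarrow> {\<sigma>' i, l i, \<sigma>' (Suc i)} \<in> H" and "\<sigma> k = \<sigma>' k"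
  shows "i \<le> k \<Longrightarrow> j \<le> i \<Longrightarrow> \<sigma> i = \<sigma>' i"
proof (induction i rule: inc_induct)
  case (step i)
  then have eq: "\<sigma> (Suc i) = \<sigma>' (Suc i)" by auto
  have "{\<sigma> (Suc i), l i, \<sigma> i} \<in> H" "{\<sigma> (Suc i), l i, \<sigma>' i} \<in> H"
    using s[of i] step eq by (simp_all add: insert_commute)
  then show ?case by (rule linear3_third[OF H])
qed (rule assms(4))

text \<open>Reading forwards from the start and backwards from \<open>z\<close> determines the spine
  on both sides of an unknown letter, and linearity then gives the letter. An unknown start is found
  by reading backwards all the way.\<close>

lemma path_latin:
  assumes H: "linear3 H" and y: "y \<in> cube (Suc p) V" "y' \<in> cube (Suc p) V"
    and py: "path H \<chi> p z y" "path H \<chi> p z y'" and i: "i < Suc p" and eq: "\<forall>k. k \<noteq> i \<longrightarrow> y k = y' k"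
  shows "y = y'"
proof -
  obtain \<sigma> \<sigma>' where \<sigma>: "spine H \<chi> p z y \<sigma>" and \<sigma>': "spine H \<chi> p z y' \<sigma>'" using py unfolding path_def by blast
  have e: "\<And>k. k < p \<Longrightarrow> {\<sigma> k, y (Suc k), \<sigma> (Suc k)} \<in> H" "\<And>k. k < p \<Longrightarrow> {\<sigma>' k, y' (Suc k), \<sigma>' (Suc k)} \<in> H"
    and ends: "\<sigma> 0 = y 0" "\<sigma>' 0 = y' 0" "\<sigma> p = \<sigma>' p"
    using \<sigma> \<sigma>' by (auto simp: spine_def)
  have "y i = y' i"
  proof (cases i)
    case 0
    have "\<sigma> 0 = \<sigma>' 0"
    proof (rule seq_backward[OF H, where j = 0 and k = p and l = "\<lambda>k. y (Suc k)"])
      fix k assume "k < p"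
      moreover have "y (Suc k) = y' (Suc k)" using eq 0 by auto
      ultimately show "{\<sigma> k, y (Suc k), \<sigma> (Suc k)} \<in> H" "{\<sigma>' k, y (Suc k), \<sigma>' (Suc k)} \<in> H" using e[of k] by auto
    qed (auto simp: ends)
    then show ?thesis using 0 ends by simp
  next
    case (Suc j)
    have jp: "j < p" using Suc i by simp
    have "\<sigma> j = \<sigma>' j"
    proof (rule seq_forward[OF H, where k = j and l = "\<lambda>k. y (Suc k)"])
      fix k assume "k < j"
      moreover then have "y (Suc k) = y' (Suc k)" using eq Suc by auto
      ultimately show "{\<sigma> k, y (Suc k), \<sigma> (Suc k)} \<in> H" "{\<sigma>' k, y (Suc k), \<sigma>' (Suc k)} \<in> H" using e[of k] jp by auto
    next
      show "\<sigma> 0 = \<sigma>' 0" using ends eq Suc by auto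
    qed simp
    moreover have "\<sigma> (Suc j) = \<sigma>' (Suc j)"
    proof (rule seq_backward[OF H, where j = "Suc j" and k = p and l = "\<lambda>k. y (Suc k)"])
      fix k assume k: "Suc j \<le> k" "k < p"
      then have "y (Suc k) = y' (Suc k)" using eq Suc by auto
      then show "{\<sigma> k, y (Suc k), \<sigma> (Suc k)} \<in> H" "{\<sigma>' k, y (Suc k), \<sigma>' (Suc k)} \<in> H" using e[of k] k by auto
    qed (use ends jp in auto)
    ultimately have "{\<sigma> j, \<sigma> (Suc j), y (Suc j)} \<in> H" "{\<sigma> j, \<sigma> (Suc j), y' (Suc j)} \<in> H"
      using e[OF jp] by (simp_all add: insert_commute)
    then show ?thesis unfolding Suc by (rule linear3_third[OF H])
  qed
  then have "y k = y' k" for k using eq by (cases "k = i") auto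
  then show ?thesis by auto
qed

lemma card_path_le:
  assumes H: "linear3 H" and V: "finite V"
  shows "card {y \<in> cube (Suc p) V. path H \<chi> p z y} \<le> card V ^ p"
proof -
  let ?Y = "{y \<in> cube (Suc p) V. path H \<chi> p z y}"
  let ?r = "\<lambda>y. restrict y {1..p}"
  have "inj_on ?r ?Y"
  proof (rule inj_onI)
    fix y y' assume y: "y \<in> ?Y" "y' \<in> ?Y" and eq: "?r y = ?r y'"
    show "y = y'"
    proof (rule path_latin[OF H, where i = 0])
      show "\<forall>k. k \<noteq> 0 \<longrightarrow> y k = y' k"
      proof (intro allI impI)
        fix k :: nat assume "k \<noteq> 0"
        show "y k = y' k"
        proof (cases "k \<le> p")
          case True
          then show ?thesis using fun_cong[OF eq, of k] \<open>k \<noteq> 0\<close> by simp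
        next
          case False
          then show ?thesis using y by (auto simp: cube_def PiE_def extensional_def)
        qed
      qed
    qed (use y in auto)
  qed
  moreover have "?r ` ?Y \<subseteq> {1..p} \<rightarrow>\<^sub>E V"
    by (auto simp: cube_def PiE_def Pi_def)
  moreover have "finite ({1..p} \<rightarrow>\<^sub>E V)" using V by (intro finite_PiE) auto
  ultimately have "card ?Y \<le> card ({1..p} \<rightarrow>\<^sub>E V)" by (rule card_inj_on_le)
  then show ?thesis by (simp add: card_PiE)
qed

text \<open>Popularity argument: elements with a value below \<open>c / 2 * M\<close> contribute at
  most half of the total.\<close>

lemma many_rich:
  fixes f :: "'b \<Rightarrow> nat" and c N M :: real
  assumes "finite A" "\<And>a. a \<in> A \<Longrightarrow> real (f a) \<le> M" "real (card A) \<le> N" "c * (N * M) \<le> real (\<Sum>a\<in>A. f a)"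
    "0 < M" "0 \<le> c"
  shows "c / 2 * N \<le> real (card {a\<in>A. c / 2 * M \<le> real (f a)})"
proof -
  let ?R = "{a\<in>A. c / 2 * M \<le> real (f a)}"
  have "c * (N * M) \<le> (\<Sum>a\<in>A. real (f a))" using assms(4) by simp
  also have "\<dots> \<le> (\<Sum>a\<in>A. (if a \<in> ?R then M else 0) + c / 2 * M)"
  proof (rule sum_mono)
    fix a assume "a \<in> A"
    moreover have "0 \<le> c / 2 * M" using assms(5,6) by simp
    ultimately show "real (f a) \<le> (if a \<in> ?R then M else 0) + c / 2 * M"
      using assms(2)[of a] by (cases "a \<in> ?R") auto
  qed
  also have "\<dots> = real (card ?R) * M + real (card A) * (c / 2 * M)"
  proof -
    have "(\<Sum>a\<in>A. if a \<in> ?R then M else 0) = (\<Sum>a\<in>?R. M)"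
      using assms(1) by (intro sum.mono_neutral_cong_right) auto
    then show ?thesis by (simp add: sum.distrib)
  qed
  also have "real (card A) * (c / 2 * M) \<le> N * (c / 2 * M)"
    using assms by (intro mult_right_mono) auto
  finally have "c / 2 * N * M \<le> real (card ?R) * M" by (simp add: field_simps)
  then show ?thesis using assms(5) by simp
qed

text \<open>For a list with many towers, removal is applied to these towers. A resulting simplex
  \<open>x\<close> yields the new list entry \<open>x 0\<close> and the tower
  \<open>x(0 := v)\<close>; changing another coordinate \<open>j\<close> of \<open>x\<close> gives
  exactly this tower with start \<open>x 0\<close> and letter \<open>j\<close> replaced.\<close>

lemma tower_count:
  fixes c :: real
  assumes c: "0 < c"
  shows "\<exists>c'>0. \<forall>(V :: 'a set) H \<chi> z. linear3 H \<longrightarrow> finite V \<longrightarrow> V \<noteq> {} \<longrightarrow>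
    c * real (card V) ^ p \<le> real (card {y \<in> cube (Suc p) V. path H \<chi> p z y}) \<longrightarrow>
    c' * real (card V) ^ (t + p) \<le> real (card (SIGMA as:{as. set as \<subseteq> V \<and> length as = t}. {y \<in> cube (Suc p) V. tower H \<chi> p z as y}))"
proof (induction t)
  case 0
  have "(SIGMA as:{as. set as \<subseteq> V \<and> length as = 0}. {y \<in> cube (Suc p) V. tower H \<chi> p z as y}) =
     Pair [] ` {y \<in> cube (Suc p) V. path H \<chi> p z y}" for H :: "'a set set" and V \<chi> z by auto
  then have "card (SIGMA as:{as. set as \<subseteq> V \<and> length as = 0}. {y \<in> cube (Suc p) V. tower H \<chi> p z as y}) =
     card {y \<in> cube (Suc p) V. path H \<chi> p z y}" for H :: "'a set set" and V \<chi> z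
    by (simp add: card_image inj_on_def)
  then show ?case using c by (intro exI[of _ c]) simp
next
  case (Suc t)
  then obtain c' where c': "c' > 0" and IH: "\<And>(V :: 'a set) H \<chi> z. linear3 H \<Longrightarrow> finite V \<Longrightarrow> V \<noteq> {} \<Longrightarrow>
    c * real (card V) ^ p \<le> real (card {y \<in> cube (Suc p) V. path H \<chi> p z y}) \<Longrightarrow>
    c' * real (card V) ^ (t + p) \<le> real (card (SIGMA as:{as. set as \<subseteq> V \<and> length as = t}. {y \<in> cube (Suc p) V. tower H \<chi> p z as y}))"
    by blast
  obtain d where d: "d > 0" and rem: "\<And>(V :: 'a set) S. finite V \<Longrightarrow> V \<noteq> {} \<Longrightarrow> S \<subseteq> cube (Suc p) V \<Longrightarrow>
    (\<forall>x\<in>S. \<forall>y\<in>S. \<forall>i<Suc p. (\<forall>k. k \<noteq> i \<longrightarrow> x k = y k) \<longrightarrow> x = y) \<Longrightarrow>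
    c' / 2 * real (card V) ^ (Suc p - 1) \<le> real (card S) \<Longrightarrow>
    d * real (card V) ^ Suc p \<le> real (card {x \<in> cube (Suc p) V. \<forall>i<Suc p. \<exists>v\<in>V. x(i := v) \<in> S})"
    using simplex_removal[of "Suc p" "c' / 2", where 'a = 'a] c' by auto
  show ?case
  proof (intro exI[of _ "c' / 2 * d"] conjI allI impI)
    show "0 < c' / 2 * d" using c' d by simp
    fix V :: "'a set" and H \<chi> z
    assume H: "linear3 H" and V: "finite V" "V \<noteq> {}"
      and base: "c * real (card V) ^ p \<le> real (card {y \<in> cube (Suc p) V. path H \<chi> p z y})"
    let ?n = "real (card V)"
    have n: "?n > 0" using V by (simp add: card_gt_0_iff)
    let ?L = "\<lambda>t. {as. set as \<subseteq> V \<and> length as = t}"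
    define Y where "Y as = {y \<in> cube (Suc p) V. tower H \<chi> p z as y}" for as
    have fL: "finite (?L t)" "card (?L t) = card V ^ t" for t
      using V by (auto simp: finite_lists_length_eq card_lists_length_eq)
    have fY: "finite (Y as)" for as using V by (simp add: Y_def)
    have Yp: "Y as \<subseteq> {y \<in> cube (Suc p) V. path H \<chi> p z y}" for as unfolding Y_def by (auto dest: tower_path)
    have Yle: "card (Y as) \<le> card V ^ p" for as
    proof -
      have "card (Y as) \<le> card {y \<in> cube (Suc p) V. path H \<chi> p z y}" using V by (intro card_mono Yp) auto
      also have "\<dots> \<le> card V ^ p" by (rule card_path_le[OF H V(1)])
      finally show ?thesis .
    qed
    define R where "R = {as \<in> ?L t. c' / 2 * ?n ^ p \<le> real (card (Y as))}"
    have Rbig: "c' / 2 * ?n ^ t \<le> real (card R)"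
      unfolding R_def
    proof (rule many_rich[OF fL(1)])
      show "real (card (Y as)) \<le> ?n ^ p" for as using Yle[of as] by (metis of_nat_le_iff of_nat_power)
      show "real (card (?L t)) \<le> ?n ^ t" by (simp add: fL(2))
      have "card (SIGMA as:?L t. Y as) = (\<Sum>as\<in>?L t. card (Y as))" using fL(1) fY by (intro card_SigmaI) auto
      then show "c' * (?n ^ t * ?n ^ p) \<le> real (\<Sum>as\<in>?L t. card (Y as))"
        using IH[OF H V base] by (simp add: Y_def power_add)
    qed (use n c' in auto)
    define X where "X as = {x \<in> cube (Suc p) V. \<forall>i<Suc p. \<exists>v\<in>V. x(i := v) \<in> Y as}" for as
    have Xbig: "d * ?n ^ Suc p \<le> real (card (X as))" if "as \<in> R" for as
      unfolding X_def
    proof (rule rem[OF V])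
      show "Y as \<subseteq> cube (Suc p) V" by (auto simp: Y_def)
      show "\<forall>x\<in>Y as. \<forall>y\<in>Y as. \<forall>i<Suc p. (\<forall>k. k \<noteq> i \<longrightarrow> x k = y k) \<longrightarrow> x = y"
      proof (intro ballI allI impI)
        fix x y i assume "x \<in> Y as" "y \<in> Y as" "i < Suc p" "\<forall>k. k \<noteq> i \<longrightarrow> x k = y k"
        then show "x = y" using Yp[of as] by (intro path_latin[OF H, of x p V y]) auto
      qed
      show "c' / 2 * ?n ^ (Suc p - 1) \<le> real (card (Y as))" using that by (simp add: R_def)
    qed
    define v0 where "v0 as x = (SOME v. v \<in> V \<and> x(0 := v) \<in> Y as)" for as x
    have v0: "v0 as x \<in> V \<and> x(0 := v0 as x) \<in> Y as" if "x \<in> X as" for as x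
      unfolding v0_def by (rule someI_ex) (use that in \<open>auto simp: X_def\<close>)
    \<comment> \<open>\<open>x\<close> can be recovered: its start is the head of the new list, its
      letters are those of the tower.\<close>
    define \<phi> where "\<phi> = (\<lambda>(as, x). (x 0 # as, x(0 := v0 as x)))"
    have sub: "\<phi> ` (SIGMA as:R. X as) \<subseteq> (SIGMA as:?L (Suc t). Y as)"
    proof
      fix q assume "q \<in> \<phi> ` (SIGMA as:R. X as)"
      then obtain as x where q: "q = (x 0 # as, x(0 := v0 as x))" and as: "as \<in> R" and x: "x \<in> X as"
        by (auto simp: \<phi>_def)
      have v: "v0 as x \<in> V" "x(0 := v0 as x) \<in> Y as" using v0[OF x] by auto
      have "tower H \<chi> p z (x 0 # as) (x(0 := v0 as x))"
        unfolding tower.simps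
      proof (intro conjI ballI)
        show "tower H \<chi> p z as (x(0 := v0 as x))" using v by (simp add: Y_def)
        fix j assume j: "j \<in> {1..p}"
        then obtain l where "x(j := l) \<in> Y as" using x by (auto simp: X_def less_Suc_eq_le)
        moreover have "(x(0 := v0 as x))(0 := x 0, j := l) = x(j := l)" by auto
        ultimately show "\<exists>l. tower H \<chi> p z as ((x(0 := v0 as x))(0 := x 0, j := l))"
          by (intro exI[of _ l]) (simp only: Y_def mem_Collect_eq)
      qed
      moreover have "x 0 \<in> V" using x by (auto simp: X_def cube_def)
      ultimately show "q \<in> (SIGMA as:?L (Suc t). Y as)"
        using v as unfolding q by (auto simp: R_def Y_def)
    qed
    have inj: "inj_on \<phi> (SIGMA as:R. X as)"
    proof (rule inj_onI, clarify)
      fix as x as' x' assume "\<phi> (as, x) = \<phi> (as', x')"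
      then have e: "x 0 = x' 0" "as = as'" "x(0 := v0 as x) = x'(0 := v0 as' x')" by (auto simp: \<phi>_def)
      have "x k = x' k" for k using e(1) fun_cong[OF e(3), of k] by (cases "k = 0") auto
      then show "as = as' \<and> x = x'" using e(2) by auto
    qed
    have fT: "finite (SIGMA as:?L (Suc t). Y as)" using fL(1) fY by (intro finite_SigmaI) auto
    have X1: "card (SIGMA as:R. X as) \<le> card (SIGMA as:?L (Suc t). Y as)"
      by (rule card_inj_on_le[OF inj sub fT])
    have X2: "card (SIGMA as:R. X as) = (\<Sum>as\<in>R. card (X as))"
    proof (intro card_SigmaI ballI)
      show "finite R" by (rule finite_subset[OF _ fL(1)[of t]]) (auto simp: R_def)
      show "finite (X as)" for as unfolding X_def using V by simp
    qed
    have "c' / 2 * ?n ^ t * (d * ?n ^ Suc p) \<le> real (card R) * (d * ?n ^ Suc p)"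
      using Rbig d n by (intro mult_right_mono) auto
    also have "\<dots> = (\<Sum>as\<in>R. d * ?n ^ Suc p)" by simp
    also have "\<dots> \<le> (\<Sum>as\<in>R. real (card (X as)))" by (intro sum_mono Xbig)
    also have "\<dots> = real (card (SIGMA as:R. X as))" unfolding X2 by simp
    also have "\<dots> \<le> real (card (SIGMA as:?L (Suc t). Y as))" using X1 by (simp only: of_nat_le_iff)
    finally have "c' / 2 * ?n ^ t * (d * ?n ^ Suc p) \<le> real (card (SIGMA as:?L (Suc t). Y as))" .
    moreover have "c' / 2 * d * ?n ^ (Suc t + p) = c' / 2 * ?n ^ t * (d * ?n ^ Suc p)" by (simp add: power_add)
    ultimately show "c' / 2 * d * ?n ^ (Suc t + p) \<le> real (card (SIGMA as:?L (Suc t). {y \<in> cube (Suc p) V. tower H \<chi> p z as y}))"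
      by (simp only: Y_def)
  qed
qed

section \<open>Many words\<close>

text \<open>From step \<open>j\<close> on the new spine agrees with the old one, as both end in
  \<open>z\<close>; before that it is a walk from \<open>a\<close> with old letters. So the new
  letter is reached from \<open>a\<close> in \<open>j\<close> steps, the last of them with letter
  \<open>\<sigma> j\<close>, and genericity makes it new.\<close>

lemma reflected_spine:
  assumes H: "linear3 H" and gen: "generic H p U a" and sp: "spine H \<chi> p z y \<sigma>"
    and yU: "\<forall>k\<in>{1..p}. y k \<in> U" and \<sigma>U: "\<forall>i\<le>p. \<sigma> i \<in> U" and j: "j \<in> {1..p}"
    and sp': "spine H \<chi> p z (y(0 := a, j := l)) \<sigma>'"
  shows "l \<in> expand H p U a" "l \<notin> U" "\<forall>i\<le>p. \<sigma>' i \<in> expand H p U a"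
proof -
  let ?y = "y(0 := a, j := l)"
  have e: "\<And>k. k < p \<Longrightarrow> {\<sigma> k, y (Suc k), \<sigma> (Suc k)} \<in> H" "\<And>k. k < p \<Longrightarrow> {\<sigma>' k, ?y (Suc k), \<sigma>' (Suc k)} \<in> H"
    and s0: "\<sigma>' 0 = a" and sp_eq: "\<sigma> p = \<sigma>' p"
    using sp sp' j by (auto simp: spine_def)
  have R: "\<sigma>' k \<in> reach H U a k" if "k < j" for k
    using that
  proof (induction k)
    case (Suc k)
    have "{\<sigma>' k, y (Suc k), \<sigma>' (Suc k)} \<in> H" using e(2)[of k] Suc.prems j by auto
    moreover have "y (Suc k) \<in> U" using yU Suc.prems j by auto
    ultimately show ?case using Suc by (intro reach_step) auto
  qed (simp add: s0)
  have S: "\<sigma> k = \<sigma>' k" if "j \<le> k" "k \<le> p" for k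
  proof (rule seq_backward[OF H, where j = j and k = p and l = "\<lambda>k. y (Suc k)"])
    fix i assume i: "j \<le> i" "i < p"
    show "{\<sigma> i, y (Suc i), \<sigma> (Suc i)} \<in> H" by (rule e(1)[OF i(2)])
    show "{\<sigma>' i, y (Suc i), \<sigma>' (Suc i)} \<in> H" using e(2)[OF i(2)] i(1) by simp
  qed (use that sp_eq in auto)
  obtain i where i: "j = Suc i" using j by (cases j) auto
  have "{\<sigma>' i, l, \<sigma>' (Suc i)} \<in> H" using e(2)[of i] j i by simp
  then have "{\<sigma>' i, \<sigma> j, l} \<in> H" using S[of j] j i by (simp add: insert_commute)
  then have lR: "l \<in> reach H U a j" unfolding i using R[of i] \<sigma>U j i by (intro reach_step) auto
  show "l \<notin> U" using gen lR j unfolding generic_def by auto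
  have sub: "reach H U a k \<subseteq> expand H p U a" if "k \<le> p" for k using that unfolding expand_def by blast
  show "l \<in> expand H p U a" using lR sub[of j] j by auto
  show "\<forall>i\<le>p. \<sigma>' i \<in> expand H p U a"
  proof (intro allI impI)
    fix k assume k: "k \<le> p"
    show "\<sigma>' k \<in> expand H p U a"
    proof (cases "k < j")
      case True
      then show ?thesis using R[OF True] sub[OF k] by blast
    next
      case False
      then have "\<sigma>' k \<in> U" using S[of k] k \<sigma>U by auto
      then show ?thesis by (simp add: expand_def)
    qed
  qed
qed

text \<open>\<open>J\<close> holds the positions still open to replacement. The last starting point
  \<open>a0\<close> is reserved for the final walk: it changes the letter at \<open>p\<close>, hence
  the words are compared on \<open>{1..<p}\<close> only. Words whose first replaced positions differ
  are different, since the first new letter lies in \<open>expand H p U a\<close> but not in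
  \<open>U\<close>, whereas later new letters lie outside \<open>expand H p U a\<close>.\<close>

lemma many_words:
  assumes H: "linear3 H" and p: "1 \<le> p"
  shows "tower H \<chi> p z (as @ [a0]) y \<Longrightarrow> generics H p U as \<Longrightarrow> spine H \<chi> p z y \<sigma> \<Longrightarrow>
    \<forall>k\<in>{1..p}. y k \<in> U \<Longrightarrow> \<forall>i\<le>p. \<sigma> i \<in> U \<Longrightarrow> J \<subseteq> {1..<p} \<Longrightarrow>
    \<exists>W. finite W \<and> (\<Prod>i<length as. card J - i) \<le> card W \<and> inj_on (\<lambda>y. restrict y {1..<p}) W \<and>
      (\<forall>y'\<in>W. (\<exists>l. path H \<chi> p z (y'(0 := a0, p := l))) \<and> (\<forall>k\<in>{1..p}. y' k \<in> expands H p U as) \<and>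
         (\<forall>k\<in>{1..p}. y' k = y k \<or> k \<in> J \<and> y' k \<notin> U))"
proof (induction as arbitrary: y U \<sigma> J)
  case Nil
  have "p \<in> {1..p}" using p by simp
  then have "\<exists>l. path H \<chi> p z (y(0 := a0, p := l))" using Nil(1) by auto
  moreover have "\<forall>k\<in>{1..p}. y k \<in> expands H p U []" using Nil(4) by simp
  ultimately show ?case by (intro exI[of _ "{y}"] conjI ballI) (simp_all del: fun_upd_apply)
next
  case (Cons a as)
  have fJ: "finite J" using Cons.prems(6) finite_subset by blast
  have gen: "generic H p U a" and gens: "generics H p (expand H p U a) as" using Cons.prems(2) by auto
  let ?U = "expand H p U a"
  have UU: "U \<subseteq> ?U" by (auto simp: expand_def)
  define Q where "Q j l W \<longleftrightarrow> finite W \<and> (\<Prod>i<length as. card (J - {j}) - i) \<le> card W \<and>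
      inj_on (\<lambda>y. restrict y {1..<p}) W \<and>
      (\<forall>y'\<in>W. (\<exists>l. path H \<chi> p z (y'(0 := a0, p := l))) \<and> (\<forall>k\<in>{1..p}. y' k \<in> expands H p ?U as) \<and>
         (\<forall>k\<in>{1..p}. y' k = (y(0 := a, j := l)) k \<or> k \<in> J - {j} \<and> y' k \<notin> ?U))" for j l W
  have "\<forall>j\<in>J. \<exists>l W. l \<in> ?U \<and> l \<notin> U \<and> Q j l W"
  proof
    fix j assume jJ: "j \<in> J"
    then have j: "j \<in> {1..p}" using Cons.prems(6) by auto
    then obtain l where tw: "tower H \<chi> p z (as @ [a0]) (y(0 := a, j := l))"
      using Cons.prems(1) unfolding append_Cons tower.simps by blast
    obtain \<sigma>' where sp': "spine H \<chi> p z (y(0 := a, j := l)) \<sigma>'" using tower_path[OF tw] unfolding path_def by blast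
    note rs = reflected_spine[OF H gen Cons.prems(3,4,5) j sp']
    have yU: "\<forall>k\<in>{1..p}. (y(0 := a, j := l)) k \<in> ?U" using Cons.prems(4) UU rs(1) by auto
    have "J - {j} \<subseteq> {1..<p}" using Cons.prems(6) by auto
    from Cons.IH[OF tw gens sp' yU rs(3) this] have "\<exists>W. Q j l W" unfolding Q_def .
    then show "\<exists>l W. l \<in> ?U \<and> l \<notin> U \<and> Q j l W" using rs(1,2) by blast
  qed
  then obtain L W where L: "\<And>j. j \<in> J \<Longrightarrow> L j \<in> ?U \<and> L j \<notin> U" and Q: "\<And>j. j \<in> J \<Longrightarrow> Q j (L j) (W j)"
    by metis
  have W: "finite (W j)" "(\<Prod>i<length as. card (J - {j}) - i) \<le> card (W j)"
      "inj_on (\<lambda>y. restrict y {1..<p}) (W j)" if "j \<in> J" for j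
    using Q[OF that] unfolding Q_def by auto
  have Wp: "\<exists>l. path H \<chi> p z (y'(0 := a0, p := l))" "\<And>k. k \<in> {1..p} \<Longrightarrow> y' k \<in> expands H p ?U as"
      "\<And>k. k \<in> {1..p} \<Longrightarrow> y' k = (y(0 := a, j := L j)) k \<or> k \<in> J - {j} \<and> y' k \<notin> ?U"
    if "j \<in> J" "y' \<in> W j" for j y'
    using Q[OF that(1)] that(2) unfolding Q_def by blast+
  have Wj: "y' j = L j" if "j \<in> J" "y' \<in> W j" for j y'
    using Wp(3)[OF that, of j] that Cons.prems(6) by auto
  have Wk: "y' k \<noteq> L k" if jk: "j \<in> J" "k \<in> J" "j \<noteq> k" and y': "y' \<in> W j" for j k y'
  proof -
    have k: "k \<in> {1..p}" using jk(2) Cons.prems(6) by auto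
    have "y' k = y k \<or> y' k \<notin> ?U" using Wp(3)[OF jk(1) y' k] jk(3) k by auto
    then show ?thesis using L[OF jk(2)] Cons.prems(4)[rule_format, OF k] by auto
  qed
  have inj: "inj_on (\<lambda>y. restrict y {1..<p}) (\<Union>j\<in>J. W j)"
  proof (rule inj_onI)
    fix y1 y2 assume "y1 \<in> (\<Union>j\<in>J. W j)" "y2 \<in> (\<Union>j\<in>J. W j)" and eq: "restrict y1 {1..<p} = restrict y2 {1..<p}"
    then obtain j1 j2 where j: "j1 \<in> J" "y1 \<in> W j1" "j2 \<in> J" "y2 \<in> W j2" by blast
    have "j1 = j2"
    proof (rule ccontr)
      assume "j1 \<noteq> j2"
      then have "y2 j1 \<noteq> L j1" using Wk[OF j(3,1)] j(4) by auto
      moreover have "y1 j1 = y2 j1" using fun_cong[OF eq, of j1] j(1) Cons.prems(6) by auto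
      ultimately show False using Wj[OF j(1,2)] by simp
    qed
    then show "y1 = y2" using W(3)[OF j(1)] j eq unfolding inj_on_def by blast
  qed
  have "(\<Prod>i<length (a # as). card J - i) = card J * (\<Prod>i<length as. card J - Suc i)"
    by (simp only: length_Cons prod.lessThan_Suc_shift) simp
  also have "\<dots> = (\<Sum>j\<in>J. \<Prod>i<length as. card (J - {j}) - i)"
    using fJ by (simp add: card_Diff_singleton)
  also have "\<dots> \<le> (\<Sum>j\<in>J. card (W j))" by (intro sum_mono W(2))
  also have "\<dots> = card (\<Union>j\<in>J. W j)"
  proof (rule card_UN_disjoint[symmetric, OF fJ])
    show "\<forall>j\<in>J. finite (W j)" using W(1) by blast
    show "\<forall>j\<in>J. \<forall>k\<in>J. j \<noteq> k \<longrightarrow> W j \<inter> W k = {}" using Wj Wk by blast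
  qed
  finally have "(\<Prod>i<length (a # as). card J - i) \<le> card (\<Union>j\<in>J. W j)" .
  moreover have "finite (\<Union>j\<in>J. W j)" using fJ W(1) by blast
  moreover have "(\<exists>l. path H \<chi> p z (y'(0 := a0, p := l))) \<and> (\<forall>k\<in>{1..p}. y' k \<in> expands H p U (a # as)) \<and>
         (\<forall>k\<in>{1..p}. y' k = y k \<or> k \<in> J \<and> y' k \<notin> U)" if y': "y' \<in> (\<Union>j\<in>J. W j)" for y'
  proof -
    obtain j where j: "j \<in> J" "y' \<in> W j" using y' by blast
    have "y' k = y k \<or> k \<in> J \<and> y' k \<notin> U" if k: "k \<in> {1..p}" for k
    proof (cases "k = j")
      case True
      then show ?thesis using Wj[OF j] L[OF j(1)] j(1) by simp
    next
      case False
      then show ?thesis using Wp(3)[OF j k] k UU by auto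
    qed
    then show ?thesis using Wp(1,2)[OF j] by simp
  qed
  ultimately show ?case using inj by (intro exI[of _ "\<Union>j\<in>J. W j"]) blast
qed

section \<open>Counting walks in layers\<close>

lemma factor_through_image:
  assumes "\<And>y y'. y \<in> W \<Longrightarrow> y' \<in> W \<Longrightarrow> f y = f y' \<Longrightarrow> g y = g y'"
  shows "\<exists>h. \<forall>y\<in>W. g y = h (f y)"
proof (intro exI ballI)
  fix y assume y: "y \<in> W"
  let ?y = "SOME y'. y' \<in> W \<and> f y' = f y"
  have "?y \<in> W \<and> f ?y = f y" by (rule someI[of "\<lambda>y'. y' \<in> W \<and> f y' = f y" y]) (simp add: y)
  then show "g y = (\<lambda>v. g (SOME y'. y' \<in> W \<and> f y' = v)) (f y)" using assms[OF y, of ?y] by metis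
qed

text \<open>The exponent is the cyclomatic number of the graph formed by the walks: an excess of incoming edges
  is the only way for two words to end at the same vertex.\<close>

lemma layered_count:
  fixes s :: "'w \<Rightarrow> nat \<Rightarrow> 'v" and l :: "'w \<Rightarrow> nat \<Rightarrow> 'l" and ph :: "nat \<Rightarrow> 'w \<Rightarrow> 'f"
  assumes W: "finite W"
    and ph: "\<And>i y y'. i < q \<Longrightarrow> y \<in> W \<Longrightarrow> y' \<in> W \<Longrightarrow> ph i y = ph i y' \<Longrightarrow>
        s y i = s y' i \<and> l y (Suc i) = l y' (Suc i) \<and> s y (Suc i) = s y' (Suc i)"
  shows "i \<le> q \<Longrightarrow> card ((\<lambda>y. restrict (l y) {1..i}) ` {y\<in>W. s y i = v})
      \<le> 2 ^ (\<Sum>k<i. card (ph k ` W) - card ((\<lambda>y. s y (Suc k)) ` W))"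
proof (induction i arbitrary: v)
  case 0
  have "(\<lambda>y. restrict (l y) {1..0::nat}) ` {y\<in>W. s y 0 = v} \<subseteq> {\<lambda>_. undefined}" by auto
  from card_mono[OF _ this] show ?case by (simp add: restrict_def)
next
  case (Suc i)
  then have iq: "i < q" by simp
  let ?C = "\<Sum>k<i. card (ph k ` W) - card ((\<lambda>y. s y (Suc k)) ` W)"
  let ?c = "card (ph i ` W) - card ((\<lambda>y. s y (Suc i)) ` W)"
  let ?r = "\<lambda>y. restrict (l y) {1..Suc i}"
  define E where "E u = ph i ` {y\<in>W. s y (Suc i) = u}" for u
  have fE: "finite (E u)" for u using W by (simp add: E_def)
  have part: "card (?r ` {y\<in>W. ph i y = f}) \<le> 2 ^ ?C" if fEv: "f \<in> E v" for f
  proof -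
    obtain y0 where y0: "y0 \<in> W" "f = ph i y0" using fEv by (auto simp: E_def)
    let ?R = "(\<lambda>y. restrict (l y) {1..i}) ` {y\<in>W. s y i = s y0 i}"
    have "?r ` {y\<in>W. ph i y = f} \<subseteq> (\<lambda>g. g(Suc i := l y0 (Suc i))) ` ?R"
    proof
      fix g assume "g \<in> ?r ` {y\<in>W. ph i y = f}"
      then obtain y where y: "y \<in> W" "ph i y = ph i y0" and g: "g = ?r y" using y0 by auto
      have e: "s y i = s y0 i" "l y (Suc i) = l y0 (Suc i)" using ph[OF iq y(1) y0(1) y(2)] by auto
      have geq: "g = (restrict (l y) {1..i})(Suc i := l y0 (Suc i))"
        unfolding g using e(2) by (auto simp: restrict_def fun_eq_iff)
      have "restrict (l y) {1..i} \<in> ?R" using y(1) e(1) by blast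
      then show "g \<in> (\<lambda>g. g(Suc i := l y0 (Suc i))) ` ?R" unfolding geq by (rule imageI)
    qed
    moreover have "finite ?R" using W by simp
    ultimately have "card (?r ` {y\<in>W. ph i y = f}) \<le> card ?R"
      by (meson card_image_le card_mono finite_imageI le_trans)
    also have "\<dots> \<le> 2 ^ ?C" by (rule Suc.IH) (use iq in simp)
    finally show ?thesis .
  qed
  have "?r ` {y\<in>W. s y (Suc i) = v} \<subseteq> (\<Union>f\<in>E v. ?r ` {y\<in>W. ph i y = f})" by (auto simp: E_def)
  then have "card (?r ` {y\<in>W. s y (Suc i) = v}) \<le> card (\<Union>f\<in>E v. ?r ` {y\<in>W. ph i y = f})"
    using W fE by (intro card_mono) auto
  also have "\<dots> \<le> (\<Sum>f\<in>E v. card (?r ` {y\<in>W. ph i y = f}))" by (rule card_UN_le[OF fE])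
  also have "\<dots> \<le> (\<Sum>f\<in>E v. 2 ^ ?C)" by (intro sum_mono part)
  also have "\<dots> = card (E v) * 2 ^ ?C" by simp
  also have "\<dots> \<le> 2 ^ ?c * 2 ^ ?C"
  proof (rule mult_right_mono)
    \<comment> \<open>Every other vertex of the layer has at least one incoming edge, so those into
      \<open>v\<close> number at most the excess plus one.\<close>
    show "card (E v) \<le> 2 ^ ?c"
    proof (cases "E v = {}")
      case False
      let ?S = "(\<lambda>y. s y (Suc i)) ` W"
      have v: "v \<in> ?S" using False by (auto simp: E_def)
      have fS: "finite ?S" using W by simp
      have "ph i ` W = (\<Union>u\<in>?S. E u)" by (auto simp: E_def)
      then have "card (ph i ` W) = (\<Sum>u\<in>?S. card (E u))"
      proof (simp only:, intro card_UN_disjoint[OF fS] ballI impI)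
        fix u u' :: 'v assume "u \<noteq> u'"
        show "E u \<inter> E u' = {}"
        proof (rule ccontr)
          assume "E u \<inter> E u' \<noteq> {}"
          then obtain y y' where "y \<in> W" "y' \<in> W" "ph i y = ph i y'" "s y (Suc i) = u" "s y' (Suc i) = u'"
            by (auto simp: E_def)
          then show False using ph[OF iq] \<open>u \<noteq> u'\<close> by blast
        qed
      qed (rule fE)
      also have "\<dots> = card (E v) + (\<Sum>u\<in>?S - {v}. card (E u))" using fS v by (rule sum.remove)
      also have "\<dots> \<ge> card (E v) + (\<Sum>u\<in>?S - {v}. 1)"
      proof (intro add_left_mono sum_mono)
        fix u assume "u \<in> ?S - {v}"
        then have "E u \<noteq> {}" by (auto simp: E_def)
        then show "1 \<le> card (E u)" using fE[of u] by (simp add: Suc_le_eq card_gt_0_iff)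
      qed
      finally have "card (E v) + (card ?S - 1) \<le> card (ph i ` W)" using fS v by simp
      moreover have "card ?S \<ge> 1" using fS v by (auto simp: Suc_le_eq card_gt_0_iff)
      ultimately have "card (E v) \<le> ?c + 1" by linarith
      also have "\<dots> \<le> 2 ^ ?c" by (simp add: Suc_leI)
      finally show ?thesis .
    qed simp
  qed simp
  also have "\<dots> = 2 ^ (\<Sum>k<Suc i. card (ph k ` W) - card ((\<lambda>y. s y (Suc k)) ` W))"
    by (simp add: power_add mult.commute)
  finally show ?case .
qed

text \<open>All words are walked from one generic point \<open>a\<close>, and vertices and edges are
  counted layer by layer. If vertices outnumber edges, the excess of edges over vertices within the
  layers is at most \<open>\<zeta>\<close>, and \<open>layered_count\<close> allows at most
  \<open>2 ^ \<zeta>\<close> words per endpoint.\<close>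

lemma last_level:
  assumes H: "linear3 H" and b: "built H \<zeta> U G" and gen: "generic H p U a" and p: "2 \<le> p"
    and W: "finite W" "W \<noteq> {}" and inj: "inj_on (\<lambda>y. restrict y {1..<p}) W"
    and letters: "\<And>y k. y \<in> W \<Longrightarrow> k \<in> {1..p} \<Longrightarrow> y k \<in> U"
    and paths: "\<And>y. y \<in> W \<Longrightarrow> \<exists>l. path H \<chi> p z (y(0 := a, p := l))"
  shows "\<exists>U' G'. built H (Suc \<zeta>) U' G' \<and> G' \<noteq> {} \<and> (card U' \<le> card G' \<or> card W \<le> card G' * 2 ^ \<zeta>)"
proof -
  have H3: "\<forall>f\<in>H. card f = 3" using H by (simp add: linear3_def)
  have bp: "finite U" "finite G" "\<Union>G \<subseteq> U" "card U \<le> \<zeta> + card G" using built_props[OF b H3] by auto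
  \<comment> \<open>The last letter varies with the word and need not lie in \<open>U\<close>, so
    the walks stop one step before the end.\<close>
  define q where "q = p - 1"
  have q: "1 \<le> q" "Suc q = p" using p by (auto simp: q_def)
  have "\<exists>s. \<forall>y\<in>W. s y 0 = a \<and> (\<forall>i<q. {s y i, y (Suc i), s y (Suc i)} \<in> H) \<and> (\<forall>i\<le>q. \<chi> (s y i) = i)"
  proof (rule bchoice, rule ballI)
    fix y assume "y \<in> W"
    then obtain l \<sigma> where sp: "spine H \<chi> p z (y(0 := a, p := l)) \<sigma>" using paths unfolding path_def by blast
    have "{\<sigma> i, y (Suc i), \<sigma> (Suc i)} \<in> H" if "i < q" for i
    proof -
      have "{\<sigma> i, (y(0 := a, p := l)) (Suc i), \<sigma> (Suc i)} \<in> H"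
        using sp that q(2) unfolding spine_def by (meson less_SucI)
      then show ?thesis using that q by simp
    qed
    moreover have "\<sigma> 0 = a" using sp p by (simp add: spine_def)
    moreover have "\<forall>i\<le>q. \<chi> (\<sigma> i) = i" using sp q by (auto simp: spine_def)
    ultimately show "\<exists>\<sigma>. \<sigma> 0 = a \<and> (\<forall>i<q. {\<sigma> i, y (Suc i), \<sigma> (Suc i)} \<in> H) \<and> (\<forall>i\<le>q. \<chi> (\<sigma> i) = i)" by blast
  qed
  then obtain s where s0: "\<And>y. y \<in> W \<Longrightarrow> s y 0 = a"
    and sH: "\<And>y i. y \<in> W \<Longrightarrow> i < q \<Longrightarrow> {s y i, y (Suc i), s y (Suc i)} \<in> H"
    and s\<chi>: "\<And>y i. y \<in> W \<Longrightarrow> i \<le> q \<Longrightarrow> \<chi> (s y i) = i" by blast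
  have letU: "y (Suc i) \<in> U" if "y \<in> W" "i < q" for y i using letters[OF that(1), of "Suc i"] that(2) q by auto
  have sR: "s y i \<in> reach H U a i" if "y \<in> W" "i \<le> q" for y i
    using that(2)
  proof (induction i)
    case 0
    then show ?case using s0 that(1) by simp
  next
    case (Suc i)
    then show ?case using sH[OF that(1), of i] letU[OF that(1), of i] by (intro reach_step) auto
  qed
  have sU: "s y i \<notin> U" if "y \<in> W" "i \<le> q" for y i
  proof -
    have "reach H U a i \<inter> U = {}" using gen that(2) q unfolding generic_def by auto
    then show ?thesis using sR[OF that] by blast
  qed
  define ph where "ph i y = {s y i, y (Suc i), s y (Suc i)}" for i y
  define Sg where "Sg i = (\<lambda>y. s y i) ` W" for i
  define Ph where "Ph i = ph i ` W" for i
  have phU: "ph i y - U = {s y i, s y (Suc i)}" "ph i y \<inter> U = {y (Suc i)}" if "y \<in> W" "i < q" for i y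
    using sU[OF that(1), of i] sU[OF that(1), of "Suc i"] letU[OF that] that(2) by (auto simp: ph_def)
  \<comment> \<open>An edge has its letter in \<open>U\<close> and its two spine vertices outside
    \<open>U\<close>; the colours tell the layer and which of the two comes first.\<close>
  have det: "i = j \<and> s y i = s y' j \<and> y (Suc i) = y' (Suc j) \<and> s y (Suc i) = s y' (Suc j)"
    if y: "y \<in> W" "y' \<in> W" "i < q" "j < q" and eq: "ph i y = ph j y'" for i j y y'
  proof -
    have e1: "{s y i, s y (Suc i)} = {s y' j, s y' (Suc j)}" using phU(1)[OF y(1,3)] phU(1)[OF y(2,4)] eq by simp
    have "{y (Suc i)} = {y' (Suc j)}" using phU(2)[OF y(1,3)] phU(2)[OF y(2,4)] eq by simp
    then have e2: "y (Suc i) = y' (Suc j)" by simp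
    have c: "\<chi> (s y i) = i" "\<chi> (s y (Suc i)) = Suc i" "\<chi> (s y' j) = j" "\<chi> (s y' (Suc j)) = Suc j"
      using s\<chi> y by auto
    have "{i, Suc i} = {j, Suc j}" using arg_cong[OF e1, of "image \<chi>"] c by simp
    then have ij: "i = j" by (auto simp: doubleton_eq_iff)
    have "s y i = s y' j" "s y (Suc i) = s y' (Suc j)" using e1 c ij by (auto simp: doubleton_eq_iff)
    then show ?thesis using e2 ij by blast
  qed
  have fSg: "finite (Sg i)" and fPh: "finite (Ph i)" for i using W(1) by (simp_all add: Sg_def Ph_def)
  have bk: "k \<le> q \<Longrightarrow> built H (Suc \<zeta>) (U \<union> (\<Union>i\<le>k. Sg i)) (G \<union> (\<Union>i<k. Ph i))" for k
  proof (induction k)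
    case 0
    have "Sg 0 = {a}" using s0 W(2) by (auto simp: Sg_def)
    then show ?case using built_vertex[OF b, of a] by simp
  next
    case (Suc k)
    let ?U = "U \<union> (\<Union>i\<le>k. Sg i)"
    have "built H (Suc \<zeta>) (?U \<union> \<Union>(Ph k)) (G \<union> (\<Union>i<k. Ph i) \<union> Ph k)"
    proof (rule built_edges[OF fPh _ _ _ H3])
      show "built H (Suc \<zeta>) ?U (G \<union> (\<Union>i<k. Ph i))" using Suc by simp
      show "Ph k \<subseteq> H" using sH Suc.prems by (auto simp: Ph_def ph_def)
      show "\<forall>f\<in>Ph k. 2 \<le> card (f \<inter> ?U)"
      proof
        fix f assume "f \<in> Ph k"
        then obtain y where y: "y \<in> W" "f = ph k y" by (auto simp: Ph_def)
        have "s y k \<noteq> y (Suc k)" using linear3_distinct[OF H sH[OF y(1), of k]] Suc.prems by auto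
        then have "2 = card {s y k, y (Suc k)}" by simp
        also have "\<dots> \<le> card (f \<inter> ?U)"
        proof (rule card_mono)
          show "finite (f \<inter> ?U)" unfolding y(2) ph_def by simp
          have "s y k \<in> ?U" using y(1) by (auto simp: Sg_def)
          moreover have "y (Suc k) \<in> ?U" using letU[OF y(1), of k] Suc.prems by auto
          ultimately show "{s y k, y (Suc k)} \<subseteq> f \<inter> ?U" unfolding y(2) ph_def by auto
        qed
        finally show "2 \<le> card (f \<inter> ?U)" .
      qed
    qed
    moreover have "?U \<union> \<Union>(Ph k) = U \<union> (\<Union>i\<le>Suc k. Sg i)"
    proof (intro equalityI subsetI)
      fix v assume "v \<in> ?U \<union> \<Union>(Ph k)"
      then show "v \<in> U \<union> (\<Union>i\<le>Suc k. Sg i)"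
      proof
        assume "v \<in> \<Union>(Ph k)"
        then obtain y where y: "y \<in> W" "v \<in> {s y k, y (Suc k), s y (Suc k)}" by (auto simp: Ph_def ph_def)
        then show ?thesis using letU[OF y(1), of k] Suc.prems by (auto simp: Sg_def atMost_Suc)
      qed (auto simp: atMost_Suc)
    next
      fix v assume "v \<in> U \<union> (\<Union>i\<le>Suc k. Sg i)"
      then consider "v \<in> ?U" | "v \<in> Sg (Suc k)" by (auto simp: atMost_Suc)
      then show "v \<in> ?U \<union> \<Union>(Ph k)" by cases (auto simp: Sg_def Ph_def ph_def)
    qed
    moreover have "G \<union> (\<Union>i<k. Ph i) \<union> Ph k = G \<union> (\<Union>i<Suc k. Ph i)" by (auto simp: lessThan_Suc)
    ultimately show ?case by metis
  qed
  define U' where "U' = U \<union> (\<Union>i\<le>q. Sg i)"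
  define G' where "G' = G \<union> (\<Union>i<q. Ph i)"
  have bU': "built H (Suc \<zeta>) U' G'" unfolding U'_def G'_def by (rule bk) simp
  have cU: "card U' = card U + (\<Sum>i\<le>q. card (Sg i))"
  proof -
    have "card U' = card U + card (\<Union>i\<le>q. Sg i)"
      unfolding U'_def using bp(1) fSg sU by (intro card_Un_disjoint) (auto simp: Sg_def)
    also have "card (\<Union>i\<le>q. Sg i) = (\<Sum>i\<le>q. card (Sg i))"
    proof (intro card_UN_disjoint ballI impI)
      fix i j assume ij: "i \<in> {..q}" "j \<in> {..q}" "i \<noteq> j"
      show "Sg i \<inter> Sg j = {}"
      proof (rule ccontr)
        assume "Sg i \<inter> Sg j \<noteq> {}"
        then obtain y y' where "y \<in> W" "y' \<in> W" "s y i = s y' j" by (auto simp: Sg_def)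
        then show False using s\<chi>[of y i] s\<chi>[of y' j] ij by auto
      qed
    qed (simp_all add: fSg)
    finally show ?thesis .
  qed
  have cG: "card G' = card G + (\<Sum>i<q. card (Ph i))"
  proof -
    have "f \<notin> G" if "f \<in> Ph i" "i < q" for f i
    proof
      assume "f \<in> G"
      obtain y where y: "y \<in> W" "f = ph i y" using \<open>f \<in> Ph i\<close> by (auto simp: Ph_def)
      have "f \<subseteq> U" using \<open>f \<in> G\<close> bp(3) by blast
      then show False using phU(1)[OF y(1) \<open>i < q\<close>] y(2) by blast
    qed
    then have "card G' = card G + card (\<Union>i<q. Ph i)"
      unfolding G'_def using bp(2) fPh by (intro card_Un_disjoint) auto
    also have "card (\<Union>i<q. Ph i) = (\<Sum>i<q. card (Ph i))"
    proof (intro card_UN_disjoint ballI impI)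
      fix i j assume ij: "i \<in> {..<q}" "j \<in> {..<q}" "i \<noteq> j"
      show "Ph i \<inter> Ph j = {}"
      proof (rule ccontr)
        assume "Ph i \<inter> Ph j \<noteq> {}"
        then obtain y y' where "y \<in> W" "y' \<in> W" "ph i y = ph j y'" by (auto simp: Ph_def)
        then show False using det[of y y' i j] ij by auto
      qed
    qed (simp_all add: fPh)
    finally show ?thesis .
  qed
  have SP: "card (Sg (Suc i)) \<le> card (Ph i)" if "i < q" for i
  proof -
    have "\<exists>h. \<forall>y\<in>W. s y (Suc i) = h (ph i y)"
    proof (rule factor_through_image)
      fix y y' assume "y \<in> W" "y' \<in> W" "ph i y = ph i y'"
      then show "s y (Suc i) = s y' (Suc i)" using det[of y y' i i] that by blast
    qed
    then obtain h where h: "\<forall>y\<in>W. s y (Suc i) = h (ph i y)" by blast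
    have "Sg (Suc i) = h ` Ph i" using h by (auto simp: Sg_def Ph_def image_image intro!: image_cong)
    then show ?thesis using fPh[of i] by (simp add: card_image_le)
  qed
  have q1: "q - 1 < q" "Suc (q - 1) = q" using q(1) by auto
  have "Ph (q - 1) \<subseteq> G'" using q1(1) by (auto simp: G'_def)
  moreover have fG': "finite G'" using bp(2) fPh by (simp add: G'_def)
  ultimately have SqG: "card (Sg q) \<le> card G'"
    using SP[OF q1(1)] card_mono[of G' "Ph (q - 1)"] q1(2) by simp
  have ne: "G' \<noteq> {}"
  proof -
    have "Ph 0 \<noteq> {}" using W(2) by (simp add: Ph_def)
    then show ?thesis using q(1) by (auto simp: G'_def)
  qed
  have "card U' \<le> card G' \<or> card W \<le> card G' * 2 ^ \<zeta>"
  proof (cases "card U' \<le> card G'")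
    case False
    have "(\<Sum>i\<le>q. card (Sg i)) = card (Sg 0) + (\<Sum>i<q. card (Sg (Suc i)))"
      by (rule sum.atMost_shift)
    moreover have "card (Sg 0) = 1"
    proof -
      have "Sg 0 = {a}" using s0 W(2) by (auto simp: Sg_def)
      then show ?thesis by simp
    qed
    ultimately have cU': "card U' = card U + 1 + (\<Sum>i<q. card (Sg (Suc i)))" using cU by simp
    have "(\<Sum>k<q. card (Ph k) - card (Sg (Suc k))) + (\<Sum>k<q. card (Sg (Suc k))) = (\<Sum>k<q. card (Ph k))"
      unfolding sum.distrib[symmetric] using SP by (intro sum.cong) auto
    \<comment> \<open>The strict inequality absorbs the extra vertex \<open>a\<close>.\<close>
    then have cyc: "(\<Sum>k<q. card (Ph k) - card (Sg (Suc k))) \<le> \<zeta>" using False cU' cG bp(4) by linarith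
    let ?r = "\<lambda>y. restrict y {1..q}"
    have ip: "{1..q} = {1..<p}" using q(2) by auto
    have "card W = card (?r ` W)" using inj unfolding ip by (rule card_image[symmetric])
    also have "?r ` W = (\<Union>v\<in>Sg q. ?r ` {y\<in>W. s y q = v})" by (auto simp: Sg_def)
    also have "card \<dots> \<le> (\<Sum>v\<in>Sg q. card (?r ` {y\<in>W. s y q = v}))" by (rule card_UN_le[OF fSg])
    also have "\<dots> \<le> (\<Sum>v\<in>Sg q. 2 ^ (\<Sum>k<q. card (Ph k) - card (Sg (Suc k))))"
      unfolding Ph_def Sg_def
      by (intro sum_mono layered_count[where l = "\<lambda>y. y" and q = q] W(1) order_refl) (use det in blast)
    also have "\<dots> \<le> (\<Sum>v\<in>Sg q. 2 ^ \<zeta>)" using cyc by (intro sum_mono power_increasing) auto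
    also have "\<dots> = card (Sg q) * 2 ^ \<zeta>" by simp
    also have "\<dots> \<le> card G' * 2 ^ \<zeta>" using SqG by (intro mult_right_mono) auto
    finally show ?thesis by blast
  qed simp
  then show ?thesis using bU' ne by blast
qed

section \<open>A supply of walks\<close>

lemma linear3_eq:
  assumes "linear3 H" "f \<in> H" "f' \<in> H" "u \<noteq> v" "u \<in> f" "v \<in> f" "u \<in> f'" "v \<in> f'"
  shows "f = f'"
proof (rule ccontr)
  assume "f \<noteq> f'"
  then have "card (f \<inter> f') \<le> 1" by (rule assms(1)[unfolded linear3_def, THEN conjunct2, rule_format, OF assms(2,3)])
  moreover have "finite f" using assms(1,2) by (intro card_ge_0_finite) (auto simp: linear3_def)
  then have "card {u, v} \<le> card (f \<inter> f')" using assms by (intro card_mono) auto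
  ultimately show False using assms(4) by simp
qed

text \<open>\<open>U\<close> maximises the number of edges inside it minus \<open>\<delta>\<close>
  times its size; deleting a vertex of smaller degree would increase this quantity.\<close>

lemma min_degree_subset:
  fixes \<delta> :: real
  assumes V: "finite V" and H: "H \<subseteq> Pow V" "{} \<notin> H" and big: "\<delta> * real (card V) < real (card H)"
  shows "\<exists>U\<subseteq>V. U \<noteq> {} \<and> (\<forall>v\<in>U. \<delta> \<le> real (card {f\<in>H. f \<subseteq> U \<and> v \<in> f}))"
proof -
  define \<phi> where "\<phi> U = real (card {f\<in>H. f \<subseteq> U}) - \<delta> * real (card U)" for U
  have fH: "finite H" using H V by (meson finite_Pow_iff finite_subset)
  obtain U where U: "U \<in> Pow V" and mx: "\<And>U'. U' \<in> Pow V \<Longrightarrow> \<phi> U' \<le> \<phi> U"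
  proof -
    have "Max (\<phi> ` Pow V) \<in> \<phi> ` Pow V" using V by (intro Max_in) auto
    then obtain U where U: "U \<in> Pow V" "Max (\<phi> ` Pow V) = \<phi> U" by blast
    have "\<phi> U' \<le> \<phi> U" if "U' \<in> Pow V" for U'
      unfolding U(2)[symmetric] using V that by (intro Max_ge) auto
    then show thesis using that U(1) by blast
  qed
  have "{f\<in>H. f \<subseteq> V} = H" using H by blast
  then have "0 < \<phi> V" using big by (simp add: \<phi>_def)
  then have pos: "0 < \<phi> U" using mx[of V] by simp
  have fU: "finite U" using U V finite_subset by blast
  have "U \<noteq> {}"
  proof
    assume "U = {}"
    then have e: "{f\<in>H. f \<subseteq> U} = {}" using H(2) by auto
    have "\<phi> U = 0" unfolding \<phi>_def e using \<open>U = {}\<close> by simp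
    then show False using pos by simp
  qed
  moreover have "\<delta> \<le> real (card {f\<in>H. f \<subseteq> U \<and> v \<in> f})" if v: "v \<in> U" for v
  proof -
    have "{f\<in>H. f \<subseteq> U} = {f\<in>H. f \<subseteq> U - {v}} \<union> {f\<in>H. f \<subseteq> U \<and> v \<in> f}" by blast
    then have "card {f\<in>H. f \<subseteq> U} = card {f\<in>H. f \<subseteq> U - {v}} + card {f\<in>H. f \<subseteq> U \<and> v \<in> f}"
      using fH by (simp only:) (intro card_Un_disjoint, auto)
    moreover have "\<phi> (U - {v}) \<le> \<phi> U" using U by (intro mx) auto
    moreover have "card U = Suc (card (U - {v}))" using fU v by (metis card.remove)
    ultimately show ?thesis by (simp add: \<phi>_def algebra_simps)
  qed
  ultimately show ?thesis using U by blast
qed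

text \<open>Injectivity of the spine ensures that some colouring gives its vertices the colours
  \<open>0, ..., k\<close> in order.\<close>

definition walks :: "'a set set \<Rightarrow> 'a set \<Rightarrow> 'a set \<Rightarrow> nat \<Rightarrow> (nat \<Rightarrow> 'a) set" where
  "walks H V U k = {y \<in> cube (Suc k) V. \<exists>\<sigma>. \<sigma> 0 = y 0 \<and> (\<forall>i<k. {\<sigma> i, y (Suc i), \<sigma> (Suc i)} \<in> H) \<and>
     inj_on \<sigma> {..k} \<and> \<sigma> ` {..k} \<subseteq> U}"

text \<open>By linearity each earlier spine vertex spoils at most one edge at
  \<open>\<sigma> k\<close>, and each remaining edge supplies a letter of its own.\<close>

lemma many_continuations:
  assumes H: "linear3 H" and inj: "inj_on \<sigma> {..k}" and \<sigma>: "\<sigma> ` {..k} \<subseteq> U" and U: "finite U"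
    and deg: "d \<le> card {f\<in>H. f \<subseteq> U \<and> \<sigma> k \<in> f}"
  shows "d - k \<le> card {l \<in> U. \<exists>s\<in>U. {\<sigma> k, l, s} \<in> H \<and> s \<notin> \<sigma> ` {..k}}"
proof -
  define A where "A = {f\<in>H. f \<subseteq> U \<and> \<sigma> k \<in> f}"
  define A' where "A' = {f\<in>A. f \<inter> \<sigma> ` {..<k} = {}}"
  have "A \<subseteq> Pow U" by (auto simp: A_def)
  then have fA: "finite A" using U by (meson finite_Pow_iff finite_subset)
  have AA': "A' \<subseteq> A" by (auto simp: A'_def)
  have "card (A - A') \<le> card {..<k}"
  proof (rule card_inj_on_le[where f = "\<lambda>f. SOME i. i < k \<and> \<sigma> i \<in> f"])
    have some: "(SOME i. i < k \<and> \<sigma> i \<in> f) < k \<and> \<sigma> (SOME i. i < k \<and> \<sigma> i \<in> f) \<in> f" if "f \<in> A - A'" for f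
      by (rule someI_ex) (use that in \<open>auto simp: A'_def\<close>)
    then show "(\<lambda>f. SOME i. i < k \<and> \<sigma> i \<in> f) ` (A - A') \<subseteq> {..<k}" by blast
    show "inj_on (\<lambda>f. SOME i. i < k \<and> \<sigma> i \<in> f) (A - A')"
    proof (rule inj_onI)
      fix f f' assume f: "f \<in> A - A'" "f' \<in> A - A'" and eq: "(SOME i. i < k \<and> \<sigma> i \<in> f) = (SOME i. i < k \<and> \<sigma> i \<in> f')"
      define i where "i = (SOME i. i < k \<and> \<sigma> i \<in> f)"
      have i: "i < k" "\<sigma> i \<in> f" "\<sigma> i \<in> f'" using some[OF f(1)] some[OF f(2)] eq by (auto simp: i_def)
      then have "\<sigma> i \<noteq> \<sigma> k" using inj by (auto simp: inj_on_def)
      then show "f = f'" using f i by (intro linear3_eq[OF H, of f f' "\<sigma> i" "\<sigma> k"]) (auto simp: A_def)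
    qed
  qed simp
  then have A'k: "card A - k \<le> card A'" using card_Diff_subset[OF finite_subset[OF AA' fA] AA'] by simp
  let ?L = "{l \<in> U. \<exists>s\<in>U. {\<sigma> k, l, s} \<in> H \<and> s \<notin> \<sigma> ` {..k}}"
  have trip: "\<exists>l s. f = {\<sigma> k, l, s} \<and> l \<in> ?L \<and> l \<noteq> \<sigma> k" if f: "f \<in> A'" for f
  proof -
    have fH: "f \<in> H" "f \<subseteq> U" "\<sigma> k \<in> f" using f by (auto simp: A'_def A_def)
    have "card f = 3" using H fH by (auto simp: linear3_def)
    then have "card (f - {\<sigma> k}) = 2" using fH(3) by (simp add: card_Diff_singleton)
    then obtain l s where ls: "f - {\<sigma> k} = {l, s}" "l \<noteq> s" by (auto simp: card_2_iff)
    then have eq: "f = {\<sigma> k, l, s}" and ne: "l \<noteq> \<sigma> k" "s \<noteq> \<sigma> k" using fH(3) by auto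
    have "s \<notin> \<sigma> ` {..k}"
    proof
      assume "s \<in> \<sigma> ` {..k}"
      then obtain i where "i \<le> k" "s = \<sigma> i" by auto
      then show False using ne(2) f eq by (cases "i = k") (auto simp: A'_def)
    qed
    then have "l \<in> ?L" using eq fH by auto
    then show ?thesis using eq ne by blast
  qed
  define L where "L f = (SOME l. \<exists>s. f = {\<sigma> k, l, s} \<and> l \<in> ?L \<and> l \<noteq> \<sigma> k)" for f
  have L: "\<exists>s. f = {\<sigma> k, L f, s} \<and> L f \<in> ?L \<and> L f \<noteq> \<sigma> k" if "f \<in> A'" for f
    unfolding L_def by (rule someI_ex) (rule trip[OF that])
  have "card A' \<le> card ?L"
  proof (rule card_inj_on_le[where f = L])
    show "L ` A' \<subseteq> ?L" using L by blast
    show "finite ?L" using U by simp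
    show "inj_on L A'"
    proof (rule inj_onI)
      fix f f' assume f: "f \<in> A'" "f' \<in> A'" "L f = L f'"
      have "L f \<in> f" "L f \<in> f'" "L f \<noteq> \<sigma> k" using L[OF f(1)] L[OF f(2)] f(3) by auto
      then show "f = f'" using f by (intro linear3_eq[OF H, of f f' "L f" "\<sigma> k"]) (auto simp: A'_def A_def)
    qed
  qed
  then show ?thesis using A'k deg unfolding A_def[symmetric] by linarith
qed

text \<open>The start and each of the \<open>j\<close> letters can be chosen in \<open>d\<close>
  ways; the extra \<open>k\<close> in the degree hypothesis pays for edges leading back to visited
  vertices.\<close>

lemma card_walks:
  assumes H: "linear3 H" and V: "finite V" and U: "U \<subseteq> V"
    and deg: "\<And>v. v \<in> U \<Longrightarrow> d + k \<le> card {f\<in>H. f \<subseteq> U \<and> v \<in> f}" and dU: "d \<le> card U"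
  shows "j \<le> k \<Longrightarrow> d ^ Suc j \<le> card (walks H V U j)"
proof (induction j)
  case 0
  have "card U \<le> card (walks H V U 0)"
  proof (rule card_inj_on_le[where f = "\<lambda>v. (\<lambda>_::nat. undefined)(0 := v)"])
    show "inj_on (\<lambda>v. (\<lambda>_::nat. undefined)(0 := v)) U" by (auto simp: inj_on_def fun_eq_iff)
    show "(\<lambda>v. (\<lambda>_::nat. undefined)(0 := v)) ` U \<subseteq> walks H V U 0"
    proof
      fix y assume "y \<in> (\<lambda>v. (\<lambda>_::nat. undefined)(0 := v)) ` U"
      then obtain v where v: "v \<in> U" "y = (\<lambda>_::nat. undefined)(0 := v)" by blast
      then have "y \<in> cube (Suc 0) V" using U by (auto simp: cube_def PiE_def extensional_def)
      then show "y \<in> walks H V U 0" unfolding walks_def using v by (auto intro!: exI[of _ y])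
    qed
    show "finite (walks H V U 0)" using V by (simp add: walks_def)
  qed
  then show ?case using dU by simp
next
  case (Suc j)
  have fU: "finite U" using U V finite_subset by blast
  have "\<forall>y\<in>walks H V U j. \<exists>\<sigma>. \<sigma> 0 = y 0 \<and> (\<forall>i<j. {\<sigma> i, y (Suc i), \<sigma> (Suc i)} \<in> H) \<and>
     inj_on \<sigma> {..j} \<and> \<sigma> ` {..j} \<subseteq> U" unfolding walks_def by blast
  from bchoice[OF this] obtain sg where sg: "\<And>y. y \<in> walks H V U j \<Longrightarrow>
     sg y 0 = y 0 \<and> (\<forall>i<j. {sg y i, y (Suc i), sg y (Suc i)} \<in> H) \<and> inj_on (sg y) {..j} \<and> sg y ` {..j} \<subseteq> U" by blast
  define L where "L y = {l \<in> U. \<exists>s\<in>U. {sg y j, l, s} \<in> H \<and> s \<notin> sg y ` {..j}}" for y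
  have Ld: "d \<le> card (L y)" if y: "y \<in> walks H V U j" for y
  proof -
    have "sg y j \<in> U" using sg[OF y] by auto
    then have "d + k - j \<le> card (L y)"
      unfolding L_def using sg[OF y] by (intro many_continuations H fU deg) auto
    then show ?thesis using Suc.prems by linarith
  qed
  have fW: "finite (walks H V U i)" for i using V by (simp add: walks_def)
  have fL: "finite (L y)" for y using fU by (simp add: L_def)
  have "d ^ Suc (Suc j) \<le> card (walks H V U j) * d" using Suc by (simp add: mult.commute)
  also have "\<dots> = (\<Sum>y\<in>walks H V U j. d)" by simp
  also have "\<dots> \<le> (\<Sum>y\<in>walks H V U j. card (L y))" by (intro sum_mono Ld)
  also have "\<dots> = card (SIGMA y:walks H V U j. L y)" using fW fL by (intro card_SigmaI[symmetric]) auto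
  also have "\<dots> \<le> card (walks H V U (Suc j))"
  proof (rule card_inj_on_le[where f = "\<lambda>(y, l). y(Suc j := l)"])
    show "inj_on (\<lambda>(y, l). y(Suc j := l)) (SIGMA y:walks H V U j. L y)"
    proof (rule inj_onI, clarify)
      fix y l y' l' assume y: "y \<in> walks H V U j" "y' \<in> walks H V U j" and eq: "y(Suc j := l) = y'(Suc j := l')"
      have "y i = y' i" if "i < Suc j" for i using fun_cong[OF eq, of i] that by simp
      then have "y = y'" using y by (intro cube_eqI[of y "Suc j" V y']) (auto simp: walks_def)
      moreover have "l = l'" using fun_cong[OF eq, of "Suc j"] by simp
      ultimately show "y = y' \<and> l = l'" by blast
    qed
    show "(\<lambda>(y, l). y(Suc j := l)) ` (SIGMA y:walks H V U j. L y) \<subseteq> walks H V U (Suc j)"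
    proof
      fix y' assume "y' \<in> (\<lambda>(y, l). y(Suc j := l)) ` (SIGMA y:walks H V U j. L y)"
      then obtain y l where y: "y \<in> walks H V U j" and l: "l \<in> L y" and y': "y' = y(Suc j := l)" by auto
      obtain s where s: "s \<in> U" "{sg y j, l, s} \<in> H" "s \<notin> sg y ` {..j}" using l by (auto simp: L_def)
      have "l \<in> V" using l U by (auto simp: L_def)
      then have c: "y' \<in> cube (Suc (Suc j)) V"
        using y unfolding y' walks_def by (auto simp: cube_def PiE_def Pi_def extensional_def less_Suc_eq)
      let ?\<sigma> = "(sg y)(Suc j := s)"
      note g = sg[OF y]
      have 1: "?\<sigma> 0 = y' 0" using g by (simp add: y')
      have 2: "{?\<sigma> i, y' (Suc i), ?\<sigma> (Suc i)} \<in> H" if "i < Suc j" for i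
      proof (cases "i = j")
        case True
        then show ?thesis using s(2) by (simp add: y')
      next
        case False
        then have "i < j" using that by simp
        then show ?thesis using g by (simp add: y')
      qed
      have im: "?\<sigma> ` {..j} = sg y ` {..j}" by (intro image_cong) auto
      have "inj_on ?\<sigma> {..j}" using g by (simp add: inj_on_def)
      then have 3: "inj_on ?\<sigma> {..Suc j}" unfolding atMost_Suc using s(3) im by (subst inj_on_insert) auto
      have 4: "?\<sigma> ` {..Suc j} \<subseteq> U" unfolding atMost_Suc image_insert im using g s(1) by simp
      show "y' \<in> walks H V U (Suc j)" unfolding walks_def
        using c 1 2 3 4 by (intro CollectI conjI exI[of _ ?\<sigma>]) blast+
    qed
  qed (rule fW)
  finally show ?case .
qed

text \<open>Large minimum degree on a subset gives order \<open>n ^ (p + 1)\<close> walks. Averaging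
  over all colourings, one of them keeps the proportion \<open>1 / K ^ K\<close>, and fixing a
  popular endpoint \<open>z\<close> loses a factor \<open>n\<close>.\<close>

lemma path_supply:
  fixes \<epsilon> :: real
  assumes \<epsilon>: "0 < \<epsilon>"
  shows "\<exists>c>0. \<exists>n0. \<forall>(V :: 'a set) H. finite V \<longrightarrow> n0 \<le> card V \<longrightarrow> H \<subseteq> Pow V \<longrightarrow> linear3 H \<longrightarrow>
    \<epsilon> * real (card V) ^ 2 \<le> real (card H) \<longrightarrow>
    (\<exists>\<chi> z. c * real (card V) ^ p \<le> real (card {y \<in> cube (Suc p) V. path H \<chi> p z y}))"
proof -
  define K where "K = Suc p"
  \<comment> \<open>Makes room for rounding up \<open>d\<close> and for the \<open>p\<close>
    vertices already visited.\<close>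
  define n0 where "n0 = nat \<lceil>4 * real (Suc p) / \<epsilon>\<rceil> + 1"
  define c where "c = (\<epsilon> / 4) ^ Suc p / real K ^ K"
  have c: "0 < c" using \<epsilon> by (simp add: c_def K_def)
  show ?thesis
  proof (intro exI[of _ c] conjI c exI[of _ n0] allI impI)
    fix V :: "'a set" and H
    assume V: "finite V" and n0: "n0 \<le> card V" and HV: "H \<subseteq> Pow V" and H: "linear3 H"
      and big: "\<epsilon> * real (card V) ^ 2 \<le> real (card H)"
    let ?n = "real (card V)"
    have n: "4 * real (Suc p) \<le> \<epsilon> * ?n" "0 < ?n"
    proof -
      have "4 * real (Suc p) / \<epsilon> \<le> real n0" unfolding n0_def by linarith
      also have "\<dots> \<le> ?n" using n0 by simp
      finally show "4 * real (Suc p) \<le> \<epsilon> * ?n" using \<epsilon> by (simp add: field_simps)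
      have "0 < n0" by (simp add: n0_def)
      then show "0 < ?n" using n0 by simp
    qed
    have "{} \<notin> H" using H by (auto simp: linear3_def)
    moreover have "\<epsilon> / 2 * ?n * ?n < real (card H)"
    proof -
      have "\<epsilon> / 2 * ?n * ?n < \<epsilon> * ?n ^ 2" using \<epsilon> n(2) by (simp add: power2_eq_square)
      then show ?thesis using big by linarith
    qed
    ultimately obtain U where U: "U \<subseteq> V" "U \<noteq> {}"
      and deg: "\<And>v. v \<in> U \<Longrightarrow> \<epsilon> / 2 * ?n \<le> real (card {f\<in>H. f \<subseteq> U \<and> v \<in> f})"
      using min_degree_subset[OF V HV, of "\<epsilon> / 2 * ?n"] by blast
    have fU: "finite U" using U V finite_subset by blast
    define d where "d = nat \<lceil>\<epsilon> / 4 * ?n\<rceil>"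
    have d: "\<epsilon> / 4 * ?n \<le> real d" "real (d + p) \<le> \<epsilon> / 2 * ?n"
    proof -
      show "\<epsilon> / 4 * ?n \<le> real d" unfolding d_def by linarith
      have "0 \<le> \<epsilon> / 4 * ?n" using \<epsilon> by simp
      then have "real d \<le> \<epsilon> / 4 * ?n + 1" unfolding d_def by linarith
      then show "real (d + p) \<le> \<epsilon> / 2 * ?n" using n(1) by simp
    qed
    have deg': "d + p \<le> card {f\<in>H. f \<subseteq> U \<and> v \<in> f}" if "v \<in> U" for v
      using deg[OF that] d(2) by linarith
    have dU: "d \<le> card U"
    proof -
      obtain v where v: "v \<in> U" using U(2) by blast
      have "inj_on (\<lambda>_. v) {..0::nat}" "(\<lambda>_. v) ` {..0::nat} \<subseteq> U" using v by auto
      from many_continuations[OF H this fU, of "d + p"] deg'[OF v]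
      have "d + p - 0 \<le> card {l \<in> U. \<exists>s\<in>U. {v, l, s} \<in> H \<and> s \<notin> (\<lambda>_. v) ` {..0::nat}}" by simp
      also have "\<dots> \<le> card U" using fU by (intro card_mono) auto
      finally show ?thesis by simp
    qed
    have W: "d ^ Suc p \<le> card (walks H V U p)" by (rule card_walks[OF H V U(1) deg' dU order_refl])
    have fW: "finite (walks H V U p)" using V by (simp add: walks_def)
    have "\<forall>y\<in>walks H V U p. \<exists>\<sigma>. \<sigma> 0 = y 0 \<and> (\<forall>i<p. {\<sigma> i, y (Suc i), \<sigma> (Suc i)} \<in> H) \<and>
       inj_on \<sigma> {..p} \<and> \<sigma> ` {..p} \<subseteq> U" unfolding walks_def by blast
    from bchoice[OF this] obtain sg where sg: "\<And>y. y \<in> walks H V U p \<Longrightarrow>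
       sg y 0 = y 0 \<and> (\<forall>i<p. {sg y i, y (Suc i), sg y (Suc i)} \<in> H) \<and> inj_on (sg y) {..p} \<and> sg y ` {..p} \<subseteq> U" by blast
    define Col where "Col = (V \<rightarrow>\<^sub>E {..p})"
    have fCol: "finite Col" "card Col = K ^ card V" using V by (auto simp: Col_def finite_PiE card_PiE K_def)
    have cnt: "K ^ (card V - K) \<le> card {\<chi>\<in>Col. \<forall>i\<le>p. \<chi> (sg y i) = i}" if y: "y \<in> walks H V U p" for y
    proof -
      note g = sg[OF y]
      \<comment> \<open>Colours are forced on the \<open>K\<close> spine vertices and free
        elsewhere.\<close>
      define A where "A v = (if v \<in> sg y ` {..p} then {the_inv_into {..p} (sg y) v} else {..p})" for v
      have sub: "sg y ` {..p} \<subseteq> V" using g U by blast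
      have cK: "card (sg y ` {..p}) = K" using g by (simp add: card_image K_def)
      have fA: "card (A v) = (if v \<in> sg y ` {..p} then 1 else K)" for v by (simp add: A_def K_def)
      have "card (PiE V A) = (\<Prod>v\<in>V. card (A v))" using V by (rule card_PiE)
      also have "\<dots> = (\<Prod>v\<in>V - sg y ` {..p}. card (A v)) * (\<Prod>v\<in>sg y ` {..p}. card (A v))"
        using sub V by (rule prod.subset_diff)
      also have "\<dots> = K ^ (card V - K)" by (simp add: fA card_Diff_subset sub cK)
      finally have "K ^ (card V - K) = card (PiE V A)" by simp
      also have "\<dots> \<le> card {\<chi>\<in>Col. \<forall>i\<le>p. \<chi> (sg y i) = i}"
      proof (rule card_mono)
        show "finite {\<chi>\<in>Col. \<forall>i\<le>p. \<chi> (sg y i) = i}" using fCol by simp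
        have inv: "the_inv_into {..p} (sg y) (sg y i) = i" if "i \<le> p" for i
          using g that by (intro the_inv_into_f_f) auto
        have "A v \<subseteq> {..p}" for v using inv by (auto simp: A_def)
        then have "PiE V A \<subseteq> Col" unfolding Col_def by (intro PiE_mono) auto
        moreover have "\<chi> (sg y i) = i" if "\<chi> \<in> PiE V A" "i \<le> p" for \<chi> i
        proof -
          have "sg y i \<in> V" using sub that(2) by auto
          then have "\<chi> (sg y i) \<in> A (sg y i)" using that(1) by auto
          then show ?thesis using that(2) inv[OF that(2)] by (auto simp: A_def)
        qed
        ultimately show "PiE V A \<subseteq> {\<chi>\<in>Col. \<forall>i\<le>p. \<chi> (sg y i) = i}" by blast
      qed
      finally show ?thesis .
    qed
    have KV: "K \<le> card V"
    proof -
      have "walks H V U p \<noteq> {}"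
      proof
        assume "walks H V U p = {}"
        then have "d = 0" using W by auto
        then show False using d(1) \<epsilon> n(2) by (simp add: mult_le_0_iff)
      qed
      then obtain y where y: "y \<in> walks H V U p" by blast
      have "card (sg y ` {..p}) = K" using sg[OF y] by (simp add: card_image K_def)
      moreover have "card (sg y ` {..p}) \<le> card V" using sg[OF y] U V by (intro card_mono) auto
      ultimately show ?thesis by simp
    qed
    define T where "T \<chi> = {y \<in> walks H V U p. \<forall>i\<le>p. \<chi> (sg y i) = i}" for \<chi>
    have "card (walks H V U p) * K ^ (card V - K) \<le> (\<Sum>y\<in>walks H V U p. card {\<chi>\<in>Col. \<forall>i\<le>p. \<chi> (sg y i) = i})"
      using sum_mono[of "walks H V U p" "\<lambda>_. K ^ (card V - K)"] cnt by simp
    also have "\<dots> = (\<Sum>\<chi>\<in>Col. card (T \<chi>))"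
      unfolding T_def using sum.swap_restrict[OF fW fCol(1), of "\<lambda>_ _. 1::nat" "\<lambda>y \<chi>. \<forall>i\<le>p. \<chi> (sg y i) = i"] by simp
    finally have tot: "card (walks H V U p) * K ^ (card V - K) \<le> (\<Sum>\<chi>\<in>Col. card (T \<chi>))" .
    have "\<exists>\<chi>\<in>Col. card (walks H V U p) \<le> card (T \<chi>) * K ^ K"
    proof (rule ccontr)
      assume no: "\<not> ?thesis"
      have "Col \<noteq> {}" using fCol(2) by (auto simp: K_def)
      then have "(\<Sum>\<chi>\<in>Col. card (T \<chi>) * K ^ K) < (\<Sum>\<chi>\<in>Col. card (walks H V U p))"
        using no fCol(1) by (intro sum_strict_mono) (auto simp: not_le)
      also have "\<dots> = card (walks H V U p) * K ^ (card V - K) * K ^ K"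
        using KV by (simp add: fCol(2) power_add[symmetric])
      also have "\<dots> \<le> (\<Sum>\<chi>\<in>Col. card (T \<chi>)) * K ^ K" using tot by (intro mult_right_mono) auto
      finally show False by (simp add: sum_distrib_right)
    qed
    then obtain \<chi> where \<chi>: "card (walks H V U p) \<le> card (T \<chi>) * K ^ K" by blast
    let ?P = "\<lambda>z. {y \<in> cube (Suc p) V. path H \<chi> p z y}"
    have TP: "T \<chi> \<subseteq> (\<Union>z\<in>V. ?P z)"
    proof
      fix y assume y: "y \<in> T \<chi>"
      then have yw: "y \<in> walks H V U p" by (simp add: T_def)
      note g = sg[OF yw]
      have "spine H \<chi> p (sg y p) y (sg y)" using g y by (simp add: spine_def T_def)
      then have "path H \<chi> p (sg y p) y" by (auto simp: path_def)
      moreover have "sg y p \<in> V" using g U by auto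
      moreover have "y \<in> cube (Suc p) V" using yw by (simp add: walks_def)
      ultimately show "y \<in> (\<Union>z\<in>V. ?P z)" by blast
    qed
    have "\<exists>z\<in>V. real (card (T \<chi>)) \<le> ?n * real (card (?P z))"
    proof (rule ccontr)
      assume no: "\<not> ?thesis"
      have "V \<noteq> {}" using n(2) by auto
      have "card (T \<chi>) \<le> card (\<Union>z\<in>V. ?P z)" using V TP by (intro card_mono) auto
      also have "\<dots> \<le> (\<Sum>z\<in>V. card (?P z))" by (rule card_UN_le[OF V])
      finally have "real (card (T \<chi>)) \<le> (\<Sum>z\<in>V. real (card (?P z)))" by (simp flip: of_nat_sum)
      then have "?n * real (card (T \<chi>)) \<le> (\<Sum>z\<in>V. ?n * real (card (?P z)))"
        unfolding sum_distrib_left[symmetric] by (intro mult_left_mono) auto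
      also have "\<dots> < (\<Sum>z\<in>V. real (card (T \<chi>)))"
        using no V \<open>V \<noteq> {}\<close> by (intro sum_strict_mono) (auto simp: not_le)
      finally show False by simp
    qed
    then obtain z where z: "real (card (T \<chi>)) \<le> ?n * real (card (?P z))" by blast
    have "(\<epsilon> / 4 * ?n) ^ Suc p \<le> real d ^ Suc p" using d(1) \<epsilon> by (intro power_mono) auto
    also have "\<dots> \<le> real (card (walks H V U p))" using W by (simp only: of_nat_power[symmetric] of_nat_le_iff)
    also have "\<dots> \<le> real (card (T \<chi>)) * real K ^ K" 
      using \<chi> by (simp only: of_nat_power[symmetric] of_nat_mult[symmetric] of_nat_le_iff)
    also have "\<dots> \<le> ?n * real (card (?P z)) * real K ^ K" using z by (intro mult_right_mono) auto
    finally have "(\<epsilon> / 4 * ?n) ^ Suc p \<le> ?n * real (card (?P z)) * real K ^ K" .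
    moreover have "(\<epsilon> / 4 * ?n) ^ Suc p = (\<epsilon> / 4) ^ Suc p * ?n ^ p * ?n"
      by (simp only: power_mult_distrib power_Suc ac_simps)
    ultimately have "(\<epsilon> / 4) ^ Suc p * ?n ^ p * ?n \<le> real (card (?P z)) * real K ^ K * ?n"
      by (simp only: ac_simps)
    then have "(\<epsilon> / 4) ^ Suc p * ?n ^ p \<le> real (card (?P z)) * real K ^ K" using n(2) by simp
    moreover have "0 < real K ^ K" by (simp add: K_def)
    ultimately have "c * ?n ^ p \<le> real (card (?P z))"
      by (simp only: c_def times_divide_eq_left pos_divide_le_eq)
    then show "\<exists>\<chi> z. c * ?n ^ p \<le> real (card {y \<in> cube (Suc p) V. path H \<chi> p z y})" by blast
  qed
qed


section \<open>Building edges in a dense linear 3-graph\<close>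

lemma built_spine:
  assumes H: "linear3 H" and sp: "spine H \<chi> p z y \<sigma>"
  shows "\<exists>G. built H (Suc p) (y ` {..p} \<union> \<sigma> ` {..p}) G"
proof -
  have vs: "built H (Suc k) (y ` {..k}) {}" for k
  proof (induction k)
    case 0
    show ?case using built_vertex[OF built_empty, of H "y 0"] by simp
  next
    case (Suc k)
    then show ?case using built_vertex[OF Suc, of "y (Suc k)"] by (simp add: atMost_Suc)
  qed
  have "k \<le> p \<Longrightarrow> \<exists>G. built H (Suc p) (y ` {..p} \<union> \<sigma> ` {..k}) G" for k
  proof (induction k)
    case 0
    have "y ` {..p} \<union> \<sigma> ` {..0} = y ` {..p}" using sp by (auto simp: spine_def)
    then show ?case using vs[of p] by auto
  next
    case (Suc k)
    then obtain G where G: "built H (Suc p) (y ` {..p} \<union> \<sigma> ` {..k}) G" (is "built H _ ?U _") by auto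
    let ?f = "{\<sigma> k, y (Suc k), \<sigma> (Suc k)}"
    have f: "?f \<in> H" using sp Suc.prems by (auto simp: spine_def)
    have "\<sigma> k \<noteq> y (Suc k)" using linear3_distinct[OF H f] by blast
    then have "2 = card {\<sigma> k, y (Suc k)}" by simp
    also have "\<dots> \<le> card (?f \<inter> ?U)" using Suc.prems by (intro card_mono) auto
    finally have "built H (Suc p) (?U \<union> ?f) (insert ?f G)" by (intro built_edge G f)
    moreover have "?U \<union> ?f = y ` {..p} \<union> \<sigma> ` {..Suc k}" using Suc.prems by (auto simp: atMost_Suc)
    ultimately show ?case by metis
  qed
  then show ?thesis by blast
qed

text \<open>The \<open>p + k + 2\<close> free vertices are the start and the \<open>p\<close>
  letters of one word, the \<open>k\<close> generic points that multiply it, and the starting point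
  of the last walk.\<close>

lemma dense_built:
  fixes \<epsilon> :: real
  assumes \<epsilon>: "0 < \<epsilon>" and p: "2 \<le> p" and k: "k < p"
  shows "\<exists>n0. \<forall>(V :: 'a set) H. finite V \<longrightarrow> n0 \<le> card V \<longrightarrow> H \<subseteq> Pow V \<longrightarrow> linear3 H \<longrightarrow>
    \<epsilon> * real (card V) ^ 2 \<le> real (card H) \<longrightarrow>
    (\<exists>U G. built H (p + k + 2) U G \<and> G \<noteq> {} \<and> (card U \<le> card G \<or> (\<Prod>i<k. p - 1 - i) \<le> card G * 2 ^ (p + k + 1)))"
proof -
  obtain c n1 where c: "0 < c" and sup: "\<And>(V :: 'a set) H. finite V \<Longrightarrow> n1 \<le> card V \<Longrightarrow> H \<subseteq> Pow V \<Longrightarrow> linear3 H \<Longrightarrow>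
    \<epsilon> * real (card V) ^ 2 \<le> real (card H) \<Longrightarrow>
    (\<exists>\<chi> z. c * real (card V) ^ p \<le> real (card {y \<in> cube (Suc p) V. path H \<chi> p z y}))"
    using path_supply[OF \<epsilon>, where 'a = 'a and p = p] by blast
  obtain c' where c': "0 < c'" and tow: "\<And>(V :: 'a set) H \<chi> z. linear3 H \<Longrightarrow> finite V \<Longrightarrow> V \<noteq> {} \<Longrightarrow>
    c * real (card V) ^ p \<le> real (card {y \<in> cube (Suc p) V. path H \<chi> p z y}) \<Longrightarrow>
    c' * real (card V) ^ (Suc k + p) \<le> real (card (SIGMA as:{as. set as \<subseteq> V \<and> length as = Suc k}. {y \<in> cube (Suc p) V. tower H \<chi> p z as y}))"
    using tower_count[OF c, where 'a = 'a and p = p and t = "Suc k"] by blast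
  obtain C where C: "\<And>(H :: 'a set set) U V. linear3 H \<Longrightarrow> finite V \<Longrightarrow> finite U \<Longrightarrow> card U \<le> 2 * Suc p \<Longrightarrow>
     card {as. set as \<subseteq> V \<and> length as = Suc k \<and> \<not> generics H p U as} \<le> C * card V ^ (Suc k - 1)"
    using card_not_generics[where 'a = 'a and N = "2 * Suc p" and t = "Suc k" and p = p] by blast
  \<comment> \<open>Beyond this size the towers, at least \<open>c' * n ^ (k + 1 + p)\<close>,
    outnumber those with a non-generic list, at most \<open>C * n ^ (k + p)\<close>.\<close>
  define n0 where "n0 = max n1 (nat \<lceil>real C / c'\<rceil> + 1)"
  show ?thesis
  proof (rule exI[of _ n0], intro allI impI)
    fix V :: "'a set" and H
    assume V: "finite V" and n0: "n0 \<le> card V" and HV: "H \<subseteq> Pow V" and H: "linear3 H"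
      and big: "\<epsilon> * real (card V) ^ 2 \<le> real (card H)"
    let ?n = "real (card V)"
    have "nat \<lceil>real C / c'\<rceil> + 1 \<le> card V" using n0 by (simp add: n0_def)
    then have "real C / c' < ?n" by linarith
    then have nC: "real C < c' * ?n" using c' by (simp add: field_simps)
    have npos: "0 < ?n" using n0 by (simp add: n0_def)
    then have Vne: "V \<noteq> {}" by auto
    obtain \<chi> z where base: "c * ?n ^ p \<le> real (card {y \<in> cube (Suc p) V. path H \<chi> p z y})"
      using sup[OF V _ HV H big] n0 by (auto simp: n0_def)
    let ?L = "{as. set as \<subseteq> V \<and> length as = Suc k}"
    let ?Y = "\<lambda>as. {y \<in> cube (Suc p) V. tower H \<chi> p z as y}"
    let ?P = "{y \<in> cube (Suc p) V. path H \<chi> p z y}"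
    have "\<forall>y\<in>?P. \<exists>\<sigma>. spine H \<chi> p z y \<sigma>" by (auto simp: path_def)
    from bchoice[OF this] obtain sg where sg: "\<And>y. y \<in> ?P \<Longrightarrow> spine H \<chi> p z y (sg y)" by blast
    define U0 where "U0 y = y ` {..p} \<union> sg y ` {..p}" for y
    have U0: "finite (U0 y)" "card (U0 y) \<le> 2 * Suc p" for y
    proof -
      have "card (U0 y) \<le> card (y ` {..p}) + card (sg y ` {..p})" unfolding U0_def by (rule card_Un_le)
      also have "\<dots> \<le> Suc p + Suc p" using card_image_le[of "{..p}" y] card_image_le[of "{..p}" "sg y"] by simp
      finally show "card (U0 y) \<le> 2 * Suc p" by simp
    qed (simp add: U0_def)
    have fL: "finite ?L" using V by (rule finite_lists_length_eq)
    have fP: "finite ?P" using V by simp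
    let ?S = "SIGMA as:?L. ?Y as"
    let ?Bad = "\<lambda>y. {as. set as \<subseteq> V \<and> length as = Suc k \<and> \<not> generics H p (U0 y) as}"
    have "\<exists>as y. (as, y) \<in> ?S \<and> generics H p (U0 y) as"
    proof (rule ccontr)
      assume no: "\<not> ?thesis"
      have fB: "finite (?Bad y)" for y by (rule finite_subset[OF _ fL]) auto
      have "card ?S \<le> card (SIGMA y:?P. ?Bad y)"
      proof (rule card_inj_on_le[where f = prod.swap])
        show "prod.swap ` ?S \<subseteq> (SIGMA y:?P. ?Bad y)" using no by (auto dest: tower_path)
        show "finite (SIGMA y:?P. ?Bad y)" using fP fB by (intro finite_SigmaI) auto
      qed simp
      also have "\<dots> = (\<Sum>y\<in>?P. card (?Bad y))" using fP fB by (intro card_SigmaI) auto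
      also have "\<dots> \<le> (\<Sum>y\<in>?P. C * card V ^ (Suc k - 1))" by (intro sum_mono C H V U0)
      also have "\<dots> = card ?P * (C * card V ^ k)" by simp
      also have "\<dots> \<le> card V ^ p * (C * card V ^ k)" using card_path_le[OF H V] by (intro mult_right_mono) auto
      finally have "real (card ?S) \<le> real (card V ^ p * (C * card V ^ k))" by (simp only: of_nat_le_iff)
      then have "c' * ?n ^ (Suc k + p) \<le> ?n ^ p * (real C * ?n ^ k)"
        using tow[OF H V Vne base] by simp
      then have "(c' * ?n) * (?n ^ k * ?n ^ p) \<le> real C * (?n ^ k * ?n ^ p)"
        by (simp add: power_add ac_simps)
      moreover have "0 < ?n ^ k * ?n ^ p" using npos by simp
      ultimately have "c' * ?n \<le> real C" by (simp add: mult_le_cancel_right)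
      then show False using nC by simp
    qed
    then obtain as y where as: "set as \<subseteq> V" "length as = Suc k" and y: "y \<in> cube (Suc p) V" and tw: "tower H \<chi> p z as y"
      and gn: "generics H p (U0 y) as" by blast
    have yP: "y \<in> ?P" using y tower_path[OF tw] by blast
    define bs where "bs = butlast as"
    define a where "a = last as"
    have "as \<noteq> []" using as(2) by auto
    then have asb: "as = bs @ [a]" and lb: "length bs = k" using as(2) by (simp_all add: bs_def a_def)
    have gb: "generics H p (U0 y) bs" and ga: "generic H p (expands H p (U0 y) bs) a"
      using gn unfolding asb generics_append by auto
    have "\<forall>k\<in>{1..p}. y k \<in> U0 y" "\<forall>i\<le>p. sg y i \<in> U0 y" by (auto simp: U0_def)
    from many_words[OF H _ tw[unfolded asb] gb sg[OF yP] this order_refl] p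
    obtain W where W: "finite W" "(\<Prod>i<length bs. card {1..<p} - i) \<le> card W" "inj_on (\<lambda>y. restrict y {1..<p}) W"
      and Wp: "\<forall>y'\<in>W. (\<exists>l. path H \<chi> p z (y'(0 := a, p := l))) \<and> (\<forall>k\<in>{1..p}. y' k \<in> expands H p (U0 y) bs) \<and>
         (\<forall>k\<in>{1..p}. y' k = y k \<or> k \<in> {1..<p} \<and> y' k \<notin> U0 y)" by auto
    have N: "(\<Prod>i<k. p - 1 - i) \<le> card W" using W(2) lb by simp
    moreover have "0 < (\<Prod>i<k. p - 1 - i)" using k by (intro prod_pos) auto
    ultimately have "0 < card W" by (rule less_le_trans[rotated])
    then have Wne: "W \<noteq> {}" by auto
    obtain G0 where "built H (Suc p) (U0 y) G0" using built_spine[OF H sg[OF yP]] by (auto simp: U0_def)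
    from built_expands[OF H this, of bs] obtain G1 where b1: "built H (Suc p + k) (expands H p (U0 y) bs) G1"
      by (auto simp: lb)
    have "\<exists>U' G'. built H (Suc (Suc p + k)) U' G' \<and> G' \<noteq> {} \<and> (card U' \<le> card G' \<or> card W \<le> card G' * 2 ^ (Suc p + k))"
      by (rule last_level[OF H b1 ga p W(1) Wne W(3)]) (use Wp in blast)+
    then obtain U' G' where b2: "built H (Suc (Suc p + k)) U' G'" and G': "G' \<noteq> {}"
      and alt: "card U' \<le> card G' \<or> card W \<le> card G' * 2 ^ (Suc p + k)" by blast
    have "Suc (Suc p + k) = p + k + 2" "Suc p + k = p + k + 1" by auto
    with b2 G' alt N show "\<exists>U G. built H (p + k + 2) U G \<and> G \<noteq> {} \<and>
        (card U \<le> card G \<or> (\<Prod>i<k. p - 1 - i) \<le> card G * 2 ^ (p + k + 1))"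
      by (metis le_trans)
  qed
qed

section \<open>Configurations in dense 3-graphs\<close>

lemma card_edges_at_vertex:
  assumes H: "linear3 H" "H \<subseteq> Pow V" and V: "finite V"
  shows "card {f\<in>H. v \<in> f} \<le> card V"
proof -
  define w where "w f = (SOME w. w \<in> f \<and> w \<noteq> v)" for f
  have w: "w f \<in> f \<and> w f \<noteq> v" if "f \<in> H" for f
  proof -
    have "card f = 3" using H(1) that by (auto simp: linear3_def)
    then have "\<not> f \<subseteq> {v}" using card_mono[of "{v}" f] by auto
    then have "\<exists>w. w \<in> f \<and> w \<noteq> v" by blast
    then show ?thesis unfolding w_def by (rule someI_ex)
  qed
  show ?thesis
  proof (rule card_inj_on_le[where f = w])
    show "w ` {f\<in>H. v \<in> f} \<subseteq> V" using w H(2) by blast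
    show "inj_on w {f\<in>H. v \<in> f}"
    proof (rule inj_onI)
      fix f f' assume f: "f \<in> {f\<in>H. v \<in> f}" "f' \<in> {f\<in>H. v \<in> f}" and eq: "w f = w f'"
      then have "w f \<in> f" "w f \<in> f'" "w f \<noteq> v" using w[of f] w[of f'] by auto
      then show "f = f'" using f by (intro linear3_eq[OF H(1), of f f' "w f" v]) auto
    qed
  qed (rule V)
qed

lemma card_edges_meeting:
  assumes H: "linear3 H" "H \<subseteq> Pow V" and V: "finite V" and X: "finite X"
  shows "card {f\<in>H. f \<inter> X \<noteq> {}} \<le> card X * card V"
proof -
  have fH: "finite H" using H(2) V by (meson finite_Pow_iff finite_subset)
  have "{f\<in>H. f \<inter> X \<noteq> {}} = (\<Union>v\<in>X. {f\<in>H. v \<in> f})" by blast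
  then have "card {f\<in>H. f \<inter> X \<noteq> {}} \<le> (\<Sum>v\<in>X. card {f\<in>H. v \<in> f})" using card_UN_le[OF X] by metis
  also have "\<dots> \<le> (\<Sum>v\<in>X. card V)" by (intro sum_mono card_edges_at_vertex[OF H V])
  finally show ?thesis by simp
qed

text \<open>Vertex-disjoint configurations with at most as many vertices as edges are collected until
  \<open>e\<close> edges are exceeded; the last one is cut off to the right length.\<close>

lemma linear_dense_configuration:
  fixes \<epsilon> :: real
  assumes \<epsilon>: "0 < \<epsilon>" and p: "2 \<le> p" and k: "k < p" and N: "e * 2 ^ (p + k + 1) \<le> (\<Prod>i<k. p - 1 - i)"
  shows "\<exists>n0. \<forall>(V :: 'a set) H. finite V \<longrightarrow> n0 \<le> card V \<longrightarrow> H \<subseteq> Pow V \<longrightarrow> linear3 H \<longrightarrow>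
    \<epsilon> * real (card V) ^ 2 \<le> real (card H) \<longrightarrow>
    (\<exists>F\<subseteq>H. finite F \<and> card F = e \<and> card (\<Union>F) \<le> e + (p + k + 2))"
proof -
  obtain n1 where n1: "\<And>(V :: 'a set) H. finite V \<Longrightarrow> n1 \<le> card V \<Longrightarrow> H \<subseteq> Pow V \<Longrightarrow> linear3 H \<Longrightarrow>
    \<epsilon> / 2 * real (card V) ^ 2 \<le> real (card H) \<Longrightarrow>
    (\<exists>U G. built H (p + k + 2) U G \<and> G \<noteq> {} \<and> (card U \<le> card G \<or> (\<Prod>i<k. p - 1 - i) \<le> card G * 2 ^ (p + k + 1)))"
    using dense_built[of "\<epsilon> / 2" p k, where 'a = 'a] \<epsilon> p k by (metis half_gt_zero)
  \<comment> \<open>The collected vertices number at most \<open>e\<close>, so avoiding them costs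
    at most \<open>e * n\<close> edges, which is then at most
    \<open>\<epsilon> / 2 * n ^ 2\<close>.\<close>
  define n0 where "n0 = max n1 (nat \<lceil>2 * real e / \<epsilon>\<rceil>)"
  show ?thesis
  proof (rule exI[of _ n0], intro allI impI)
    fix V :: "'a set" and H
    assume V: "finite V" and n0: "n0 \<le> card V" and HV: "H \<subseteq> Pow V" and H: "linear3 H"
      and big: "\<epsilon> * real (card V) ^ 2 \<le> real (card H)"
    let ?n = "real (card V)" and ?\<zeta> = "p + k + 2"
    have nn1: "n1 \<le> card V" using n0 by (simp add: n0_def)
    have "2 * real e / \<epsilon> \<le> real (nat \<lceil>2 * real e / \<epsilon>\<rceil>)" by linarith
    also have "\<dots> \<le> ?n" using n0 by (simp add: n0_def)
    finally have en: "real e \<le> \<epsilon> / 2 * ?n" using \<epsilon> by (simp add: field_simps)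
    have fH: "finite H" using HV V by (meson finite_Pow_iff finite_subset)
    have "\<exists>F'\<subseteq>H. finite F' \<and> card F' = e \<and> card (\<Union>F') \<le> e + ?\<zeta>"
      if "F \<subseteq> H" "\<Union>F \<subseteq> X" "finite X" "card X \<le> card F" "card F \<le> e" for F X
      using that
    proof (induction "e - card F" arbitrary: F X rule: less_induct)
      case less
      have fF: "finite F" using less.prems(1) fH finite_subset by blast
      show ?case
      proof (cases "card F = e")
        case True
        have "card (\<Union>F) \<le> card X" using less.prems by (intro card_mono) auto
        then show ?thesis using True less.prems fF by (intro exI[of _ F]) auto
      next
        case False
        then have Fe: "card F < e" using less.prems by simp
        define H' where "H' = {f\<in>H. f \<inter> X = {}}"
        have H': "H' \<subseteq> Pow V" "linear3 H'" "H' \<subseteq> H" using HV linear3_subset[OF H] by (auto simp: H'_def)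
        have "H = H' \<union> {f\<in>H. f \<inter> X \<noteq> {}}" by (auto simp: H'_def)
        then have "card H \<le> card H' + card {f\<in>H. f \<inter> X \<noteq> {}}" using card_Un_le by metis
        also have "\<dots> \<le> card H' + card X * card V"
          using card_edges_meeting[OF H HV V less.prems(3)] by simp
        also have "card X * card V \<le> e * card V" using less.prems by (intro mult_right_mono) auto
        finally have "card H \<le> card H' + e * card V" by simp
        then have "real (card H) \<le> real (card H' + e * card V)" by (simp only: of_nat_le_iff)
        then have "real (card H) \<le> real (card H') + real e * ?n" by simp
        also have "real e * ?n \<le> \<epsilon> / 2 * ?n * ?n" using en by (intro mult_right_mono) auto
        finally have "\<epsilon> / 2 * ?n ^ 2 \<le> real (card H')" using big by (simp add: power2_eq_square)
        from n1[OF V nn1 H'(1,2) this] obtain U G where b: "built H' ?\<zeta> U G" and Gne: "G \<noteq> {}"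
          and alt: "card U \<le> card G \<or> (\<Prod>i<k. p - 1 - i) \<le> card G * 2 ^ (p + k + 1)" by blast
        have H'3: "\<forall>f\<in>H'. card f = 3" using H'(2) by (simp add: linear3_def)
        have disj: "F \<inter> G' = {}" if G'H': "G' \<subseteq> H'" for G'
        proof (rule ccontr)
          assume "F \<inter> G' \<noteq> {}"
          then obtain f where f: "f \<in> F" "f \<in> H'" using G'H' by blast
          then have "f = {}" using less.prems(2) by (auto simp: H'_def)
          then show False using f(2) H'3 by auto
        qed
        note bp = built_props[OF b H'3]
        show ?thesis
        \<comment> \<open>With enough edges a prefix completes the collection. Otherwise
          \<open>card G < e\<close> excludes the second alternative, so \<open>G\<close> spans no
          more vertices than it has edges.\<close>
        proof (cases "e - card F \<le> card G")
          case True
          from built_prefix[OF b H'3 True] obtain \<zeta>' U' G' where *: "\<zeta>' \<le> ?\<zeta>" "built H' \<zeta>' U' G'" "card G' = e - card F" by blast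
          note bp' = built_props[OF *(2) H'3]
          have "card (F \<union> G') = card F + card G'" using fF bp' disj[of G'] by (intro card_Un_disjoint) auto
          then have c: "card (F \<union> G') = e" using *(3) Fe by simp
          have "card (\<Union>(F \<union> G')) \<le> card (X \<union> U')" using less.prems bp' by (intro card_mono) auto
          also have "\<dots> \<le> card X + card U'" by (rule card_Un_le)
          also have "\<dots> \<le> card F + (\<zeta>' + card G')" using less.prems bp' by (intro add_mono) auto
          also have "\<dots> \<le> e + ?\<zeta>" using *(1,3) Fe by simp
          finally have "card (\<Union>(F \<union> G')) \<le> e + ?\<zeta>" .
          moreover have "F \<union> G' \<subseteq> H" using less.prems(1) bp' H'(3) by blast
          moreover have "finite (F \<union> G')" using fF bp' by simp
          ultimately show ?thesis using c by blast
        next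
          case False
          then have "card G < e" by simp
          then have "card G * 2 ^ (p + k + 1) < e * 2 ^ (p + k + 1)" by simp
          then have UG: "card U \<le> card G" using alt N by linarith
          have cFG: "card (F \<union> G) = card F + card G" using fF bp disj[of G] by (intro card_Un_disjoint) auto
          show ?thesis
          proof (rule less.hyps)
            have "0 < card G" using Gne bp by (simp add: card_gt_0_iff)
            then show "e - card (F \<union> G) < e - card F" using cFG Fe by linarith
            show "F \<union> G \<subseteq> H" using less.prems(1) bp H'(3) by blast
            show "\<Union>(F \<union> G) \<subseteq> X \<union> U" using less.prems(2) bp by auto
            show "finite (X \<union> U)" using less.prems(3) bp by simp
            have "card (X \<union> U) \<le> card X + card U" by (rule card_Un_le)
            then show "card (X \<union> U) \<le> card (F \<union> G)" using less.prems(4) UG cFG by linarith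
            show "card (F \<union> G) \<le> e" using cFG False by linarith
          qed
        qed
      qed
    qed
    from this[of "{}" "{}"] show "\<exists>F\<subseteq>H. finite F \<and> card F = e \<and> card (\<Union>F) \<le> e + ?\<zeta>" by simp
  qed
qed

text \<open>By maximality every edge shares a pair with an edge of a largest linear subset
  \<open>M\<close>; an edge of \<open>M\<close> has three pairs, each in at most \<open>e\<close>
  edges.\<close>

lemma linear_subgraph:
  assumes V: "finite V" and H: "H \<subseteq> Pow V" "\<forall>f\<in>H. card f = 3"
    and codeg: "\<And>P. card P = 2 \<Longrightarrow> card {f\<in>H. P \<subseteq> f} \<le> e"
  shows "\<exists>M\<subseteq>H. linear3 M \<and> card H \<le> 3 * e * card M"
proof -
  have fH: "finite H" using H V by (meson finite_Pow_iff finite_subset)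
  let ?S = "{M. M \<subseteq> H \<and> linear3 M}"
  have "finite ?S" using fH by simp
  moreover have "{} \<in> ?S" by (simp add: linear3_def)
  ultimately have "Max (card ` ?S) \<in> card ` ?S" by (intro Max_in) auto
  then obtain M where M: "M \<subseteq> H" "linear3 M" and MM: "Max (card ` ?S) = card M" by auto
  have mx: "card M' \<le> card M" if "M' \<subseteq> H" "linear3 M'" for M'
    unfolding MM[symmetric] using \<open>finite ?S\<close> that by (intro Max_ge) auto
  have fM: "finite M" using M fH finite_subset by blast
  let ?C = "\<lambda>g. {f\<in>H. 2 \<le> card (f \<inter> g)}"
  have "H \<subseteq> (\<Union>g\<in>M. ?C g)"
  proof
    fix f assume f: "f \<in> H"
    show "f \<in> (\<Union>g\<in>M. ?C g)"
    proof (rule ccontr)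
      assume no: "f \<notin> (\<Union>g\<in>M. ?C g)"
      have small: "card (f \<inter> g) \<le> 1" "card (g \<inter> f) \<le> 1" if "g \<in> M" for g
        using no f that by (auto simp: Int_commute)
      have "f \<notin> M" using small[of f] H(2) f by auto
      have "linear3 (insert f M)"
        using M(2) H(2) f small unfolding linear3_def by blast
      then have "card (insert f M) \<le> card M" using f M(1) by (intro mx) auto
      then show False using \<open>f \<notin> M\<close> fM by simp
    qed
  qed
  then have "card H \<le> card (\<Union>g\<in>M. ?C g)" using fM fH by (intro card_mono) auto
  also have "\<dots> \<le> (\<Sum>g\<in>M. card (?C g))" by (rule card_UN_le[OF fM])
  also have "\<dots> \<le> (\<Sum>g\<in>M. 3 * e)"
  proof (rule sum_mono)
    fix g assume "g \<in> M"
    then have g3: "card g = 3" using M(1) H(2) by blast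
    then have fg: "finite g" by (intro card_ge_0_finite) simp
    let ?P = "{P. P \<subseteq> g \<and> card P = 2}"
    have cP: "card ?P = 3" using n_subsets[OF fg, of 2] g3 by (simp add: numeral_eq_Suc)
    then have fP: "finite ?P" by (intro card_ge_0_finite) simp
    have "?C g \<subseteq> (\<Union>P\<in>?P. {f\<in>H. P \<subseteq> f})"
    proof
      fix f assume "f \<in> ?C g"
      then have f: "f \<in> H" "2 \<le> card (f \<inter> g)" by auto
      obtain P where "P \<subseteq> f \<inter> g" "card P = 2" using obtain_subset_with_card_n[OF f(2)] by blast
      then show "f \<in> (\<Union>P\<in>?P. {f\<in>H. P \<subseteq> f})" using f(1) by blast
    qed
    then have "card (?C g) \<le> card (\<Union>P\<in>?P. {f\<in>H. P \<subseteq> f})" using fP fH by (intro card_mono) auto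
    also have "\<dots> \<le> (\<Sum>P\<in>?P. card {f\<in>H. P \<subseteq> f})" by (rule card_UN_le[OF fP])
    also have "\<dots> \<le> (\<Sum>P\<in>?P. e)" using codeg by (intro sum_mono) auto
    also have "\<dots> = 3 * e" by (simp add: cP)
    finally show "card (?C g) \<le> 3 * e" .
  qed
  finally have "card H \<le> 3 * e * card M" by (simp add: mult.commute)
  then show ?thesis using M by blast
qed

text \<open>Either \<open>e\<close> edges through a common pair, spanning at most
  \<open>e + 2\<close> vertices, already suffice, or the codegrees are bounded and a linear subgraph
  keeps the proportion \<open>1 / (3 * e)\<close> of the edges.\<close>

lemma dense_configuration:
  fixes \<epsilon> :: real
  assumes \<epsilon>: "0 < \<epsilon>" and p: "2 \<le> p" and k: "k < p" and e: "0 < e" and N: "e * 2 ^ (p + k + 1) \<le> (\<Prod>i<k. p - 1 - i)"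
  shows "\<exists>n0. \<forall>(V :: 'a set) H. uniform_hypergraph 3 V H \<longrightarrow> n0 \<le> card V \<longrightarrow>
    \<epsilon> * real (card V) ^ 2 \<le> real (card H) \<longrightarrow>
    (\<exists>F\<subseteq>H. finite F \<and> card F = e \<and> card (\<Union>F) \<le> e + (p + k + 2))"
proof -
  let ?\<epsilon> = "\<epsilon> / (3 * real e)"
  have "0 < ?\<epsilon>" using \<epsilon> e by simp
  then obtain n0 where n0: "\<And>(V :: 'a set) H. finite V \<Longrightarrow> n0 \<le> card V \<Longrightarrow> H \<subseteq> Pow V \<Longrightarrow> linear3 H \<Longrightarrow>
    ?\<epsilon> * real (card V) ^ 2 \<le> real (card H) \<Longrightarrow>
    (\<exists>F\<subseteq>H. finite F \<and> card F = e \<and> card (\<Union>F) \<le> e + (p + k + 2))"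
    using linear_dense_configuration[of ?\<epsilon> p k e, where 'a = 'a] p k N by blast
  show ?thesis
  proof (rule exI[of _ n0], intro allI impI)
    fix V :: "'a set" and H
    assume u: "uniform_hypergraph 3 V H" and nV: "n0 \<le> card V" and big: "\<epsilon> * real (card V) ^ 2 \<le> real (card H)"
    have V: "finite V" and H: "H \<subseteq> Pow V" "\<forall>f\<in>H. card f = 3" using u by (auto simp: uniform_hypergraph_def)
    have fH: "finite H" using H V by (meson finite_Pow_iff finite_subset)
    show "\<exists>F\<subseteq>H. finite F \<and> card F = e \<and> card (\<Union>F) \<le> e + (p + k + 2)"
    proof (cases "\<exists>P. card P = 2 \<and> e < card {f\<in>H. P \<subseteq> f}")
      case True
      then obtain P where P: "card P = 2" "e < card {f\<in>H. P \<subseteq> f}" by blast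
      then obtain F where F: "F \<subseteq> {f\<in>H. P \<subseteq> f}" "card F = e" "finite F"
        using obtain_subset_with_card_n[of e "{f\<in>H. P \<subseteq> f}"] by auto
      have fP: "finite P" using P(1) by (intro card_ge_0_finite) simp
      have one: "card (f - P) = 1" if "f \<in> F" for f
      proof -
        have "card f = 3" "P \<subseteq> f" using F(1) H(2) that by auto
        then show ?thesis using card_Diff_subset[OF fP, of f] P(1) by simp
      qed
      have "\<Union>F \<subseteq> P \<union> (\<Union>f\<in>F. f - P)" by blast
      moreover have "finite (P \<union> (\<Union>f\<in>F. f - P))"
      proof -
        have "finite (f - P)" if "f \<in> F" for f using one[OF that] by (intro card_ge_0_finite) simp
        then show ?thesis using fP F(3) by blast
      qed
      ultimately have "card (\<Union>F) \<le> card (P \<union> (\<Union>f\<in>F. f - P))" by (intro card_mono)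
      also have "\<dots> \<le> card P + card (\<Union>f\<in>F. f - P)" by (rule card_Un_le)
      also have "card (\<Union>f\<in>F. f - P) \<le> (\<Sum>f\<in>F. card (f - P))" by (rule card_UN_le[OF F(3)])
      also have "(\<Sum>f\<in>F. card (f - P)) = e" using one F(2) by simp
      finally have "card (\<Union>F) \<le> e + (p + k + 2)" using P(1) by simp
      then show ?thesis using F by blast
    next
      case False
      then have "\<And>P. card P = 2 \<Longrightarrow> card {f\<in>H. P \<subseteq> f} \<le> e" by (simp add: not_less)
      from linear_subgraph[OF V H this] obtain M where M: "M \<subseteq> H" "linear3 M" "card H \<le> 3 * e * card M" by blast
      have "real (card H) \<le> real (3 * e * card M)" using M(3) by (simp only: of_nat_le_iff)
      then have "\<epsilon> * real (card V) ^ 2 \<le> 3 * real e * real (card M)" using big by simp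
      then have "?\<epsilon> * real (card V) ^ 2 \<le> real (card M)" using e by (simp add: field_simps)
      from n0[OF V nV _ M(2) this] M(1) H(1) show ?thesis by blast
    qed
  qed
qed


section \<open>Choice of the parameters\<close>

lemma ln_le_half: "0 < x \<Longrightarrow> ln x \<le> x / (2::real)"
proof -
  assume x: "0 < x"
  have "ln x = ln (x / 2) + ln 2" using x by (simp add: ln_div)
  moreover have "ln (x / 2) \<le> x / 2 - 1" using x by (intro ln_le_minus_one) simp
  moreover have "ln (2::real) \<le> 2 - 1" by (intro ln_le_minus_one) simp
  ultimately show ?thesis by linarith
qed

text \<open>With \<open>p = 2 * k\<close> the surplus of vertices is \<open>3 * k + 2\<close>. In
  logarithms the second claim is \<open>L + ln 2 \<le> k * ln (k / 8)\<close>, which holds from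
  \<open>k \<ge> 5 * u\<close> on, where \<open>u = L / l\<close>; the constant \<open>18\<close>
  leaves about \<open>6 * u\<close> for \<open>k\<close>.\<close>

lemma parameters_exist:
  assumes e: "3 \<le> (e::nat)"
  shows "\<exists>k\<ge>1. real (3 * k + 2) \<le> 18 * ln (real e) / ln (ln (real e)) \<and> e * 2 ^ (3 * k + 1) \<le> k ^ k"
proof -
  define L where "L = ln (real e)"
  define l where "l = ln L"
  define u where "u = L / l"
  \<comment> \<open>Makes \<open>ln (ln e)\<close> positive already at \<open>e = 3\<close>;
    \<open>(7 / 8) ^ 8\<close> just exceeds \<open>1 / 3\<close>.\<close>
  have "exp 1 < (3::real)"
  proof -
    have "(7 / 8) ^ 8 \<le> exp (- (1 / 8) :: real) ^ 8"
      using exp_ge_add_one_self[of "- (1 / 8) :: real"] by (intro power_mono) auto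
    also have "\<dots> = exp (- 1)" by (simp flip: exp_of_nat_mult)
    finally have "1 / 3 < exp (- 1 :: real)" by (simp add: power_divide)
    then show ?thesis by (simp add: exp_minus field_simps)
  qed
  then have "exp 1 < real e" using e by simp
  then have "1 < L" unfolding L_def using e by (subst exp_less_cancel_iff[symmetric]) simp
  then have l: "0 < l" by (simp add: l_def)
  have u2: "2 \<le> u"
  proof -
    have "l \<le> L / 2" unfolding l_def using \<open>1 < L\<close> by (intro ln_le_half) simp
    then show ?thesis using l by (simp add: u_def field_simps)
  qed
  have ul: "u * l = L" using l by (simp add: u_def)
  define k where "k = nat \<lfloor>(18 * u - 2) / 3\<rfloor>"
  have "0 \<le> (18 * u - 2) / 3" using u2 by simp
  then have k: "real k \<le> (18 * u - 2) / 3" "(18 * u - 2) / 3 < real k + 1"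
    unfolding k_def by linarith+
  \<comment> \<open>Rounding down loses less than \<open>1\<close>, and
    \<open>6 * u - 5 / 3 \<ge> 5 * u\<close> because \<open>u \<ge> 2\<close>.\<close>
  then have k5: "5 * u \<le> real k" using u2 by argo
  have k1: "1 \<le> k" using k5 u2 by linarith
  have first: "real (3 * k + 2) \<le> 18 * ln (real e) / ln (ln (real e))"
    using k(1) by (simp add: u_def l_def L_def)
  \<comment> \<open>The tangent of \<open>ln\<close> at \<open>5 / 4\<close>, with
    \<open>ln (5 / 4)\<close> rounded up. Slope \<open>4 / 5\<close> leaves \<open>l / 5\<close> of
    \<open>ln u = l - ln l\<close>, which the factor \<open>5 * u\<close> turns into exactly
    \<open>L\<close>.\<close>
  have ln1: "ln l \<le> 4 / 5 * l - 3 / 4"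
  proof -
    have "ln (4 / 5 * l * (5 / 4)) = ln (4 / 5 * l) + ln (5 / 4)" using l by (intro ln_mult_pos) auto
    then have "ln l = ln (4 / 5 * l) + ln (5 / 4)" by simp
    moreover have "ln (4 / 5 * l) \<le> 4 / 5 * l - 1" using l by (intro ln_le_minus_one) simp
    moreover have "ln (5 / 4 :: real) \<le> 5 / 4 - 1" by (intro ln_le_minus_one) simp
    ultimately show ?thesis by linarith
  qed
  have "ln (u * (5 / 8)) = ln u + ln (5 / 8)" using u2 by (intro ln_mult_pos) auto
  then have "ln (5 * u / 8) = ln u + ln (5 / 8)" by (simp add: mult.commute)
  moreover have "ln u = l - ln l" unfolding u_def l_def using \<open>1 < L\<close> l by (simp add: ln_div l_def)
  moreover have "- (3 / 5) \<le> ln (5 / 8 :: real)"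
  proof -
    have "ln (8 / 5 :: real) \<le> 8 / 5 - 1" by (intro ln_le_minus_one) simp
    moreover have "ln (5 / 8 :: real) = - ln (8 / 5)" by (simp add: ln_div)
    ultimately show ?thesis by linarith
  qed
  ultimately have "1 / 5 * l + 3 / 20 \<le> ln (5 * u / 8)" using ln1 by argo
  then have "5 * u * (1 / 5 * l + 3 / 20) \<le> 5 * u * ln (5 * u / 8)" using u2 by (intro mult_left_mono) auto
  moreover have "5 * u * (1 / 5 * l + 3 / 20) = L + 3 / 4 * u" unfolding ul[symmetric] by (simp add: algebra_simps)
  moreover have "ln (2::real) \<le> 1" using ln_le_minus_one[of "2::real"] by simp
  ultimately have "L + ln 2 \<le> 5 * u * ln (5 * u / 8)" using u2 by linarith
  also have "\<dots> \<le> real k * ln (real k / 8)"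
  proof (rule mult_mono)
    show "ln (5 * u / 8) \<le> ln (real k / 8)" using k5 u2 by simp
    show "0 \<le> ln (5 * u / 8)" using u2 by (intro ln_ge_zero) simp
  qed (use k5 in auto)
  also have "real k * ln (real k / 8) = real k * ln (real k) - real k * ln 8" using k1 by (simp add: ln_div algebra_simps)
  finally have "L + ln 2 + real k * ln 8 \<le> real k * ln (real k)" by linarith
  moreover have "ln (real (e * 2 ^ (3 * k + 1))) = L + ln 2 + real k * ln 8"
  proof -
    have "real (e * 2 ^ (3 * k + 1)) = real e * (2 * 8 ^ k)" by (simp add: power_mult)
    then show ?thesis using e by (simp add: ln_mult ln_realpow L_def)
  qed
  moreover have "ln (real (k ^ k)) = real k * ln (real k)" using k1 by (simp add: ln_realpow)
  ultimately have "ln (real (e * 2 ^ (3 * k + 1))) \<le> ln (real (k ^ k))" by simp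
  moreover have "0 < real (e * 2 ^ (3 * k + 1))" "0 < real (k ^ k)" using e k1 by auto
  ultimately have "real (e * 2 ^ (3 * k + 1)) \<le> real (k ^ k)" by (simp only: ln_le_cancel_iff)
  then have "e * 2 ^ (3 * k + 1) \<le> k ^ k" by (simp only: of_nat_le_iff)
  then show ?thesis using first k1 by blast
qed

lemma brown_erdos_sos_density:
  fixes \<epsilon> :: real
  assumes e: "3 \<le> e" and \<epsilon>: "0 < \<epsilon>"
  shows "\<exists>n0. \<forall>(V :: 'a set) E. uniform_hypergraph 3 V E \<and> n0 \<le> card V \<and> \<epsilon> * real (card V) ^ 2 \<le> real (card E) \<longrightarrow>
    contains_configuration E (real e + 18 * ln (real e) / ln (ln (real e))) e"
proof -
  obtain k where k: "1 \<le> k" and bound: "real (3 * k + 2) \<le> 18 * ln (real e) / ln (ln (real e))"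
    and big: "e * 2 ^ (3 * k + 1) \<le> k ^ k" using parameters_exist[OF e] by blast
  have "k ^ k = (\<Prod>i<k. k)" by simp
  \<comment> \<open>The reason for \<open>p = 2 * k\<close>: every factor with \<open>i < k\<close>
    is still at least \<open>k\<close>.\<close>
  also have "\<dots> \<le> (\<Prod>i<k. 2 * k - 1 - i)" by (intro prod_mono) auto
  finally have "e * 2 ^ (2 * k + k + 1) \<le> (\<Prod>i<k. 2 * k - 1 - i)" using big by simp
  then obtain n0 where n0: "\<And>(V :: 'a set) H. uniform_hypergraph 3 V H \<Longrightarrow> n0 \<le> card V \<Longrightarrow>
    \<epsilon> * real (card V) ^ 2 \<le> real (card H) \<Longrightarrow>
    (\<exists>F\<subseteq>H. finite F \<and> card F = e \<and> card (\<Union>F) \<le> e + (2 * k + k + 2))"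
    using dense_configuration[OF \<epsilon>, of "2 * k" k e, where 'a = 'a] k e by auto
  show ?thesis
  proof (rule exI[of _ n0], intro allI impI)
    fix V :: "'a set" and E
    assume "uniform_hypergraph 3 V E \<and> n0 \<le> card V \<and> \<epsilon> * real (card V) ^ 2 \<le> real (card E)"
    then obtain F where F: "F \<subseteq> E" "finite F" "card F = e" "card (\<Union>F) \<le> e + (2 * k + k + 2)" using n0 by blast
    have "real (card (\<Union>F)) \<le> real (e + (2 * k + k + 2))" using F(4) by (simp only: of_nat_le_iff)
    also have "\<dots> \<le> real e + 18 * ln (real e) / ln (ln (real e))" using bound by simp
    finally show "contains_configuration E (real e + 18 * ln (real e) / ln (ln (real e))) e"
      unfolding contains_configuration_def using F(1-3) by blast
  qed
qed

theorem theorem1p2: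
  fixes e :: nat
  assumes "e \<ge> 3"
  shows "(\<lambda>n. real (max_edges 3 n (real e + 18 * ln (real e) / ln (ln (real e))) e))
           \<in> o(\<lambda>n. real n ^ 2)
       \<and> (\<forall>\<epsilon>::real. 0 < \<epsilon> \<and> \<epsilon> < 1 \<longrightarrow>
            (\<exists>n0::nat. \<forall>(V :: 'a set) E.
               uniform_hypergraph 3 V E \<and> card V \<ge> n0
                 \<and> real (card E) \<ge> \<epsilon> * real (card V) ^ 2 \<longrightarrow>
               contains_configuration E (real e + 18 * ln (real e) / ln (ln (real e))) e))"
proof
  let ?v = "real e + 18 * ln (real e) / ln (ln (real e))"
  show "(\<lambda>n. real (max_edges 3 n ?v e)) \<in> o(\<lambda>n. real n ^ 2)"
  proof (rule landau_o.smallI)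
    fix c :: real assume c: "0 < c"
    obtain n0 where n0: "\<And>(V :: nat set) E. uniform_hypergraph 3 V E \<Longrightarrow> n0 \<le> card V \<Longrightarrow>
        c * real (card V) ^ 2 \<le> real (card E) \<Longrightarrow> contains_configuration E ?v e"
      using brown_erdos_sos_density[OF assms c, where 'a = nat] by blast
    have "norm (real (max_edges 3 n ?v e)) \<le> c * norm (real n ^ 2)" if n: "n0 \<le> n" for n
    proof -
      let ?S = "{card E | E. uniform_hypergraph 3 {..<n} E \<and> \<not> contains_configuration E ?v e}"
      have "?S \<subseteq> card ` Pow (Pow {..<n})" by (auto simp: uniform_hypergraph_def)
      then have "finite ?S" by (rule finite_subset) simp
      \<comment> \<open>The edgeless hypergraph contains no configuration because
        \<open>e > 0\<close>, so the maximum is over a nonempty set.\<close>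
      moreover have "card {} \<in> ?S"
        using assms by (intro CollectI exI[of _ "{}"]) (auto simp: uniform_hypergraph_def contains_configuration_def)
      ultimately have "Max ?S \<in> ?S" by (intro Max_in) auto
      then obtain E where E: "max_edges 3 n ?v e = card E" "uniform_hypergraph 3 {..<n} E"
        "\<not> contains_configuration E ?v e" unfolding max_edges_def by blast
      have "real (card E) < c * real n ^ 2" using n0[OF E(2)] E(3) n by (force simp: not_le)
      then show ?thesis using E(1) by simp
    qed
    then show "\<forall>\<^sub>F n in at_top. norm (real (max_edges 3 n ?v e)) \<le> c * norm (real n ^ 2)"
      by (auto simp: eventually_at_top_linorder)
  qed
  show "\<forall>\<epsilon>::real. 0 < \<epsilon> \<and> \<epsilon> < 1 \<longrightarrow>
            (\<exists>n0::nat. \<forall>(V :: 'a set) E.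
               uniform_hypergraph 3 V E \<and> card V \<ge> n0
                 \<and> real (card E) \<ge> \<epsilon> * real (card V) ^ 2 \<longrightarrow> contains_configuration E ?v e)"
    using brown_erdos_sos_density[OF assms] by blast
qed

end
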